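(* There is a real number $T < 1.786\cdot\sqrt{2}$ such that, with $S=\sqrt{2}$, the pair $(S,T)$ is a feasible space-time tradeoff for TSP; in particular $S\cdot T < 3.572$.
   Context: TSP: given $n$ cities $c_1,\dots,c_n$ and real distances $d(c_i,c_j)$, compute the minimum over permutations $\pi$ of $[n]$ of $d(c_{\pi(n)},c_{\pi(1)})+\sum_{i=1}^{n-1} d(c_{\pi(i)},c_{\pi(i+1)})$. A pair $(S,T)$ of reals is a feasible space-time tradeoff for TSP if there is an algorithm that solves every TSP instance on $n$ cities simultaneously in time $T^{n+o(n)}$ and space $S^{n+o(n)}$. *)

theory Defs
  imports Complex_Main "HOL-Combinatorics.Permutations" "HOL-Library.Landau_Symbols"
begin

definition tour_length :: "nat \<Rightarrow> (nat \<Rightarrow> nat \<Rightarrow> real) \<Rightarrow> (nat \<Rightarrow> nat) \<Rightarrow> real" where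
  "tour_length n d \<pi> = d (\<pi> n) (\<pi> 1) + (\<Sum>i = 1..n - 1. d (\<pi> i) (\<pi> (i + 1)))"

definition tsp_opt :: "nat \<Rightarrow> (nat \<Rightarrow> nat \<Rightarrow> real) \<Rightarrow> real" where
  "tsp_opt n d = Min {tour_length n d \<pi> | \<pi>. \<pi> permutes {1..n}}"

text \<open>
  The machine model is a real RAM with two banks of random-access memory, one of integer words and
  one of real numbers, plus the registers named in the program (a number independent of the input).
  Programs are finite and do not depend on the number of cities. Integer arithmetic is that of
  \<^typ>\<open>nat\<close>. The only operations on reals are addition, subtraction and comparison, and there is no
  conversion between reals and integers.
\<close>

type_synonym reg = nat

datatype iexp =
    IConst nat
  | IReg reg
  | IAdd iexp iexp
  | ISub iexp iexp
  | IMul iexp iexp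
  | IDiv iexp iexp
  | IMod iexp iexp

datatype rexp =
    RZero
  | RReg reg
  | RAdd rexp rexp
  | RSub rexp rexp

datatype bexp =
    ILess iexp iexp
  | RLess rexp rexp
  | BNot bexp
  | BAnd bexp bexp

datatype com =
    Skip
  | ISet reg iexp
  | ILoad reg iexp
  | IStore iexp iexp
  | RSet reg rexp
  | RLoad reg iexp
  | RStore iexp rexp
  | Seq com com
  | Cond bexp com com
  | While bexp com

record state =
  ireg :: "reg \<Rightarrow> nat"
  imem :: "nat \<Rightarrow> nat"
  rreg :: "reg \<Rightarrow> real"
  rmem :: "nat \<Rightarrow> real"

fun ival :: "state \<Rightarrow> iexp \<Rightarrow> nat" where
  "ival s (IConst c) = c"
| "ival s (IReg x) = ireg s x"
| "ival s (IAdd a b) = ival s a + ival s b"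
| "ival s (ISub a b) = ival s a - ival s b"
| "ival s (IMul a b) = ival s a * ival s b"
| "ival s (IDiv a b) = ival s a div ival s b"
| "ival s (IMod a b) = ival s a mod ival s b"

fun rval :: "state \<Rightarrow> rexp \<Rightarrow> real" where
  "rval s RZero = 0"
| "rval s (RReg x) = rreg s x"
| "rval s (RAdd a b) = rval s a + rval s b"
| "rval s (RSub a b) = rval s a - rval s b"

fun bval :: "state \<Rightarrow> bexp \<Rightarrow> bool" where
  "bval s (ILess a b) \<longleftrightarrow> ival s a < ival s b"
| "bval s (RLess a b) \<longleftrightarrow> rval s a < rval s b"
| "bval s (BNot b) \<longleftrightarrow> \<not> bval s b"
| "bval s (BAnd b c) \<longleftrightarrow> bval s b \<and> bval s c"

text \<open>
  \<open>exec w D m c s t s'\<close>: started in state \<open>s\<close>, program \<open>c\<close> halts in state \<open>s'\<close> after \<open>t\<close> steps, on a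
  machine with \<open>m\<close> cells in each memory bank. There is no such derivation if the program accesses an
  address outside \<open>{..<m}\<close>, stores an integer of more than \<open>w\<close> bits, or stores a real of absolute
  value more than \<open>2 ^ w * D\<close>, where \<open>D\<close> is the scale of the input.

  The bound on reals is the counterpart of the word length. Without it a single real cell could hold
  arbitrarily long bit strings, readable through doubling and comparison, and the number of cells
  would no longer measure space. On integer inputs every stored real is an integer, so the bound
  limits a real cell to about \<open>w + log D\<close> bits.

  Expressions need no bounds of their own: they have constant size, so their intermediate values
  exceed the word length by at most a constant factor and their evaluation costs \<open>O(1)\<close> operations.
\<close>

inductive exec :: "nat \<Rightarrow> real \<Rightarrow> nat \<Rightarrow> com \<Rightarrow> state \<Rightarrow> nat \<Rightarrow> state \<Rightarrow> bool"
  for w :: nat and D :: real and m :: nat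
where
  Skip: "exec w D m Skip s 1 s"
| ISet: "ival s a < 2 ^ w \<Longrightarrow>
    exec w D m (ISet x a) s 1 (s\<lparr>ireg := (ireg s)(x := ival s a)\<rparr>)"
| ILoad: "ival s a < m \<Longrightarrow>
    exec w D m (ILoad x a) s 1 (s\<lparr>ireg := (ireg s)(x := imem s (ival s a))\<rparr>)"
| IStore: "ival s a < m \<Longrightarrow> ival s b < 2 ^ w \<Longrightarrow>
    exec w D m (IStore a b) s 1 (s\<lparr>imem := (imem s)(ival s a := ival s b)\<rparr>)"
| RSet: "\<bar>rval s r\<bar> \<le> 2 ^ w * D \<Longrightarrow>
    exec w D m (RSet x r) s 1 (s\<lparr>rreg := (rreg s)(x := rval s r)\<rparr>)"
| RLoad: "ival s a < m \<Longrightarrow>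
    exec w D m (RLoad x a) s 1 (s\<lparr>rreg := (rreg s)(x := rmem s (ival s a))\<rparr>)"
| RStore: "ival s a < m \<Longrightarrow> \<bar>rval s r\<bar> \<le> 2 ^ w * D \<Longrightarrow>
    exec w D m (RStore a r) s 1 (s\<lparr>rmem := (rmem s)(ival s a := rval s r)\<rparr>)"
| Seq: "exec w D m c s t s' \<Longrightarrow> exec w D m c' s' t' s'' \<Longrightarrow>
    exec w D m (Seq c c') s (t + t') s''"
| CondTrue: "bval s b \<Longrightarrow> exec w D m c s t s' \<Longrightarrow>
    exec w D m (Cond b c c') s (1 + t) s'"
| CondFalse: "\<not> bval s b \<Longrightarrow> exec w D m c' s t s' \<Longrightarrow>
    exec w D m (Cond b c c') s (1 + t) s'"
| WhileFalse: "\<not> bval s b \<Longrightarrow> exec w D m (While b c) s 1 s"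
| WhileTrue: "bval s b \<Longrightarrow> exec w D m c s t s' \<Longrightarrow> exec w D m (While b c) s' t' s'' \<Longrightarrow>
    exec w D m (While b c) s (1 + t + t') s''"

inductive_cases exec_SkipE: "exec w D m Skip s t s'"
inductive_cases exec_ISetE: "exec w D m (ISet x a) s t s'"
inductive_cases exec_ILoadE: "exec w D m (ILoad x a) s t s'"
inductive_cases exec_IStoreE: "exec w D m (IStore a b) s t s'"
inductive_cases exec_RSetE: "exec w D m (RSet x r) s t s'"
inductive_cases exec_RLoadE: "exec w D m (RLoad x a) s t s'"
inductive_cases exec_RStoreE: "exec w D m (RStore a r) s t s'"
inductive_cases exec_SeqE: "exec w D m (Seq c c') s t s'"
inductive_cases exec_CondE: "exec w D m (Cond b c c') s t s'"
inductive_cases exec_WhileE: "exec w D m (While b c) s t s'"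

lemma exec_deterministic:
  "exec w D m c s t s' \<Longrightarrow> exec w D m c s u s'' \<Longrightarrow> t = u \<and> s' = s''"
proof (induction arbitrary: u s'' rule: exec.induct)
  case (Seq c s t s' c' t' s1)
  from Seq.prems obtain t1 s2 t2
    where "exec w D m c s t1 s2" "exec w D m c' s2 t2 s''" "u = t1 + t2"
    by (rule exec_SeqE)
  with Seq.IH show ?case by blast
next
  case (CondTrue s b c t s' c')
  from CondTrue.prems CondTrue.hyps(1) obtain t1 where "exec w D m c s t1 s''" "u = 1 + t1"
    by (elim exec_CondE) simp_all
  with CondTrue.IH show ?case by blast
next
  case (CondFalse s b c' t s' c)
  from CondFalse.prems CondFalse.hyps(1) obtain t1 where "exec w D m c' s t1 s''" "u = 1 + t1"
    by (elim exec_CondE) simp_all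
  with CondFalse.IH show ?case by blast
next
  case (WhileFalse s b c)
  from WhileFalse.prems show ?case
    by (rule exec_WhileE) (use WhileFalse.hyps in simp_all)
next
  case (WhileTrue s b c t s' t' s1)
  from WhileTrue.prems obtain t1 s2 t2
    where "exec w D m c s t1 s2" "exec w D m (While b c) s2 t2 s''" "u = 1 + t1 + t2"
    by (rule exec_WhileE) (use WhileTrue.hyps(1) in simp_all)
  with WhileTrue.IH show ?case by blast
qed (auto elim!: exec_SkipE exec_ISetE exec_ILoadE exec_IStoreE exec_RSetE exec_RLoadE exec_RStoreE)

text \<open>
  The input consists of the number of cities in integer register 0 and the distance matrix, row by
  row, at the start of the real memory.
\<close>

definition tsp_input :: "nat \<Rightarrow> (nat \<Rightarrow> nat \<Rightarrow> real) \<Rightarrow> state" where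
  "tsp_input n d =
    \<lparr>ireg = (\<lambda>_. 0)(0 := n),
     imem = (\<lambda>_. 0),
     rreg = (\<lambda>_. 0),
     rmem = (\<lambda>k. if k < n * n then d (k div n + 1) (k mod n + 1) else 0)\<rparr>"

definition max_dist :: "nat \<Rightarrow> (nat \<Rightarrow> nat \<Rightarrow> real) \<Rightarrow> real" where
  "max_dist n d = Max {\<bar>d i j\<bar> | i j. i \<in> {1..n} \<and> j \<in> {1..n}}"

text \<open>
  \<open>solves_tsp c k n d t p\<close>: with words of \<open>k * n\<close> bits and \<open>p\<close> memory cells in total, which must be
  enough to hold the input, \<open>c\<close> halts after \<open>t\<close> steps with the optimum in real register 0.
\<close>

definition solves_tsp :: "com \<Rightarrow> nat \<Rightarrow> nat \<Rightarrow> (nat \<Rightarrow> nat \<Rightarrow> real) \<Rightarrow> nat \<Rightarrow> nat \<Rightarrow> bool" where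
  "solves_tsp c k n d t p \<longleftrightarrow>
    (\<exists>m s. p = 2 * m \<and> n * n \<le> m \<and>
      exec (k * n) (max_dist n d) m c (tsp_input n d) t s \<and> rreg s 0 = tsp_opt n d)"

definition feasible_tradeoff :: "real \<Rightarrow> real \<Rightarrow> bool" where
  "feasible_tradeoff S T \<longleftrightarrow> 0 < S \<and> 0 < T \<and>
    (\<exists>c k. \<exists>f \<in> o(\<lambda>n. real n). \<exists>g \<in> o(\<lambda>n. real n). \<forall>n \<ge> 1. \<forall>d. \<exists>t p.
      solves_tsp c k n d t p \<and>
      real t \<le> T powr (real n + f n) \<and> real p \<le> S powr (real n + g n))"

end

theory Submission
  imports Defs "HOL-Combinatorics.Multiset_Permutations" "HOL-Real_Asymp.Real_Asymp"
begin

text \<open>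
  For a family \<open>F\<close> of subsets of the cities, dynamic programming restricted to \<open>F\<close> finds the best
  tour all of whose prefixes lie in \<open>F\<close>, in time and space \<open>card F\<close> up to polynomial factors. So it
  suffices to cover all orderings by few small families, and since products of families on disjoint
  blocks cover all interleavings, it suffices to do this on a block of constant size \<open>b\<close>: \<open>N\<close>
  families with \<open>M\<close> sets each, \<open>M \<le> sqrt 2 ^ b\<close> and \<open>N < 1.786 ^ b\<close>. The families for a block can be
  hard-wired into the program as tables.

  On \<open>2 l\<close> elements take, for a set \<open>L\<close> of size \<open>l\<close>, all subsets of \<open>L\<close>, all supersets of \<open>L\<close> and
  the Hamming ball of radius \<open>0.22 l\<close> around \<open>L\<close>. These are at most \<open>3 * 2 ^ l\<close> sets. A given ordering
  is covered by every \<open>L\<close> that contains its first part, avoids its last part, and contains half of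
  each short interval of its middle part; so the fraction of good \<open>L\<close> is about \<open>2 powr (- 0.8 * 2 l)\<close>.
  A product with two families that consist of a single chain absorbs the factor \<open>3\<close>. A large power of
  the result, together with the greedy bound for covers in terms of fractional covers, gives \<open>N\<close> and \<open>M\<close>.
\<close>

section \<open>Covering orderings by set families\<close>

text \<open>The sweeps for different families use the same memory one after the other, so a block
  contributes a factor \<open>M\<close> to the space and \<open>N * M\<close> to the time. A larger
  tube radius would admit more centres \<open>L\<close> for a given ordering but makes the families
  larger; \<open>0.22 l\<close> is the point where the Hamming ball in dimension \<open>2 l\<close>
  has about \<open>2 ^ l\<close> elements, like the two subcubes, because the binary entropy at
  \<open>0.11\<close> is about \<open>1 / 2\<close>. Longer intervals in the middle part lose less
  in the count of balanced subsets but need more slack in the radius; length \<open>22\<close> is a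
  compromise. Fractional covers are used because their ratio multiplies without loss under products,
  whereas passing to an actual cover costs a factor polynomial in the block size. This is therefore
  done only once, on a high power, where the gap between \<open>2 ^ 1340\<close> and
  \<open>1.786 ^ 1616\<close> outgrows that factor.\<close>

definition covers :: "'a set set \<Rightarrow> 'a list \<Rightarrow> bool" where
  "covers F xs \<longleftrightarrow> (\<forall>ys zs. xs = ys @ zs \<longrightarrow> set ys \<in> F)"

text \<open>A member drawn uniformly from \<open>Fs\<close> covers each fixed ordering with
  probability at least \<open>1 / C\<close>. Lists count with multiplicity, as different pairs of
  factors may be glued to the same family. The empty set is demanded even of members that cover
  nothing, since code \<open>0\<close> will stand for it in every family.\<close>

definition frac_cover :: "nat \<Rightarrow> nat \<Rightarrow> real \<Rightarrow> bool" where
  "frac_cover b M C \<longleftrightarrow> (\<exists>Fs. Fs \<noteq> [] \<and>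
     (\<forall>F \<in> set Fs. {} \<in> F \<and> F \<subseteq> Pow {..<b} \<and> card F \<le> M) \<and>
     (\<forall>xs \<in> permutations_of_set {..<b}.
        real (length Fs) \<le> C * real (length (filter (\<lambda>F. covers F xs) Fs))))"

text \<open>The list contains, for every ordering, the chain of its own prefixes. A chain is tiny,
  at the price of the large ratio \<open>b!\<close>.\<close>

lemma frac_cover_chain: "frac_cover b (Suc b) (fact b)"
proof -
  define pre :: "nat list \<Rightarrow> nat set set" where "pre xs = (\<lambda>j. set (take j xs)) ` {..b}" for xs
  obtain xss where xss: "set xss = permutations_of_set {..<b}" "distinct xss"
    using finite_distinct_list[of "permutations_of_set {..<b}"] by auto
  have len: "length xss = fact b"
    using distinct_card[OF xss(2)] by (simp add: xss(1))
  have pre: "{} \<in> pre xs \<and> pre xs \<subseteq> Pow {..<b} \<and> card (pre xs) \<le> Suc b"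
    if "xs \<in> permutations_of_set {..<b}" for xs
  proof -
    have "card (pre xs) \<le> card {..b}" unfolding pre_def by (rule card_image_le) simp
    moreover have "{} \<in> pre xs" unfolding pre_def by (rule image_eqI[of _ _ 0]) auto
    moreover have "pre xs \<subseteq> Pow {..<b}"
      using that by (auto simp: pre_def permutations_of_set_def dest: in_set_takeD)
    ultimately show ?thesis by simp
  qed
  have cov: "covers (pre xs) xs" if "xs \<in> permutations_of_set {..<b}" for xs
  proof -
    have "length xs = b"
      using that distinct_card[of xs] by (auto simp: permutations_of_set_def)
    then show ?thesis
      unfolding covers_def pre_def
    proof (intro allI impI)
      fix ys zs assume "length xs = b" "xs = ys @ zs"
      then show "set ys \<in> (\<lambda>j. set (take j xs)) ` {..b}"
        by (intro image_eqI[of _ _ "length ys"]) auto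
    qed
  qed
  have "1 \<le> length (filter (\<lambda>F. covers F xs) (map pre xss))"
    if "xs \<in> permutations_of_set {..<b}" for xs
  proof -
    have "pre xs \<in> set (filter (\<lambda>F. covers F xs) (map pre xss))" using that cov xss by auto
    then have "filter (\<lambda>F. covers F xs) (map pre xss) \<noteq> []" by (metis empty_iff list.set(1))
    then show ?thesis by (metis One_nat_def Suc_leI length_greater_0_conv)
  qed
  then show ?thesis
    unfolding frac_cover_def using pre xss len by (intro exI[of _ "map pre xss"]) force
qed

lemma length_filter_product:
  "length (filter (\<lambda>(x, y). P x \<and> Q y) (List.product xs ys)) =
    length (filter P xs) * length (filter Q ys)"
proof (induction xs)
  case (Cons x xs)
  then show ?case by (simp add: filter_map o_def)
qed simp

lemma covers_filter:
  assumes "covers F (filter P xs)" and "xs = ys @ zs"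
  shows "{x \<in> set ys. P x} \<in> F"
proof -
  have "filter P xs = filter P ys @ filter P zs" using assms(2) by simp
  with assms(1) have "set (filter P ys) \<in> F" unfolding covers_def by blast
  then show ?thesis by simp
qed

text \<open>A prefix of an interleaving meets each block in a prefix of the induced ordering, so a
  glued family covers whatever its two factors cover separately. Counting pairs then multiplies the
  ratios.\<close>

lemma frac_cover_product:
  assumes "frac_cover b M C" "frac_cover b' M' C'" "0 \<le> C" "0 \<le> C'"
  shows "frac_cover (b + b') (M * M') (C * C')"
proof -
  obtain Fs where Fs: "Fs \<noteq> []" "\<And>F. F \<in> set Fs \<Longrightarrow> {} \<in> F \<and> F \<subseteq> Pow {..<b} \<and> card F \<le> M"
    "\<And>xs. xs \<in> permutations_of_set {..<b} \<Longrightarrow>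
      real (length Fs) \<le> C * real (length (filter (\<lambda>F. covers F xs) Fs))"
    using assms(1) unfolding frac_cover_def by blast
  obtain Gs where Gs: "Gs \<noteq> []" "\<And>F. F \<in> set Gs \<Longrightarrow> {} \<in> F \<and> F \<subseteq> Pow {..<b'} \<and> card F \<le> M'"
    "\<And>xs. xs \<in> permutations_of_set {..<b'} \<Longrightarrow>
      real (length Gs) \<le> C' * real (length (filter (\<lambda>F. covers F xs) Gs))"
    using assms(2) unfolding frac_cover_def by blast
  define glue :: "nat set set \<times> nat set set \<Rightarrow> nat set set"
    where "glue = (\<lambda>(F, G). (\<lambda>(X, Y). X \<union> (+) b ` Y) ` (F \<times> G))"
  have glue: "{} \<in> glue (F, G) \<and> glue (F, G) \<subseteq> Pow {..<b + b'} \<and> card (glue (F, G)) \<le> M * M'"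
    if "F \<in> set Fs" "G \<in> set Gs" for F G
  proof -
    have sub: "F \<subseteq> Pow {..<b}" "G \<subseteq> Pow {..<b'}" using Fs(2)[OF that(1)] Gs(2)[OF that(2)] by auto
    then have fin: "finite F" "finite G" by (auto intro: finite_subset)
    have "card (glue (F, G)) \<le> card (F \<times> G)"
      unfolding glue_def prod.case using fin by (intro card_image_le) auto
    also have "\<dots> \<le> M * M'"
      using Fs(2)[OF that(1)] Gs(2)[OF that(2)] by (simp add: card_cartesian_product mult_le_mono)
    finally have "card (glue (F, G)) \<le> M * M'" .
    moreover have "{} \<in> glue (F, G)"
      unfolding glue_def using Fs(2)[OF that(1)] Gs(2)[OF that(2)]
      by (auto intro!: image_eqI[of _ _ "({}, {})"])
    moreover have "glue (F, G) \<subseteq> Pow {..<b + b'}"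
      unfolding glue_def using sub by fastforce
    ultimately show ?thesis by simp
  qed
  have cov: "covers (glue (F, G)) xs"
    if F: "covers F (filter (\<lambda>x. x < b) xs)"
      and G: "covers G (map (\<lambda>x. x - b) (filter (\<lambda>x. \<not> x < b) xs))" for F G xs
    unfolding covers_def
  proof (intro allI impI)
    fix ys zs assume xs: "xs = ys @ zs"
    have 1: "{x \<in> set ys. x < b} \<in> F" using covers_filter[OF F xs] .
    have "map (\<lambda>x. x - b) (filter (\<lambda>x. \<not> x < b) xs) =
      map (\<lambda>x. x - b) (filter (\<lambda>x. \<not> x < b) ys) @ map (\<lambda>x. x - b) (filter (\<lambda>x. \<not> x < b) zs)"
      using xs by simp
    with G have 2: "set (map (\<lambda>x. x - b) (filter (\<lambda>x. \<not> x < b) ys)) \<in> G"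
      unfolding covers_def by blast
    have "set ys = {x \<in> set ys. x < b} \<union> (+) b ` set (map (\<lambda>x. x - b) (filter (\<lambda>x. \<not> x < b) ys))"
      by (auto simp: image_image)
    with 1 2 show "set ys \<in> glue (F, G)" unfolding glue_def by blast
  qed
  define Hs where "Hs = map glue (List.product Fs Gs)"
  have "real (length Hs) \<le> C * C' * real (length (filter (\<lambda>F. covers F xs) Hs))"
    if xs: "xs \<in> permutations_of_set {..<b + b'}" for xs
  proof -
    define us where "us = filter (\<lambda>x. x < b) xs"
    define vs where "vs = map (\<lambda>x. x - b) (filter (\<lambda>x. \<not> x < b) xs)"
    have sx: "set xs = {..<b + b'}" "distinct xs"
      using xs by (auto simp: permutations_of_set_def)
    have us: "us \<in> permutations_of_set {..<b}"
    proof (rule permutations_of_setI)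
      show "set us = {..<b}" by (auto simp: us_def sx(1))
    qed (simp add: us_def sx(2))
    have "(\<lambda>x. x - b) ` {x \<in> {..<b + b'}. \<not> x < b} = {..<b'}"
    proof (intro equalityI subsetI)
      fix y assume "y \<in> {..<b'}"
      then show "y \<in> (\<lambda>x. x - b) ` {x \<in> {..<b + b'}. \<not> x < b}"
        by (intro image_eqI[of _ _ "b + y"]) auto
    qed auto
    then have vs: "vs \<in> permutations_of_set {..<b'}"
    proof (intro permutations_of_setI)
      assume "(\<lambda>x. x - b) ` {x \<in> {..<b + b'}. \<not> x < b} = {..<b'}"
      then show "set vs = {..<b'}" by (simp add: vs_def sx(1))
      show "distinct vs" using sx(2) by (auto simp: vs_def distinct_map inj_on_def)
    qed
    have "real (length Hs) = real (length Fs) * real (length Gs)"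
      by (simp add: Hs_def length_product)
    also have "\<dots> \<le> (C * real (length (filter (\<lambda>F. covers F us) Fs))) *
        (C' * real (length (filter (\<lambda>F. covers F vs) Gs)))"
      using Fs(3)[OF us] Gs(3)[OF vs] assms(3,4) by (intro mult_mono) auto
    also have "\<dots> = C * C' * real (length (filter (\<lambda>(F, G). covers F us \<and> covers G vs) (List.product Fs Gs)))"
      by (simp add: length_filter_product)
    also have "\<dots> \<le> C * C' * real (length (filter (\<lambda>F. covers F xs) Hs))"
    proof (rule mult_left_mono)
      have "length (filter (\<lambda>(F, G). covers F us \<and> covers G vs) ps)
          \<le> length (filter (\<lambda>p. covers (glue p) xs) ps)" for ps
        by (induction ps) (auto simp: cov us_def vs_def)
      then show "real (length (filter (\<lambda>(F, G). covers F us \<and> covers G vs) (List.product Fs Gs)))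
          \<le> real (length (filter (\<lambda>F. covers F xs) Hs))"
        by (simp add: Hs_def filter_map o_def)
    qed (use assms in auto)
    finally show ?thesis .
  qed
  moreover have "Hs \<noteq> []" using Fs(1) Gs(1) by (simp add: Hs_def product_concat_map neq_Nil_conv) auto
  moreover have "\<forall>F \<in> set Hs. {} \<in> F \<and> F \<subseteq> Pow {..<b + b'} \<and> card F \<le> M * M'"
    unfolding Hs_def using glue by auto
  ultimately show ?thesis unfolding frac_cover_def by blast
qed

lemma frac_cover_power:
  assumes "frac_cover b M C" "0 \<le> C" "0 < k"
  shows "frac_cover (k * b) (M ^ k) (C ^ k)"
  using assms(3)
proof (induction k rule: nat_induct_non_zero)
  case 1
  then show ?case using assms(1) by simp
next
  case (Suc n)
  then show ?case using frac_cover_product[OF assms(1) Suc.IH] assms(2) by simp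
qed

section \<open>Tubes: their size, and how many of them cover an ordering\<close>

lemma card_balanced_choices_ge:
  fixes Gs :: "'a list list"
  assumes "distinct (concat Gs)" "\<And>G. G \<in> set Gs \<Longrightarrow> length G = 2 * q"
  shows "((2 * q) choose q) ^ length Gs \<le>
    card {L. L \<subseteq> set (concat Gs) \<and> (\<forall>G \<in> set Gs. card (L \<inter> set G) = q)}"
  using assms
proof (induction Gs)
  case Nil
  then show ?case by simp
next
  case (Cons G Gs)
  define S where "S = {L. L \<subseteq> set G \<and> card L = q}"
  define R where "R = {L. L \<subseteq> set (concat Gs) \<and> (\<forall>G \<in> set Gs. card (L \<inter> set G) = q)}"
  have dG: "distinct G" and disj: "set G \<inter> set (concat Gs) = {}" using Cons.prems(1) by auto
  have "card (set G) = 2 * q" using distinct_card[OF dG] Cons.prems(2)[of G] by simp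
  then have cS: "card S = (2 * q) choose q" unfolding S_def by (simp add: n_subsets)
  have cR: "((2 * q) choose q) ^ length Gs \<le> card R"
    unfolding R_def by (rule Cons.IH) (use Cons.prems in auto)
  have finR: "finite R" unfolding R_def by (rule finite_subset[of _ "Pow (set (concat Gs))"]) auto
  have finS: "finite S" unfolding S_def by (rule finite_subset[of _ "Pow (set G)"]) auto
  have inj: "inj_on (\<lambda>(X, Y). X \<union> Y) (S \<times> R)"
  proof (rule inj_on_inverseI[of _ "\<lambda>L. (L \<inter> set G, L - set G)"])
    fix p assume "p \<in> S \<times> R"
    then obtain X Y where p: "p = (X, Y)" "X \<subseteq> set G" "Y \<subseteq> set (concat Gs)"
      by (auto simp: S_def R_def)
    have "(X \<union> Y) \<inter> set G = X" "(X \<union> Y) - set G = Y" using p disj by blast+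
    then show "((case p of (X, Y) \<Rightarrow> X \<union> Y) \<inter> set G, (case p of (X, Y) \<Rightarrow> X \<union> Y) - set G) = p"
      using p(1) by simp
  qed
  have sub: "(\<lambda>(X, Y). X \<union> Y) ` (S \<times> R) \<subseteq>
    {L. L \<subseteq> set (concat (G # Gs)) \<and> (\<forall>H \<in> set (G # Gs). card (L \<inter> set H) = q)}"
  proof
    fix L assume "L \<in> (\<lambda>(X, Y). X \<union> Y) ` (S \<times> R)"
    then obtain X Y where L: "L = X \<union> Y" "X \<subseteq> set G" "card X = q" "Y \<subseteq> set (concat Gs)"
      "\<forall>G \<in> set Gs. card (Y \<inter> set G) = q" by (auto simp: S_def R_def)
    have "L \<inter> set G = X" using L disj by blast
    moreover have "L \<inter> set H = Y \<inter> set H" if "H \<in> set Gs" for H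
    proof -
      have "set H \<subseteq> set (concat Gs)" using that by auto
      then show ?thesis using L disj by blast
    qed
    moreover have "L \<subseteq> set (concat (G # Gs))" using L by auto
    ultimately show "L \<in> {L. L \<subseteq> set (concat (G # Gs)) \<and> (\<forall>H \<in> set (G # Gs). card (L \<inter> set H) = q)}"
      using L by simp
  qed
  have "((2 * q) choose q) ^ length (G # Gs) \<le> card (S \<times> R)"
    using cR cS by (simp add: card_cartesian_product)
  also have "\<dots> = card ((\<lambda>(X, Y). X \<union> Y) ` (S \<times> R))"
    using card_image[OF inj] by simp
  also have "\<dots> \<le> card {L. L \<subseteq> set (concat (G # Gs)) \<and> (\<forall>H \<in> set (G # Gs). card (L \<inter> set H) = q)}"
    by (rule card_mono[OF _ sub]) (rule finite_subset[of _ "Pow (set (concat (G # Gs)))"], auto)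
  finally show ?case .
qed

lemma ex_chunks:
  assumes "length xs = k * g"
  shows "\<exists>Gs. concat Gs = xs \<and> length Gs = g \<and> (\<forall>G \<in> set Gs. length G = k)"
  using assms
proof (induction g arbitrary: xs)
  case 0
  then show ?case by simp
next
  case (Suc g)
  obtain Gs where Gs: "concat Gs = drop k xs" "length Gs = g" "\<forall>G \<in> set Gs. length G = k"
    using Suc.IH[of "drop k xs"] Suc.prems by auto
  have "concat (take k xs # Gs) = xs" using Gs(1) by simp
  moreover have "length (take k xs) = k" using Suc.prems by simp
  ultimately show ?case using Gs by (intro exI[of _ "take k xs # Gs"]) auto
qed

text \<open>Whole groups are balanced, so only the group cut by the end of \<open>ys\<close> can
  cause an imbalance, and at most \<open>q\<close> of its elements lie outside
  \<open>L\<close>.\<close>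

lemma balanced_prefix:
  fixes L :: "'a set"
  assumes "distinct (concat Gs)" "\<And>G. G \<in> set Gs \<Longrightarrow> length G = 2 * q"
    and "\<And>G. G \<in> set Gs \<Longrightarrow> card (L \<inter> set G) = q" and "concat Gs = ys @ zs"
  shows "length ys \<le> 2 * card (L \<inter> set ys) + q"
  using assms
proof (induction Gs arbitrary: ys)
  case Nil
  then show ?case by simp
next
  case (Cons G Gs)
  have G: "length G = 2 * q" "card (L \<inter> set G) = q" "distinct G" using Cons.prems by auto
  have "G @ concat Gs = ys @ zs" using Cons.prems(4) by simp
  then consider us where "ys = G @ us" "concat Gs = us @ zs" | us where "G = ys @ us"
    by (auto simp: append_eq_append_conv2)
  then show ?case
  proof cases
    case (1 us)
    have IH: "length us \<le> 2 * card (L \<inter> set us) + q"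
      using Cons.IH[OF _ _ _ 1(2)] Cons.prems by auto
    have "set G \<inter> set us = {}" using Cons.prems(1) 1(2) by auto
    then have "card (L \<inter> set ys) = card (L \<inter> set G) + card (L \<inter> set us)"
      unfolding 1(1) set_append Int_Un_distrib by (intro card_Un_disjoint) auto
    then show ?thesis using IH G 1(1) by simp
  next
    case (2 us)
    have d: "distinct ys" using G(3) 2 by simp
    have "card (set ys - L) \<le> card (set G - L)" using 2 by (intro card_mono) auto
    also have "\<dots> = q"
      using card_Diff_subset_Int[of "set G" L] G distinct_card[OF G(3)] by (simp add: Int_commute)
    finally have "card (set ys - L) \<le> q" .
    moreover have "card (set ys - L) = length ys - card (L \<inter> set ys)"
      using card_Diff_subset_Int[of "set ys" L] distinct_card[OF d] by (simp add: Int_commute)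
    ultimately show ?thesis by linarith
  qed
qed

definition tube :: "'a set \<Rightarrow> nat \<Rightarrow> 'a set \<Rightarrow> 'a set set" where
  "tube V r L = {A. A \<subseteq> V \<and> (A \<subseteq> L \<or> L \<subseteq> A \<or> card (L - A) + card (A - L) \<le> r)}"

lemma card_tube_le:
  assumes "finite V" "L \<subseteq> V" "card V = 2 * l" "card L = l"
  shows "card (tube V r L) \<le> 2 * 2 ^ l + (\<Sum>k\<le>r. (2 * l) choose k)"
proof -
  have finL: "finite L" using assms(1,2) finite_subset by blast
  define X where "X = {A. A \<subseteq> V \<and> card (L - A) + card (A - L) \<le> r}"
  have "tube V r L \<subseteq> Pow L \<union> (\<union>) L ` Pow (V - L) \<union> X"
  proof
    fix A assume A: "A \<in> tube V r L"
    have "A \<in> (\<union>) L ` Pow (V - L)" if "L \<subseteq> A"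
      using A that by (intro image_eqI[of _ _ "A - L"]) (auto simp: tube_def)
    then show "A \<in> Pow L \<union> (\<union>) L ` Pow (V - L) \<union> X" using A by (auto simp: tube_def X_def)
  qed
  moreover have finX: "finite X"
    unfolding X_def by (rule finite_subset[of _ "Pow V"]) (use assms in auto)
  ultimately have "card (tube V r L) \<le> card (Pow L \<union> (\<union>) L ` Pow (V - L) \<union> X)"
    using assms finL by (intro card_mono) auto
  also have "\<dots> \<le> card (Pow L) + card ((\<union>) L ` Pow (V - L)) + card X"
    by (meson add_le_mono1 card_Un_le order_trans)
  also have "card (Pow L) = 2 ^ l" using finL assms by (simp add: card_Pow)
  also have "card ((\<union>) L ` Pow (V - L)) \<le> card (Pow (V - L))"
    using assms by (intro card_image_le) auto
  also have "card (Pow (V - L)) = 2 ^ l"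
    using assms finL by (simp add: card_Pow card_Diff_subset)
  also have "card X \<le> (\<Sum>k\<le>r. (2 * l) choose k)"
  proof -
    \<comment> \<open>Symmetric difference with \<open>L\<close> is an involution that carries the
      ball around \<open>L\<close> to sets of at most \<open>r\<close> elements, which binomials
      count.\<close>
    define sd where "sd A = (L - A) \<union> (A - L)" for A
    have "inj_on sd X" by (rule inj_on_inverseI[of _ sd]) (auto simp: sd_def)
    then have "card X = card (sd ` X)" by (simp add: card_image)
    also have "\<dots> \<le> card (\<Union>k\<le>r. {A. A \<subseteq> V \<and> card A = k})"
    proof (rule card_mono)
      show "sd ` X \<subseteq> (\<Union>k\<le>r. {A. A \<subseteq> V \<and> card A = k})"
      proof
        fix Z assume "Z \<in> sd ` X"
        then obtain A where A: "A \<subseteq> V" "card (L - A) + card (A - L) \<le> r" "Z = sd A"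
          by (auto simp: X_def)
        have "card Z \<le> r" using card_Un_le[of "L - A" "A - L"] A by (simp add: sd_def)
        moreover have "Z \<subseteq> V" using A assms by (auto simp: sd_def)
        ultimately show "Z \<in> (\<Union>k\<le>r. {A. A \<subseteq> V \<and> card A = k})" by auto
      qed
      show "finite (\<Union>k\<le>r. {A. A \<subseteq> V \<and> card A = k})"
        by (rule finite_subset[of _ "Pow V"]) (use assms in auto)
    qed
    also have "\<dots> \<le> (\<Sum>k\<le>r. card {A. A \<subseteq> V \<and> card A = k})" by (rule card_UN_le) simp
    also have "\<dots> = (\<Sum>k\<le>r. (2 * l) choose k)" using assms by (simp add: n_subsets)
    finally show ?thesis .
  qed
  finally show ?thesis by simp
qed

text \<open>Split \<open>xs\<close> into \<open>us\<close>, a middle part \<open>ms\<close> of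
  \<open>g\<close> groups of \<open>2 * q\<close> elements, and \<open>ws\<close>; let
  \<open>L\<close> consist of \<open>us\<close> and \<open>q\<close> elements of each group.
  Prefixes within \<open>us\<close> are subsets of \<open>L\<close>, prefixes containing
  \<open>ms\<close> are supersets, and those in between stay close to \<open>L\<close> by balance.
  The groups are chosen independently, hence the power.\<close>

lemma many_tubes_cover:
  assumes xs: "xs \<in> permutations_of_set V" "card V = 2 * l" and m: "q * g \<le> l"
  shows "((2 * q) choose q) ^ g \<le> card {L. L \<subseteq> V \<and> card L = l \<and> covers (tube V (q * g + q) L) xs}"
proof -
  define m where "m = q * g"
  have sx: "set xs = V" "distinct xs" using xs by (auto simp: permutations_of_set_def)
  have lx: "length xs = 2 * l" using distinct_card[OF sx(2)] sx xs(2) by simp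
  define us where "us = take (l - m) xs"
  define ms where "ms = take (2 * m) (drop (l - m) xs)"
  define ws where "ws = drop (l + m) xs"
  have ml: "m \<le> l" using m m_def by simp
  have xs_eq: "xs = us @ ms @ ws"
  proof -
    have "drop (l - m) xs = ms @ drop (2 * m) (drop (l - m) xs)"
      unfolding ms_def by (rule append_take_drop_id[symmetric])
    also have "drop (2 * m) (drop (l - m) xs) = ws" using ml by (simp add: ws_def add.commute)
    finally show ?thesis unfolding us_def by (metis append_take_drop_id)
  qed
  have len: "length us = l - m" "length ms = 2 * m" using ml lx by (auto simp: us_def ms_def)
  obtain Gs where Gs: "concat Gs = ms" "length Gs = g" "\<forall>G \<in> set Gs. length G = 2 * q"
    using ex_chunks[of ms "2 * q" g] len by (auto simp: m_def algebra_simps)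
  have dis: "distinct us" "distinct ms" "set us \<inter> set ms = {}" "set us \<inter> set ws = {}" "set ms \<inter> set ws = {}"
    using sx(2) unfolding xs_eq by auto
  define R where "R = {L. L \<subseteq> set (concat Gs) \<and> (\<forall>G \<in> set Gs. card (L \<inter> set G) = q)}"
  have cR: "((2 * q) choose q) ^ g \<le> card R"
    using card_balanced_choices_ge[of Gs q] Gs dis unfolding R_def by auto
  have inj: "inj_on ((\<union>) (set us)) R"
    by (rule inj_on_inverseI[of _ "\<lambda>L. L - set us"]) (use dis Gs in \<open>auto simp: R_def\<close>)
  have "(\<union>) (set us) ` R \<subseteq> {L. L \<subseteq> V \<and> card L = l \<and> covers (tube V (q * g + q) L) xs}"
  proof
    fix L assume "L \<in> (\<union>) (set us) ` R"
    then obtain Q where Q: "Q \<subseteq> set ms" "\<forall>G \<in> set Gs. card (Q \<inter> set G) = q" "L = set us \<union> Q"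
      using Gs by (auto simp: R_def)
    have finQ: "finite Q" using Q(1) finite_subset by blast
    have "card Q = m"
    proof -
      have "card (Q \<inter> set (concat Hs)) = q * length Hs"
        if "distinct (concat Hs)" "\<forall>G \<in> set Hs. card (Q \<inter> set G) = q" for Hs
        using that
      proof (induction Hs)
        case (Cons H Hs)
        have "card (Q \<inter> set (concat (H # Hs))) = card (Q \<inter> set H) + card (Q \<inter> set (concat Hs))"
          unfolding concat.simps set_append Int_Un_distrib
          using Cons.prems by (intro card_Un_disjoint) auto
        then show ?case using Cons by simp
      qed simp
      from this[of Gs] have "card (Q \<inter> set ms) = m" using Gs dis Q by (simp add: m_def)
      moreover have "Q \<inter> set ms = Q" using Q by blast
      ultimately show ?thesis by simp
    qed
    moreover have "card (set us) = l - m" using distinct_card[OF dis(1)] len by simp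
    moreover have "set us \<inter> Q = {}" using dis Q by blast
    ultimately have cL: "card L = l" using Q finQ ml by (simp add: card_Un_disjoint)
    have LV: "L \<subseteq> V" using Q sx xs_eq by auto
    have "covers (tube V (q * g + q) L) xs"
      unfolding covers_def
    proof (intro allI impI)
      fix ys zs assume ysz: "xs = ys @ zs"
      then have ysV: "set ys \<subseteq> V" and dys: "distinct ys" using sx by auto
      have "us @ ms @ ws = ys @ zs" using ysz xs_eq by simp
      then consider "set ys \<subseteq> set us" | as where "ys = us @ as" "ms @ ws = as @ zs"
        by (auto simp: append_eq_append_conv2)
      then show "set ys \<in> tube V (q * g + q) L"
      proof cases
        case 1
        then show ?thesis using ysV Q by (auto simp: tube_def)
      next
        case (2 as)
        note as = this
        from 2 consider cs where "ms = as @ cs" | "set ms \<subseteq> set as"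
          by (auto simp: append_eq_append_conv2)
        then show ?thesis
        proof cases
          case (1 cs)
          have bal: "length as \<le> 2 * card (Q \<inter> set as) + q"
            using balanced_prefix[of Gs q Q as cs] Gs 1 dis Q by auto
          have sub: "set us \<union> (Q \<inter> set as) \<subseteq> L \<inter> set ys" using as Q by auto
          have "card (set us \<union> (Q \<inter> set as)) = card (set us) + card (Q \<inter> set as)"
            using finQ dis Q by (intro card_Un_disjoint) auto
          then have ge: "l - m + card (Q \<inter> set as) \<le> card (L \<inter> set ys)"
            using card_mono[OF _ sub] distinct_card[OF dis(1)] len by simp
          have finL: "finite L" using Q finQ by simp
          have a: "card (L - set ys) = l - card (L \<inter> set ys)"
            using card_Diff_subset_Int[of L "set ys"] finL cL by simp
          have b: "card (set ys - L) = length ys - card (L \<inter> set ys)"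
            using card_Diff_subset_Int[of "set ys" L] distinct_card[OF dys] by (simp add: Int_commute)
          have c: "card (L \<inter> set ys) \<le> l" "card (L \<inter> set ys) \<le> length ys"
            using card_mono[of L "L \<inter> set ys"] card_mono[of "set ys" "L \<inter> set ys"] finL cL
              distinct_card[OF dys] by auto
          have "length ys = l - m + length as" using as len by simp
          \<comment> \<open>The left side is
            \<open>l + length ys - 2 * card (L \<inter> set ys)\<close>. Inserting
            \<open>length ys = l - m + length as\<close> and the lower bound \<open>ge\<close>
            leaves at most \<open>m + length as - 2 * card (Q \<inter> set as)\<close>, and
            \<open>bal\<close> applies.\<close>
          then have "card (L - set ys) + card (set ys - L) \<le> m + q"
            using a b c ge bal ml by linarith
          then show ?thesis using ysV by (simp add: tube_def m_def)
        next
          case 2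
          then have "L \<subseteq> set ys" using 2 as Q by auto
          then show ?thesis using ysV by (simp add: tube_def)
        qed
      qed
    qed
    then show "L \<in> {L. L \<subseteq> V \<and> card L = l \<and> covers (tube V (q * g + q) L) xs}" using cL LV by simp
  qed
  then have "card ((\<union>) (set us) ` R) \<le> card {L. L \<subseteq> V \<and> card L = l \<and> covers (tube V (q * g + q) L) xs}"
    by (rule card_mono[rotated]) (rule finite_subset[of _ "Pow V"], use sx in auto)
  then show ?thesis using cR card_image[OF inj] by simp
qed

text \<open>The centre ranges over all \<open>l\<close>-subsets. There are at most
  \<open>4 ^ l\<close> of them, and \<open>many_tubes_cover\<close> counts the good ones for a given
  ordering.\<close>

lemma frac_cover_tube:
  assumes m: "q * g \<le> l"
  shows "frac_cover (2 * l) (2 * 2 ^ l + (\<Sum>k\<le>q * g + q. (2 * l) choose k))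
    (4 ^ l / real ((2 * q) choose q) ^ g)"
proof -
  define V where "V = {..<2 * l}"
  define Ls where "Ls = {L. L \<subseteq> V \<and> card L = l}"
  have V: "finite V" "card V = 2 * l" by (auto simp: V_def)
  have finLs: "finite Ls" unfolding Ls_def by (rule finite_subset[of _ "Pow V"]) (auto simp: V_def)
  obtain ls where ls: "set ls = Ls" "distinct ls" using finite_distinct_list[OF finLs] by auto
  have cLs: "card Ls = (2 * l) choose l" unfolding Ls_def using V by (simp add: n_subsets)
  define Fs where "Fs = map (tube V (q * g + q)) ls"
  have len: "length Fs = (2 * l) choose l" using distinct_card[OF ls(2)] ls cLs by (simp add: Fs_def)
  have le4: "real ((2 * l) choose l) \<le> 4 ^ l"
  proof -
    have "(2 * l) choose l \<le> 2 ^ (2 * l)" by (rule binomial_le_pow2)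
    also have "\<dots> = 4 ^ l" by (simp add: power_mult)
    finally show ?thesis by (metis of_nat_le_iff of_nat_numeral of_nat_power)
  qed
  have "real (length Fs) \<le> 4 ^ l / real ((2 * q) choose q) ^ g * real (length (filter (\<lambda>F. covers F xs) Fs))"
    if xs: "xs \<in> permutations_of_set {..<2 * l}" for xs
  proof -
    have "length (filter (\<lambda>F. covers F xs) Fs) = length (filter (\<lambda>L. covers (tube V (q * g + q) L) xs) ls)"
      by (simp add: Fs_def filter_map o_def)
    also have "\<dots> = card (set (filter (\<lambda>L. covers (tube V (q * g + q) L) xs) ls))"
      using ls(2) by (metis distinct_card distinct_filter)
    also have "set (filter (\<lambda>L. covers (tube V (q * g + q) L) xs) ls) =
        {L. L \<subseteq> V \<and> card L = l \<and> covers (tube V (q * g + q) L) xs}"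
      using ls by (auto simp: Ls_def)
    finally have "((2 * q) choose q) ^ g \<le> length (filter (\<lambda>F. covers F xs) Fs)"
      using many_tubes_cover[of xs V l q g] xs V m by (simp add: V_def)
    then have ge: "real ((2 * q) choose q) ^ g \<le> real (length (filter (\<lambda>F. covers F xs) Fs))"
      by (metis of_nat_le_iff of_nat_power)
    have pos: "0 < real ((2 * q) choose q) ^ g" by simp
    have "real (length Fs) \<le> 4 ^ l * 1" using le4 len by simp
    also have "\<dots> \<le> 4 ^ l * (real (length (filter (\<lambda>F. covers F xs) Fs)) / real ((2 * q) choose q) ^ g)"
      using ge pos by (intro mult_left_mono) (auto simp: le_divide_eq)
    finally show ?thesis by simp
  qed
  moreover have "Fs \<noteq> []" using len by (metis binomial_eq_0_iff list.size(3) mult_2 le_add1 not_less)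
  moreover have "{} \<in> F \<and> F \<subseteq> Pow {..<2 * l} \<and> card F \<le> 2 * 2 ^ l + (\<Sum>k\<le>q * g + q. (2 * l) choose k)"
    if "F \<in> set Fs" for F
  proof -
    obtain L where L: "F = tube V (q * g + q) L" "L \<subseteq> V" "card L = l"
      using \<open>F \<in> set Fs\<close> ls by (auto simp: Fs_def Ls_def)
    have "card F \<le> 2 * 2 ^ l + (\<Sum>k\<le>q * g + q. (2 * l) choose k)"
      unfolding L(1) by (rule card_tube_le) (use V L in auto)
    then show ?thesis using L(1) by (auto simp: tube_def V_def)
  qed
  ultimately show ?thesis unfolding frac_cover_def by blast
qed

text \<open>The weight \<open>1 / 8\<close> is close to the optimal weight \<open>0.11 / 0.89\<close> for \<open>r = 0.11 n\<close>.\<close>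

lemma sum_binomial_le: "real (\<Sum>k\<le>r. n choose k) \<le> (9 / 8) ^ n * 8 ^ r"
proof -
  have "real (\<Sum>k\<le>r. n choose k) = (\<Sum>k\<le>r. real (n choose k))" by simp
  also have "\<dots> \<le> (\<Sum>k\<le>r. real (n choose k) * (1 / 8) ^ k * 8 ^ r)"
  proof (rule sum_mono)
    fix k assume "k \<in> {..r}"
    then have "(8::real) ^ k \<le> 8 ^ r" by (intro power_increasing) auto
    then have "1 \<le> (1 / 8) ^ k * (8::real) ^ r" by (simp add: power_divide)
    then have "real (n choose k) * 1 \<le> real (n choose k) * ((1 / 8) ^ k * 8 ^ r)"
      by (intro mult_left_mono) auto
    then show "real (n choose k) \<le> real (n choose k) * (1 / 8) ^ k * 8 ^ r" by (simp add: mult.assoc)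
  qed
  also have "\<dots> = (\<Sum>k\<le>r. real (n choose k) * (1 / 8) ^ k) * 8 ^ r" by (simp add: sum_distrib_right)
  also have "\<dots> \<le> (\<Sum>k\<le>max n r. real (n choose k) * (1 / 8) ^ k) * 8 ^ r"
    by (intro mult_right_mono sum_mono2) auto
  also have "(\<Sum>k\<le>max n r. real (n choose k) * (1 / 8) ^ k) = (\<Sum>k\<le>n. real (n choose k) * (1 / 8) ^ k)"
    by (intro sum.mono_neutral_right) auto
  also have "\<dots> = (1 / 8 + 1) ^ n" unfolding binomial_ring by simp
  also have "\<dots> = (9 / 8) ^ n" by simp
  finally show ?thesis .
qed

section \<open>Numerical parameters\<close>

lemma frac_cover_mono:
  assumes "frac_cover b M C" "M \<le> M'" "C \<le> C'"
  shows "frac_cover b M' C'"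
proof -
  obtain Fs where Fs: "Fs \<noteq> []" "\<And>F. F \<in> set Fs \<Longrightarrow> {} \<in> F \<and> F \<subseteq> Pow {..<b} \<and> card F \<le> M"
    "\<And>xs. xs \<in> permutations_of_set {..<b} \<Longrightarrow>
      real (length Fs) \<le> C * real (length (filter (\<lambda>F. covers F xs) Fs))"
    using assms(1) unfolding frac_cover_def by blast
  have "real (length Fs) \<le> C' * real (length (filter (\<lambda>F. covers F xs) Fs))"
    if "xs \<in> permutations_of_set {..<b}" for xs
    using order_trans[OF Fs(3)[OF that] mult_right_mono[OF assms(3)]] by simp
  then show ?thesis unfolding frac_cover_def using Fs(1,2) assms(2) by (meson order_trans)
qed

lemma frac_cover_tube_22:
  assumes "0 < j"
  shows "frac_cover (200 * j) (3 * 2 ^ (100 * j)) (4 ^ (100 * j) / 705432 ^ (2 * j - 1))"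
proof -
  have bin: "(22::nat) choose 11 = 705432" by (simp add: binomial_fact' fact_numeral)
  \<comment> \<open>Here \<open>l = 100 * j\<close> and \<open>q = 11\<close>. Of
    \<open>2 * j\<close> possible groups one is given up, so that the radius
    \<open>q * g + q\<close> is exactly \<open>22 * j\<close>.\<close>
  have r: "11 * (2 * j - 1) + 11 = 22 * j" using assms by (simp add: algebra_simps)
  \<comment> \<open>This is \<open>9 ^ 200 * 8 ^ 22 <= 8 ^ 200 * 2 ^ 100\<close> with the powers of
    two collected: \<open>9 ^ 200 = 81 ^ 100\<close> and
    \<open>600 + 100 - 66 = 634\<close>.\<close>
  have "(81::real) ^ 100 \<le> 2 ^ 634" by simp
  then have "((9::real) ^ 200 * 8 ^ 22) / 8 ^ 200 \<le> 2 ^ 100" by simp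
  then have base: "(9 / 8 :: real) ^ 200 * 8 ^ 22 \<le> 2 ^ 100" by (simp add: power_divide)
  have "real (\<Sum>k\<le>22 * j. (200 * j) choose k) \<le> (9 / 8) ^ (200 * j) * 8 ^ (22 * j)"
    by (rule sum_binomial_le)
  also have "\<dots> = ((9 / 8) ^ 200 * 8 ^ 22) ^ j"
    by (simp only: power_mult power_mult_distrib)
  also have "\<dots> \<le> (2 ^ 100) ^ j" by (rule power_mono[OF base]) simp
  also have "\<dots> = real (2 ^ (100 * j))" by (simp only: power_mult of_nat_power of_nat_numeral)
  finally have "(\<Sum>k\<le>22 * j. (200 * j) choose k) \<le> 2 ^ (100 * j)"
    by (simp only: of_nat_le_iff)
  moreover have "frac_cover (2 * (100 * j)) (2 * 2 ^ (100 * j) + (\<Sum>k\<le>22 * j. (2 * (100 * j)) choose k))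
      (4 ^ (100 * j) / real ((2 * 11) choose 11) ^ (2 * j - 1))"
    unfolding r[symmetric] by (rule frac_cover_tube) simp
  moreover have "2 * (100 * j) = 200 * j" "2 * 11 = (22::nat)" by simp_all
  ultimately show ?thesis
    by (auto simp only: bin of_nat_numeral intro: frac_cover_mono)
qed

text \<open>\<open>1616 = 2 * 800 + 2 * 8\<close>: a tube with \<open>l = 800\<close> and two chains on \<open>8\<close> elements, whose saving
  \<open>(9 / 2 ^ 4) ^ 2\<close> in size compensates the factor \<open>3\<close> of the tube.\<close>

lemma frac_cover_1616: "frac_cover 1616 (2 ^ 808) (2 ^ 1340)"
proof -
  have 1: "frac_cover 8 9 40320"
    using frac_cover_chain[of 8] by (simp add: fact_numeral)
  have 2: "frac_cover 16 81 1625702400"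
    using frac_cover_product[OF 1 1] by simp
  have 3: "frac_cover 1600 (3 * 2 ^ 800) (4 ^ 800 / 705432 ^ 15)"
    using frac_cover_tube_22[of 8] by simp
  have 4: "frac_cover (1600 + 16) (3 * 2 ^ 800 * 81) (4 ^ 800 / 705432 ^ 15 * 1625702400)"
    by (rule frac_cover_product[OF 3 2]) auto
  have M: "(3 * 2 ^ 800 * 81 :: nat) \<le> 2 ^ 808" by simp
  \<comment> \<open>The exponents fit because \<open>8! ^ 2 = 1625702400\<close> is below
    \<open>2 ^ 31\<close> and \<open>1600 + 31 = 1340 + 291\<close>; the \<open>291\<close> is
    reached as \<open>3 * 97\<close>.\<close>
  have "(2::real) ^ 97 \<le> 705432 ^ 5" by simp
  then have "((2::real) ^ 97) ^ 3 \<le> (705432 ^ 5) ^ 3" by (rule power_mono) simp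
  then have 5: "(2::real) ^ 291 \<le> 705432 ^ 15" by (simp only: power_mult[symmetric]) simp
  have "(4::real) ^ 800 * 1625702400 \<le> 2 ^ 1340 * 2 ^ 291" by simp
  also have "\<dots> \<le> 2 ^ 1340 * 705432 ^ 15" by (intro mult_left_mono 5) simp
  finally have C: "4 ^ 800 / 705432 ^ 15 * 1625702400 \<le> (2::real) ^ 1340"
    by (simp only: times_divide_eq_left) (subst pos_divide_le_eq, simp_all only: zero_less_power zero_less_numeral)
  show ?thesis using frac_cover_mono[OF 4 M C] by simp
qed

lemma pow_1340_less: "(2::real) ^ 1340 < 1.786 ^ 1616"
proof -
  \<comment> \<open>\<open>46 / 55\<close> and \<open>17 / 21\<close> are lower bounds for the
    binary logarithm of \<open>1.786\<close>. They are combined so that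
    \<open>55 * 29 + 21 = 1616\<close>, while \<open>46 * 29 + 17 = 1351\<close> leaves a margin
    above \<open>1340\<close>.\<close>
  have a: "(2::real) ^ 46 \<le> 1.786 ^ 55" by (simp add: power_divide)
  have b: "(2::real) ^ 17 \<le> 1.786 ^ 21" by (simp add: power_divide)
  have "(2::real) ^ 1340 < 2 ^ (46 * 29 + 17)" by (rule power_strict_increasing) auto
  also have "\<dots> = (2 ^ 46) ^ 29 * 2 ^ 17" by (simp only: power_add power_mult)
  also have "\<dots> \<le> (1.786 ^ 55) ^ 29 * 1.786 ^ 21" by (intro mult_mono power_mono a b) auto
  also have "\<dots> = 1.786 ^ (55 * 29 + 21)" by (simp only: power_add power_mult)
  finally show ?thesis by simp
qed

section \<open>From fractional covers to covers\<close>

lemma greedy_cover: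
  fixes cov :: "'f \<Rightarrow> 'y \<Rightarrow> bool"
  assumes "Fs \<noteq> []" "finite Y" "1 \<le> C"
    and "\<And>y. y \<in> Y \<Longrightarrow> real (length Fs) \<le> C * real (length (filter (\<lambda>F. cov F y) Fs))"
  shows "\<exists>Gs. set Gs \<subseteq> set Fs \<and> length Gs = n \<and>
    real (card {y \<in> Y. \<forall>G \<in> set Gs. \<not> cov G y}) \<le> real (card Y) * (1 - 1 / C) ^ n"
proof (induction n)
  case 0
  then show ?case by (intro exI[of _ "[]"]) auto
next
  case (Suc n)
  then obtain Gs where Gs: "set Gs \<subseteq> set Fs" "length Gs = n"
    "real (card {y \<in> Y. \<forall>G \<in> set Gs. \<not> cov G y}) \<le> real (card Y) * (1 - 1 / C) ^ n" by blast
  define U where "U = {y \<in> Y. \<forall>G \<in> set Gs. \<not> cov G y}"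
  have finU: "finite U" using assms(2) by (simp add: U_def)
  \<comment> \<open>Averaging: counting the pairs of a member and an uncovered \<open>y\<close> that
    it covers from both sides shows that some member covers at least the fraction
    \<open>1 / C\<close> of what remains.\<close>
  have "\<exists>F \<in> set Fs. real (card U) \<le> C * real (card {y \<in> U. cov F y})"
  proof (rule ccontr)
    assume "\<not> ?thesis"
    then have less: "C * real (card {y \<in> U. cov F y}) < real (card U)" if "F \<in> set Fs" for F
      using that by force
    have double: "(\<Sum>F\<leftarrow>Hs. card {y \<in> U. cov F y}) = (\<Sum>y\<in>U. length (filter (\<lambda>F. cov F y) Hs))" for Hs
    proof (induction Hs)
      case (Cons H Hs)
      have "card {y \<in> U. cov H y} = (\<Sum>y\<in>U. if cov H y then 1 else 0)"
        using finU by (simp add: sum.If_cases Int_def)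
      then have "(\<Sum>F\<leftarrow>H # Hs. card {y \<in> U. cov F y}) =
          (\<Sum>y\<in>U. (if cov H y then 1 else 0) + length (filter (\<lambda>F. cov F y) Hs))"
        using Cons by (simp add: sum.distrib)
      also have "\<dots> = (\<Sum>y\<in>U. length (filter (\<lambda>F. cov F y) (H # Hs)))"
        by (rule sum.cong) auto
      finally show ?case .
    qed simp
    have "C * real (\<Sum>F\<leftarrow>Hs. card {y \<in> U. cov F y}) < real (length Hs) * real (card U)"
      if "Hs \<noteq> []" "set Hs \<subseteq> set Fs" for Hs
      using that
    proof (induction Hs rule: list_nonempty_induct)
      case (single H)
      then show ?case using less[of H] by simp
    next
      case (cons H Hs)
      then show ?case using less[of H] by (simp add: distrib_left distrib_right)
    qed
    from this[OF assms(1) subset_refl] have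
      "C * real (\<Sum>y\<in>U. length (filter (\<lambda>F. cov F y) Fs)) < real (length Fs) * real (card U)"
      unfolding double .
    moreover have "real (length Fs) * real (card U) = (\<Sum>y\<in>U. real (length Fs))" by simp
    moreover have "\<dots> \<le> (\<Sum>y\<in>U. C * real (length (filter (\<lambda>F. cov F y) Fs)))"
      by (rule sum_mono) (use assms(4) in \<open>auto simp: U_def\<close>)
    moreover have "\<dots> = C * real (\<Sum>y\<in>U. length (filter (\<lambda>F. cov F y) Fs))"
      by (simp add: sum_distrib_left)
    ultimately show False by linarith
  qed
  then obtain F where F: "F \<in> set Fs" "real (card U) \<le> C * real (card {y \<in> U. cov F y})" by blast
  have "{y \<in> Y. \<forall>G \<in> set (F # Gs). \<not> cov G y} = U - {y \<in> U. cov F y}" by (auto simp: U_def)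
  then have "real (card {y \<in> Y. \<forall>G \<in> set (F # Gs). \<not> cov G y}) = real (card U) - real (card {y \<in> U. cov F y})"
    using finU by (simp add: card_Diff_subset of_nat_diff card_mono)
  also have "\<dots> \<le> real (card U) * (1 - 1 / C)"
    using F(2) assms(3) by (simp add: field_simps)
  finally have step: "real (card {y \<in> Y. \<forall>G \<in> set (F # Gs). \<not> cov G y}) \<le> real (card U) * (1 - 1 / C)" .
  have "0 \<le> 1 - 1 / C" using assms(3) by simp
  then have "real (card U) * (1 - 1 / C) \<le> real (card Y) * (1 - 1 / C) ^ n * (1 - 1 / C)"
    by (rule mult_right_mono[OF Gs(3)[folded U_def]])
  with step have "real (card {y \<in> Y. \<forall>G \<in> set (F # Gs). \<not> cov G y}) \<le> real (card Y) * (1 - 1 / C) ^ Suc n"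
    by (simp add: mult_ac)
  then show ?case using Gs(1,2) F(1) by (intro exI[of _ "F # Gs"]) auto
qed

text \<open>After \<open>n\<close> greedy rounds at most \<open>b! * (1 - 1 / C) ^ n\<close>
  orderings remain. With the crude bound \<open>b! <= exp (b ^ 2)\<close> this is less than
  \<open>1\<close>, hence \<open>0\<close>, as soon as \<open>n > C * b ^ 2\<close>.\<close>

lemma ex_cover:
  assumes "frac_cover b M C" "1 \<le> C" "0 < b"
  shows "\<exists>Gs. Gs \<noteq> [] \<and> real (length Gs) \<le> C * real b ^ 2 + 2 \<and>
    (\<forall>F \<in> set Gs. {} \<in> F \<and> F \<subseteq> Pow {..<b} \<and> card F \<le> M) \<and>
    (\<forall>xs \<in> permutations_of_set {..<b}. \<exists>F \<in> set Gs. covers F xs)"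
proof -
  obtain Fs where Fs: "Fs \<noteq> []" "\<And>F. F \<in> set Fs \<Longrightarrow> {} \<in> F \<and> F \<subseteq> Pow {..<b} \<and> card F \<le> M"
    "\<And>xs. xs \<in> permutations_of_set {..<b} \<Longrightarrow>
      real (length Fs) \<le> C * real (length (filter (\<lambda>F. covers F xs) Fs))"
    using assms(1) unfolding frac_cover_def by blast
  define n where "n = nat \<lceil>C * real b ^ 2\<rceil> + 1"
  have n: "C * real b ^ 2 < real n" "real n \<le> C * real b ^ 2 + 2"
    using assms(2) unfolding n_def by (simp_all add: of_nat_nat) linarith+
  define Y where "Y = permutations_of_set {..<b}"
  obtain Gs where Gs: "set Gs \<subseteq> set Fs" "length Gs = n"
    "real (card {y \<in> Y. \<forall>G \<in> set Gs. \<not> covers G y}) \<le> real (card Y) * (1 - 1 / C) ^ n"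
    using greedy_cover[of Fs Y C covers n] Fs assms(2) unfolding Y_def by auto
  have "real (card Y) = fact b" by (simp add: Y_def)
  also have "\<dots> \<le> real b ^ b" by (metis fact_le_power of_nat_fact of_nat_le_iff of_nat_power le_refl)
  also have "\<dots> \<le> exp (real b) ^ b"
    using exp_ge_add_one_self[of "real b"] by (intro power_mono) linarith+
  also have "\<dots> = exp (real b ^ 2)" by (simp add: exp_of_nat_mult[symmetric] power2_eq_square)
  finally have Y: "real (card Y) \<le> exp (real b ^ 2)" .
  have "(1 - 1 / C) ^ n \<le> exp (- 1 / C) ^ n"
    using exp_ge_add_one_self[of "- 1 / C"] assms(2) by (intro power_mono) auto
  also have "\<dots> = exp (- real n / C)" by (simp add: exp_of_nat_mult[symmetric])
  also have "\<dots> < exp (- (real b ^ 2))" using n assms(2) by (simp add: field_simps)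
  finally have p: "(1 - 1 / C) ^ n < exp (- (real b ^ 2))" .
  have "0 \<le> (1 - 1 / C) ^ n" using assms(2) by simp
  then have "real (card Y) * (1 - 1 / C) ^ n \<le> exp (real b ^ 2) * (1 - 1 / C) ^ n"
    using Y by (rule mult_right_mono[rotated])
  also have "\<dots> < exp (real b ^ 2) * exp (- (real b ^ 2))" using p by simp
  also have "\<dots> = 1" by (simp add: exp_minus)
  finally have "card {y \<in> Y. \<forall>G \<in> set Gs. \<not> covers G y} = 0" using Gs(3) by linarith
  then have "{y \<in> Y. \<forall>G \<in> set Gs. \<not> covers G y} = {}" by (simp add: Y_def)
  moreover have "Gs \<noteq> []" using Gs(2) n_def by auto
  ultimately show ?thesis
    using Gs(1,2) n(2) Fs(2) unfolding Y_def by (intro exI[of _ Gs]) blast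
qed

lemma ex_good_cover:
  "\<exists>b M Gs. 0 < b \<and> Gs \<noteq> [] \<and> real M \<le> sqrt 2 ^ b \<and>
    real (length Gs) * real M < (1.786 * sqrt 2) ^ b \<and>
    (\<forall>F \<in> set Gs. {} \<in> F \<and> F \<subseteq> Pow {..<b} \<and> card F \<le> M) \<and>
    (\<forall>xs \<in> permutations_of_set {..<b}. \<exists>F \<in> set Gs. covers F xs)"
proof -
  define R :: real where "R = 1.786 ^ 1616 / 2 ^ 1340"
  have R: "1 < R" unfolding R_def using pow_1340_less by (subst less_divide_eq_1_pos) simp_all
  \<comment> \<open>The cost of rounding is quadratic in \<open>k\<close> and the slack is
    \<open>R ^ k\<close>. Working with \<open>sqrt R\<close> reduces \<open>k ^ 2\<close> to the
    linear factor of the limit lemma.\<close>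
  have "(\<lambda>k. real k * (1 / sqrt R) ^ k) \<longlonglongrightarrow> 0"
    using R by (intro powser_times_n_limit_0) simp
  then have "eventually (\<lambda>k. real k * (1 / sqrt R) ^ k < 1 / 4000) sequentially"
    by (rule order_tendstoD) simp
  then have "eventually (\<lambda>k. 0 < k \<and> real k * (1 / sqrt R) ^ k < 1 / 4000) sequentially"
    using eventually_gt_at_top[of 0] by eventually_elim simp
  then obtain k where k: "0 < k" "real k * (1 / sqrt R) ^ k < 1 / 4000"
    by (auto simp: eventually_sequentially)
  have "(real k * (1 / sqrt R) ^ k) ^ 2 < (1 / 4000) ^ 2"
    using k R by (intro power_strict_mono) auto
  also have "(real k * (1 / sqrt R) ^ k) ^ 2 = real k ^ 2 / R ^ k"
    using R by (simp add: power_mult_distrib power_divide power_mult[symmetric] mult.commute[of _ 2])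
      (simp add: power_mult)
  finally have kR: "16000000 * real k ^ 2 < R ^ k" using R by (simp add: field_simps)
  define b where "b = k * 1616"
  obtain Gs where Gs: "Gs \<noteq> []" "real (length Gs) \<le> (2 ^ 1340) ^ k * real b ^ 2 + 2"
    "\<forall>F \<in> set Gs. {} \<in> F \<and> F \<subseteq> Pow {..<b} \<and> card F \<le> (2 ^ 808) ^ k"
    "\<forall>xs \<in> permutations_of_set {..<b}. \<exists>F \<in> set Gs. covers F xs"
    using ex_cover[OF frac_cover_power[OF frac_cover_1616 _ k(1)]] k(1) unfolding b_def
    by (metis one_le_numeral one_le_power mult_pos_pos zero_less_numeral zero_le_numeral zero_le_power)
  \<comment> \<open>The additive \<open>2\<close> in the number of families is turned into a
    multiple of the main term: \<open>1616 ^ 2 + 2 = 2611458\<close>, which is well below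
    \<open>4000 ^ 2\<close>.\<close>
  have "1 * 1 \<le> ((2::real) ^ 1340) ^ k * real k ^ 2"
    using k(1) by (intro mult_mono one_le_power) simp_all
  then have one: "1 \<le> ((2::real) ^ 1340) ^ k * real k ^ 2" by (simp only: mult_1)
  have "real (length Gs) \<le> (2 ^ 1340) ^ k * real b ^ 2 + 2 * ((2 ^ 1340) ^ k * real k ^ 2)"
    using Gs(2) one by linarith
  also have "\<dots> = (2 ^ 1340) ^ k * (2611458 * real k ^ 2)"
    unfolding b_def by (simp only: of_nat_mult power_mult_distrib of_nat_numeral distrib_left) simp
  also have "\<dots> \<le> (2 ^ 1340) ^ k * (16000000 * real k ^ 2)"
    by (intro mult_left_mono mult_right_mono) simp_all
  also have "\<dots> < (2 ^ 1340) ^ k * R ^ k" using kR by (intro mult_strict_left_mono) simp_all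
  also have "\<dots> = (1.786 ^ 1616) ^ k"
    unfolding power_mult_distrib[symmetric] R_def by (simp only: times_divide_eq_right) simp
  also have "\<dots> = 1.786 ^ b" unfolding b_def by (simp only: power_mult[symmetric] mult.commute)
  finally have N: "real (length Gs) < 1.786 ^ b" .
  have "sqrt 2 ^ b = (sqrt 2 ^ 2) ^ (808 * k)" unfolding b_def power_mult[symmetric] by simp
  also have "\<dots> = real ((2 ^ 808) ^ k)" by (simp only: power_mult real_sqrt_pow2 of_nat_power of_nat_numeral)
  finally have M: "real ((2 ^ 808) ^ k) = sqrt 2 ^ b" by simp
  have "real (length Gs) * real ((2 ^ 808) ^ k) < (1.786 * sqrt 2) ^ b"
    unfolding M power_mult_distrib by (rule mult_strict_right_mono[OF N]) simp
  then show ?thesis using Gs M k(1) by (intro exI[of _ b] exI[of _ "(2 ^ 808) ^ k"] exI[of _ Gs]) (simp_all add: b_def)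
qed

section \<open>A program logic with running times\<close>

definition runs :: "nat \<Rightarrow> real \<Rightarrow> nat \<Rightarrow> com \<Rightarrow> state \<Rightarrow> nat \<Rightarrow> (state \<Rightarrow> bool) \<Rightarrow> bool" where
  "runs w D m c s T Q \<longleftrightarrow> (\<exists>t s'. exec w D m c s t s' \<and> t \<le> T \<and> Q s')"

lemma runs_mono:
  assumes "runs w D m c s T Q" "T \<le> T'" "\<And>s'. Q s' \<Longrightarrow> Q' s'"
  shows "runs w D m c s T' Q'"
  using assms unfolding runs_def by (meson le_trans)

lemma runs_Seq:
  assumes "runs w D m c s T (\<lambda>s'. runs w D m c' s' T' Q)"
  shows "runs w D m (Seq c c') s (T + T') Q"
  using assms unfolding runs_def by (meson exec.Seq add_le_mono)

lemma runs_Cond: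
  assumes "bval s b \<Longrightarrow> runs w D m c s T Q" "\<not> bval s b \<Longrightarrow> runs w D m c' s T Q"
  shows "runs w D m (Cond b c c') s (1 + T) Q"
  using assms unfolding runs_def by (cases "bval s b") (meson exec.CondTrue exec.CondFalse add_le_mono le_refl)+

text \<open>Weakest preconditions of loop-free code, in a form that \<open>simp\<close> unfolds.
  \<open>While\<close> is mapped to \<open>False\<close>, which keeps \<open>runs_vc\<close> sound
  whatever \<open>steps\<close> returns on loops; every loop has to go through
  \<open>runs_For\<close>.\<close>

fun vc :: "nat \<Rightarrow> real \<Rightarrow> nat \<Rightarrow> com \<Rightarrow> state \<Rightarrow> (state \<Rightarrow> bool) \<Rightarrow> bool" where
  "vc w D m Skip s Q = Q s"
| "vc w D m (ISet x a) s Q = (ival s a < 2 ^ w \<and> Q (s\<lparr>ireg := (ireg s)(x := ival s a)\<rparr>))"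
| "vc w D m (ILoad x a) s Q = (ival s a < m \<and> Q (s\<lparr>ireg := (ireg s)(x := imem s (ival s a))\<rparr>))"
| "vc w D m (IStore a b) s Q = (ival s a < m \<and> ival s b < 2 ^ w \<and>
    Q (s\<lparr>imem := (imem s)(ival s a := ival s b)\<rparr>))"
| "vc w D m (RSet x r) s Q = (\<bar>rval s r\<bar> \<le> 2 ^ w * D \<and> Q (s\<lparr>rreg := (rreg s)(x := rval s r)\<rparr>))"
| "vc w D m (RLoad x a) s Q = (ival s a < m \<and> Q (s\<lparr>rreg := (rreg s)(x := rmem s (ival s a))\<rparr>))"
| "vc w D m (RStore a r) s Q = (ival s a < m \<and> \<bar>rval s r\<bar> \<le> 2 ^ w * D \<and>
    Q (s\<lparr>rmem := (rmem s)(ival s a := rval s r)\<rparr>))"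
| "vc w D m (Seq c c') s Q = vc w D m c s (\<lambda>s'. vc w D m c' s' Q)"
| "vc w D m (Cond b c c') s Q = ((bval s b \<longrightarrow> vc w D m c s Q) \<and> (\<not> bval s b \<longrightarrow> vc w D m c' s Q))"
| "vc w D m (While b c) s Q = False"

fun steps :: "com \<Rightarrow> nat" where
  "steps (Seq c c') = steps c + steps c'"
| "steps (Cond b c c') = 1 + max (steps c) (steps c')"
| "steps _ = 1"

lemma runs_atomic: "exec w D m c s 1 s' \<Longrightarrow> Q s' \<Longrightarrow> runs w D m c s 1 Q"
  unfolding runs_def by blast

lemma runs_vc: "vc w D m c s Q \<Longrightarrow> runs w D m c s (steps c) Q"
proof (induction c arbitrary: s Q)
  case (Seq c c')
  then have "runs w D m c s (steps c) (\<lambda>s'. vc w D m c' s' Q)" by simp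
  then have "runs w D m c s (steps c) (\<lambda>s'. runs w D m c' s' (steps c') Q)"
    by (rule runs_mono) (use Seq.IH in auto)
  then show ?case by (simp add: runs_Seq)
next
  case (Cond b c c')
  have "runs w D m (Cond b c c') s (1 + max (steps c) (steps c')) Q"
  proof (rule runs_Cond)
    assume "bval s b"
    then show "runs w D m c s (max (steps c) (steps c')) Q"
      using Cond.IH(1)[of s Q] Cond.prems by (auto intro: runs_mono)
  next
    assume "\<not> bval s b"
    then show "runs w D m c' s (max (steps c) (steps c')) Q"
      using Cond.IH(2)[of s Q] Cond.prems by (auto intro: runs_mono)
  qed
  then show ?case by simp
qed (auto simp del: One_nat_def intro!: runs_atomic[OF exec.Skip] runs_atomic[OF exec.ISet]
  runs_atomic[OF exec.ILoad] runs_atomic[OF exec.IStore] runs_atomic[OF exec.RSet]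
  runs_atomic[OF exec.RLoad] runs_atomic[OF exec.RStore])

definition For :: "reg \<Rightarrow> iexp \<Rightarrow> com \<Rightarrow> com" where
  "For i e c = Seq (ISet i (IConst 0))
    (While (ILess (IReg i) e) (Seq c (ISet i (IAdd (IReg i) (IConst 1)))))"

text \<open>The program evaluates \<open>e\<close> anew before each round, so the invariant must fix
  its value as well as the counter. The two extra steps per round are the test and the increment;
  the \<open>2\<close> in front is the initial assignment and the last, failing test.\<close>

lemma runs_For:
  assumes init: "I 0 (s\<lparr>ireg := (ireg s)(i := 0)\<rparr>)"
    and regs: "\<And>k s. k \<le> bd \<Longrightarrow> I k s \<Longrightarrow> ireg s i = k \<and> ival s e = bd"
    and body: "\<And>k s. k < bd \<Longrightarrow> I k s \<Longrightarrow>
      runs w D m c s T (\<lambda>s'. ireg s' i = k \<and> I (Suc k) (s'\<lparr>ireg := (ireg s')(i := Suc k)\<rparr>))"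
    and bd: "bd < 2 ^ w"
  shows "runs w D m (For i e c) s (2 + bd * (T + 2)) (I bd)"
proof -
  let ?W = "While (ILess (IReg i) e) (Seq c (ISet i (IAdd (IReg i) (IConst 1))))"
  have loop: "runs w D m ?W s (1 + j * (T + 2)) (I bd)" if "j \<le> bd" "I (bd - j) s" for j s
    using that
  proof (induction j arbitrary: s)
    case 0
    then have "\<not> bval s (ILess (IReg i) e)" using regs[of bd s] by simp
    then have "exec w D m ?W s 1 s" by (rule exec.WhileFalse)
    then show ?case using 0 runs_atomic by simp
  next
    case (Suc j)
    define k where "k = bd - Suc j"
    have k: "k < bd" "Suc k = bd - j" using Suc.prems by (auto simp: k_def)
    have b: "bval s (ILess (IReg i) e)" using regs[of k s] k Suc.prems by (simp add: k_def)
    obtain t s' where e1: "exec w D m c s t s'" "t \<le> T" "ireg s' i = k"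
      "I (Suc k) (s'\<lparr>ireg := (ireg s')(i := Suc k)\<rparr>)"
      using body[OF k(1)] Suc.prems(2) unfolding runs_def k_def by blast
    define s2 where "s2 = s'\<lparr>ireg := (ireg s')(i := Suc k)\<rparr>"
    have "exec w D m (ISet i (IAdd (IReg i) (IConst 1))) s' 1 s2"
      using exec.ISet[of s' "IAdd (IReg i) (IConst 1)" w D m i] e1(3) k bd by (simp add: s2_def)
    then have e2: "exec w D m (Seq c (ISet i (IAdd (IReg i) (IConst 1)))) s (t + 1) s2"
      using e1(1) by (rule exec.Seq[rotated])
    obtain t' s3 where e3: "exec w D m ?W s2 t' s3" "t' \<le> 1 + j * (T + 2)" "I bd s3"
      using Suc.IH[of s2] Suc.prems e1(4) k unfolding s2_def runs_def by auto
    have "exec w D m ?W s (1 + (t + 1) + t') s3" by (rule exec.WhileTrue[OF b e2 e3(1)])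
    moreover have "1 + (t + 1) + t' \<le> 1 + Suc j * (T + 2)" using e1(2) e3(2) by simp
    ultimately show ?case using e3(3) unfolding runs_def by blast
  qed
  have "runs w D m (ISet i (IConst 0)) s 1 (\<lambda>s'. runs w D m ?W s' (1 + bd * (T + 2)) (I bd))"
    using runs_vc[of w D m "ISet i (IConst 0)" s] init loop[of bd] by simp
  then show ?thesis unfolding For_def by (rule runs_mono[OF runs_Seq]) auto
qed

text \<open>Truncated subtraction makes
  \<open>1 - ((x - c) + (c - x))\<close> the indicator of \<open>x = c\<close>.\<close>

fun tabE :: "(nat \<Rightarrow> nat) \<Rightarrow> nat \<Rightarrow> iexp \<Rightarrow> iexp" where
  "tabE f 0 e = IConst 0"
| "tabE f (Suc c) e = IAdd (tabE f c e)
    (IMul (IConst (f c)) (ISub (IConst 1) (IAdd (ISub e (IConst c)) (ISub (IConst c) e))))"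

lemma ival_tabE [simp]: "ival s (tabE f c e) = (if ival s e < c then f (ival s e) else 0)"
  by (induction c) (auto simp: less_Suc_eq)

section \<open>Encoding sets of cities by numbers\<close>

definition dg :: "nat \<Rightarrow> nat \<Rightarrow> nat \<Rightarrow> nat" where
  "dg b x j = x div b ^ j mod b"

lemma dg_less: "0 < b \<Longrightarrow> dg b x j < b"
  by (simp add: dg_def)

lemma dg_zero [simp]: "dg b 0 j = 0"
  by (simp add: dg_def)

lemma dg_combine:
  assumes "r < b ^ j" "c < b"
  shows "dg b (q * b ^ Suc j + c * b ^ j + r) i = (if i = j then c else if i < j then dg b r i else dg b (q * b ^ Suc j) i)"
proof -
  have b: "0 < b" using assms(2) by simp
  have eq: "q * b ^ Suc j + c * b ^ j + r = (q * b + c) * b ^ j + r" by (simp add: algebra_simps)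
  consider "i = j" | "i < j" | "j < i" by linarith
  then show ?thesis
  proof cases
    case 1
    then show ?thesis using assms unfolding dg_def eq by simp
  next
    case 2
    then obtain e where j: "j = Suc (i + e)" using less_iff_Suc_add by auto
    have eq': "(q * b + c) * b ^ j = b ^ i * (b * ((q * b + c) * b ^ e))"
      by (simp add: j power_add algebra_simps)
    show ?thesis using 2 b unfolding dg_def eq eq' by simp
  next
    case 3
    then obtain e where i: "i = Suc (j + e)" using less_iff_Suc_add by auto
    have p: "b ^ i = b ^ Suc j * b ^ e" by (simp add: i power_add)
    have lt: "c * b ^ j + r < b ^ Suc j"
    proof -
      have "c * b ^ j + r < Suc c * b ^ j" using assms(1) by simp
      also have "\<dots> \<le> b * b ^ j" using assms(2) by (intro mult_right_mono) auto
      finally show ?thesis by simp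
    qed
    have "(b ^ Suc j * q + (c * b ^ j + r)) div b ^ Suc j = q"
      using lt b by (subst div_mult_self4) auto
    then have 1: "(q * b ^ Suc j + c * b ^ j + r) div b ^ Suc j = q"
      by (simp only: mult.commute add.assoc)
    have 2: "(q * b ^ Suc j) div b ^ Suc j = q" using b by simp
    show ?thesis using 3 unfolding dg_def p div_mult2_eq 1 2 by simp
  qed
qed

lemma dg_split:
  obtains q r where "x = q * b ^ Suc j + dg b x j * b ^ j + r" "r < b ^ j \<or> b = 0"
proof
  show "x = x div b ^ Suc j * b ^ Suc j + dg b x j * b ^ j + x mod b ^ j"
  proof -
    have "x div b ^ j = x div b ^ Suc j * b + dg b x j"
      unfolding dg_def power_Suc2 div_mult2_eq by simp
    then have "x div b ^ j * b ^ j + x mod b ^ j =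
        (x div b ^ Suc j * b + dg b x j) * b ^ j + x mod b ^ j" by simp
    then show ?thesis by (simp add: algebra_simps)
  qed
  show "x mod b ^ j < b ^ j \<or> b = 0" by auto
qed

text \<open>The new digit is added before the old one is taken away, as subtraction on
  \<open>nat\<close> truncates; \<open>pred_code\<close> and the program compute in the same
  order.\<close>

lemma dg_replace:
  assumes "c < b"
  shows "dg b (x + c * b ^ j - dg b x j * b ^ j) i = (if i = j then c else dg b x i)"
proof -
  have b: "0 < b" using assms by simp
  obtain q r where x: "x = q * b ^ Suc j + dg b x j * b ^ j + r" "r < b ^ j"
    using dg_split[of x b j] b by auto
  define a where "a = dg b x j"
  have "x + c * b ^ j - a * b ^ j = q * b ^ Suc j + c * b ^ j + r"
    using x(1) unfolding a_def[symmetric] by simp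
  moreover have "dg b x i = (if i = j then a else if i < j then dg b r i else dg b (q * b ^ Suc j) i)"
    using dg_combine[OF x(2) dg_less[OF b, of x j], of q i] x(1) unfolding a_def by simp
  ultimately show ?thesis
    using dg_combine[OF x(2) assms, of q i] unfolding a_def by simp
qed

lemma dg_mult_le: "dg b x j * b ^ j \<le> x"
proof -
  obtain q r where "x = q * b ^ Suc j + dg b x j * b ^ j + r"
    using dg_split[of x b j] by blast
  then show ?thesis by linarith
qed

lemma dg_beyond: "x < b ^ K \<Longrightarrow> K \<le> j \<Longrightarrow> dg b x j = 0"
proof -
  assume x: "x < b ^ K" and j: "K \<le> j"
  show ?thesis
  proof (cases "b = 0")
    case False
    then have "b ^ K \<le> b ^ j" using j by (intro power_increasing) auto
    then show ?thesis using x by (simp add: dg_def)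
  qed (use x in \<open>cases K; simp add: dg_def\<close>)
qed

lemma ex_digits:
  assumes "\<And>j. j < K \<Longrightarrow> f j < b"
  shows "\<exists>x < b ^ K. \<forall>j < K. dg b x j = f j"
  using assms
proof (induction K)
  case 0
  then show ?case by auto
next
  case (Suc K)
  then obtain x where x: "x < b ^ K" "\<forall>j < K. dg b x j = f j" by force
  define y where "y = 0 * b ^ Suc K + f K * b ^ K + x"
  have "y < Suc (f K) * b ^ K" using x(1) by (simp add: y_def)
  also have "\<dots> \<le> b * b ^ K" using Suc.prems[of K] by (intro mult_right_mono) auto
  finally have "y < b ^ Suc K" by simp
  moreover have "dg b y j = f j" if "j < Suc K" for j
    unfolding y_def using dg_combine[OF x(1) Suc.prems[of K], of 0 j] that x(2) by auto
  ultimately show ?case by blast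
qed

lemma dg_all_zero:
  assumes "x < b ^ K" "\<And>j. j < K \<Longrightarrow> dg b x j = 0"
  shows "x = 0"
  using assms
proof (induction K)
  case 0
  then show ?case by simp
next
  case (Suc K)
  have b: "0 < b" using Suc.prems(1) by (cases b) auto
  have "x div b ^ K < b" using Suc.prems(1) by (simp add: less_mult_imp_div_less)
  then have "x div b ^ K = 0" using Suc.prems(2)[of K] by (simp add: dg_def)
  then have "x < b ^ K" using b by (simp add: div_eq_0_iff)
  then show ?case using Suc by simp
qed

text \<open>The value must be attained in \<open>Hi\<close> but has to compete only with
  \<open>Lo\<close>. For \<open>Lo = Hi\<close> it is the minimum, with flag \<open>0\<close> for
  the empty set.\<close>

definition isopt :: "nat \<Rightarrow> real \<Rightarrow> real set \<Rightarrow> real set \<Rightarrow> bool" where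
  "isopt fl x Lo Hi \<longleftrightarrow> (fl \<noteq> 0 \<longrightarrow> x \<in> Hi) \<and> (\<forall>y \<in> Lo. fl \<noteq> 0 \<and> x \<le> y)"

lemma isopt_mono: "isopt fl x Lo Hi \<Longrightarrow> Lo' \<subseteq> Lo \<Longrightarrow> Hi \<subseteq> Hi' \<Longrightarrow> isopt fl x Lo' Hi'"
  by (auto simp: isopt_def)

fun plen :: "(nat \<Rightarrow> nat \<Rightarrow> real) \<Rightarrow> nat list \<Rightarrow> real" where
  "plen e [] = 0"
| "plen e [x] = 0"
| "plen e (x # y # zs) = e x y + plen e (y # zs)"

lemma plen_snoc: "xs \<noteq> [] \<Longrightarrow> plen e (xs @ [v]) = plen e xs + e (last xs) v"
  by (induction xs rule: induct_list012) auto

text \<open>The source of the bounds on stored reals that the machine demands.\<close>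

lemma abs_plen_le:
  assumes "\<And>u v. u < n \<Longrightarrow> v < n \<Longrightarrow> \<bar>e u v\<bar> \<le> D" "set xs \<subseteq> {..<n}" "0 \<le> D"
  shows "\<bar>plen e xs\<bar> \<le> real (length xs) * D"
  using assms(2)
proof (induction xs rule: induct_list012)
  case (3 x y zs)
  have "\<bar>plen e (x # y # zs)\<bar> \<le> \<bar>e x y\<bar> + \<bar>plen e (y # zs)\<bar>" by simp
  also have "\<dots> \<le> D + real (length (y # zs)) * D"
    using 3 assms(1)[of x y] by (intro add_mono) auto
  finally show ?case by (simp add: algebra_simps)
qed (use assms(3) in auto)

text \<open>
  \<open>dec i\<close> enumerates the \<open>i\<close>-th family of the cover of a block. As the empty set comes first and the
  cardinality is monotone, removing a city from an encoded set makes its code smaller.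
\<close>

locale cover_tables =
  fixes B N M :: nat and dec :: "nat \<Rightarrow> nat \<Rightarrow> nat set"
  assumes pos: "0 < B" "0 < N" "0 < M"
    and dec_sub: "\<And>i a. i < N \<Longrightarrow> a < M \<Longrightarrow> dec i a \<subseteq> {..<B}"
    and dec_empty: "\<And>i a. i < N \<Longrightarrow> a < M \<Longrightarrow> dec i a = {} \<longleftrightarrow> a = 0"
    and dec_mono: "\<And>i a a'. i < N \<Longrightarrow> a \<le> a' \<Longrightarrow> a' < M \<Longrightarrow> card (dec i a) \<le> card (dec i a')"
    and dec_cover: "\<And>xs. xs \<in> permutations_of_set {..<B} \<Longrightarrow> \<exists>i < N. covers (dec i ` {..<M}) xs"
begin

text \<open>City \<open>v\<close> is element \<open>v mod B\<close> of block \<open>v div B\<close>.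
  In base \<open>N\<close>, \<open>cc\<close> names a family for each block; in base
  \<open>M\<close>, \<open>code\<close> names a member of each of these families. The last block
  extends beyond the last city, so a set may contain numbers that are no cities.\<close>

definition setof :: "nat \<Rightarrow> nat \<Rightarrow> nat set" where
  "setof cc code = {v. v mod B \<in> dec (dg N cc (v div B)) (dg M code (v div B))}"

text \<open>Three answers in one number: \<open>0\<close> if \<open>e\<close> is absent,
  \<open>1\<close> if removing \<open>e\<close> leads to no member of smaller code, and otherwise
  \<open>2\<close> plus the code of the predecessor. \<open>LEAST\<close> makes a choice, as the
  enumeration may repeat sets.\<close>

definition tab :: "nat \<Rightarrow> nat \<Rightarrow> nat \<Rightarrow> nat" where
  "tab i a e = (if e \<in> dec i a then
     if \<exists>a'<a. dec i a' = dec i a - {e} then 2 + (LEAST a'. dec i a' = dec i a - {e}) else 1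
   else 0)"

lemma setof_zero: "setof cc 0 = {}"
  using dec_empty[OF _ pos(3)] pos by (auto simp: setof_def dg_less)

lemma setof_block: "e < B \<Longrightarrow> j * B + e \<in> setof cc code \<longleftrightarrow> e \<in> dec (dg N cc j) (dg M code j)"
  using pos by (simp add: setof_def)

lemma setof_eq_empty:
  assumes "code < M ^ K" "setof cc code = {}"
  shows "code = 0"
proof (rule dg_all_zero[OF assms(1)])
  fix j
  have "dec (dg N cc j) (dg M code j) = {}"
  proof (rule ccontr)
    assume "dec (dg N cc j) (dg M code j) \<noteq> {}"
    then obtain e where "e \<in> dec (dg N cc j) (dg M code j)" by blast
    moreover from this have "e < B" using dec_sub[OF dg_less dg_less] pos by blast
    ultimately show False using setof_block[of e j cc code] assms(2) by blast
  qed
  then show "dg M code j = 0" using dec_empty[OF dg_less dg_less] pos by blast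
qed

lemma tab_pred:
  assumes "2 \<le> tab i a e"
  shows "e \<in> dec i a" "tab i a e - 2 < a" "dec i (tab i a e - 2) = dec i a - {e}"
proof -
  have c: "e \<in> dec i a" "\<exists>a'<a. dec i a' = dec i a - {e}"
    using assms by (auto simp: tab_def split: if_splits)
  then show "e \<in> dec i a" by simp
  obtain a' where a': "a' < a" "dec i a' = dec i a - {e}" using c by blast
  have t: "tab i a e - 2 = (LEAST a'. dec i a' = dec i a - {e})" using c by (simp add: tab_def)
  show "dec i (tab i a e - 2) = dec i a - {e}" unfolding t by (rule LeastI[of _ a']) (rule a'(2))
  show "tab i a e - 2 < a"
    unfolding t by (rule le_less_trans[OF Least_le[of _ a'] a'(1)]) (rule a'(2))
qed

lemma tab_le: "a < M \<Longrightarrow> tab i a e \<le> M + 1"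
  using tab_pred(2)[of i a e] by (cases "2 \<le> tab i a e") auto

lemma tab_eq_0: "tab i a e = 0 \<longleftrightarrow> e \<notin> dec i a"
  by (simp add: tab_def)

definition tab_at :: "nat \<Rightarrow> nat \<Rightarrow> nat \<Rightarrow> nat" where
  "tab_at cc code v = tab (dg N cc (v div B)) (dg M code (v div B)) (v mod B)"

definition pred_code :: "nat \<Rightarrow> nat \<Rightarrow> nat \<Rightarrow> nat" where
  "pred_code cc code v = code + (tab_at cc code v - 2) * M ^ (v div B) - dg M code (v div B) * M ^ (v div B)"

lemma tab_at_eq_0: "tab_at cc code v = 0 \<longleftrightarrow> v \<notin> setof cc code"
  by (simp add: tab_at_def tab_eq_0 setof_def)

text \<open>Only the digit of the block of \<open>v\<close> changes, and it decreases. Increasing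
  codes are therefore a valid order for dynamic programming.\<close>

lemma pred_code:
  assumes "2 \<le> tab_at cc code v"
  shows "v \<in> setof cc code" "pred_code cc code v < code"
    "setof cc (pred_code cc code v) = setof cc code - {v}"
proof -
  define j where "j = v div B"
  define a where "a = dg M code j"
  define i where "i = dg N cc j"
  define c where "c = tab i a (v mod B) - 2"
  have "2 \<le> tab i a (v mod B)" using assms by (simp add: tab_at_def i_def a_def j_def)
  note t = tab_pred[OF this]
  have aM: "a < M" using pos by (simp add: a_def dg_less)
  show "v \<in> setof cc code" using t by (simp add: setof_def i_def a_def j_def)
  have pc: "pred_code cc code v = code + c * M ^ j - dg M code j * M ^ j"
    by (simp add: pred_code_def tab_at_def c_def i_def a_def j_def)
  have "c * M ^ j < a * M ^ j" using t(2) pos by (simp add: c_def)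
  then show "pred_code cc code v < code"
    unfolding pc using dg_mult_le[of M code j] unfolding a_def by linarith
  have dig: "dg M (pred_code cc code v) k = (if k = j then c else dg M code k)" for k
    unfolding pc by (rule dg_replace) (use t(2) aM in \<open>simp add: c_def\<close>)
  have v: "v = j * B + v mod B" by (simp add: j_def)
  show "setof cc (pred_code cc code v) = setof cc code - {v}"
  proof (rule set_eqI)
    fix u
    show "u \<in> setof cc (pred_code cc code v) \<longleftrightarrow> u \<in> setof cc code - {v}"
    proof (cases "u div B = j")
      case True
      have "u = v \<longleftrightarrow> u mod B = v mod B" using True v by (metis div_mult_mod_eq)
      moreover have "u \<in> setof cc (pred_code cc code v) \<longleftrightarrow> u mod B \<in> dec i c"
        using True by (simp add: setof_def dig i_def)
      moreover have "u \<in> setof cc code \<longleftrightarrow> u mod B \<in> dec i a"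
        using True by (simp add: setof_def i_def a_def)
      ultimately show ?thesis using t(3) by (auto simp: c_def)
    next
      case False
      then have "u \<noteq> v" by (auto simp: j_def)
      then show ?thesis using False by (simp add: setof_def dig)
    qed
  qed
qed

text \<open>Completeness of the table: if any code describes the set without \<open>v\<close>, its
  digit in the block of \<open>v\<close> describes a smaller set there, and by
  \<open>dec_mono\<close> that digit is a smaller number.\<close>

lemma two_le_tab_at:
  assumes "v \<in> setof cc code" "setof cc code' = setof cc code - {v}"
  shows "2 \<le> tab_at cc code v"
proof -
  define j where "j = v div B"
  define e where "e = v mod B"
  define i where "i = dg N cc j"
  define a where "a = dg M code j"
  define a' where "a' = dg M code' j"
  have bd: "i < N" "a < M" "a' < M" "e < B" using pos by (auto simp: i_def a_def a'_def e_def dg_less)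
  have v: "v = j * B + e" by (simp add: j_def e_def)
  have ein: "e \<in> dec i a" using assms(1) setof_block[OF bd(4), of j cc code] v by (simp add: i_def a_def)
  have "dec i a' = dec i a - {e}"
  proof (rule set_eqI)
    fix x
    show "x \<in> dec i a' \<longleftrightarrow> x \<in> dec i a - {e}"
    proof (cases "x < B")
      case True
      have "x \<in> dec i a' \<longleftrightarrow> j * B + x \<in> setof cc code'"
        using setof_block[OF True, of j cc code'] by (simp add: i_def a'_def)
      moreover have "x \<in> dec i a \<longleftrightarrow> j * B + x \<in> setof cc code"
        using setof_block[OF True, of j cc code] by (simp add: i_def a_def)
      moreover have "j * B + x = v \<longleftrightarrow> x = e" unfolding v by simp
      ultimately show ?thesis unfolding assms(2) by blast
    next
      case False
      then show ?thesis using dec_sub[OF bd(1,2)] dec_sub[OF bd(1,3)] by auto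
    qed
  qed
  moreover from this have "card (dec i a') < card (dec i a)"
    using ein dec_sub[OF bd(1,2)] by (metis card_Diff1_less finite_lessThan finite_subset)
  then have "a' < a" using dec_mono[OF bd(1), of a a'] bd by (meson leI leD)
  ultimately have "\<exists>a'<a. dec i a' = dec i a - {e}" by blast
  then show ?thesis using ein by (simp add: tab_at_def tab_def i_def a_def e_def j_def)
qed

text \<open>The ordering induced on each block is covered by some family of that block, and the
  choices are independent. So \<open>cc\<close> can be assembled digit by digit, and likewise the
  code of each prefix.\<close>

lemma ex_setof_covers:
  assumes n: "n < K * B" and xs: "xs \<in> permutations_of_set {..<n}"
  shows "\<exists>cc < N ^ K. covers (setof cc ` {..<M ^ K}) xs"
proof -
  define blk where "blk j ys = map (\<lambda>v. v mod B) (filter (\<lambda>v. v div B = j) ys)" for j ys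
  have sx: "set xs = {..<n}" "distinct xs" using xs by (auto simp: permutations_of_set_def)
  have "\<exists>i < N. \<exists>rest. covers (dec i ` {..<M}) (blk j xs @ rest)" for j
  proof -
    \<comment> \<open>A block may contain fewer than \<open>B\<close> cities. Appending the missing
      elements gives an ordering of the full block and keeps the prefixes of its cities as
      prefixes.\<close>
    define rest where "rest = filter (\<lambda>e. e \<notin> set (blk j xs)) [0..<B]"
    have "distinct (blk j xs)"
      unfolding blk_def distinct_map using sx(2)
      by (auto intro!: inj_onI) (metis div_mult_mod_eq)
    moreover have "set (blk j xs) \<subseteq> {..<B}" using pos by (auto simp: blk_def)
    ultimately have "blk j xs @ rest \<in> permutations_of_set {..<B}"
      by (intro permutations_of_setI) (auto simp: rest_def)
    then show ?thesis using dec_cover by blast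
  qed
  then obtain f where f: "\<And>j. f j < N" "\<And>j. \<exists>rest. covers (dec (f j) ` {..<M}) (blk j xs @ rest)"
    by metis
  obtain cc where cc: "cc < N ^ K" "\<And>j. j < K \<Longrightarrow> dg N cc j = f j"
    using ex_digits[of K f N] f(1) by blast
  have "set ys \<in> setof cc ` {..<M ^ K}" if ys: "xs = ys @ zs" for ys zs
  proof -
    have "\<exists>a < M. dec (f j) a = set (blk j ys)" for j
    proof -
      obtain rest where "covers (dec (f j) ` {..<M}) (blk j xs @ rest)" using f(2) by blast
      moreover have "blk j xs @ rest = blk j ys @ (blk j zs @ rest)" using ys by (simp add: blk_def)
      ultimately have "set (blk j ys) \<in> dec (f j) ` {..<M}" unfolding covers_def by blast
      then show ?thesis by auto
    qed
    then obtain g where g: "\<And>j. g j < M" "\<And>j. dec (f j) (g j) = set (blk j ys)" by metis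
    obtain code where code: "code < M ^ K" "\<And>j. j < K \<Longrightarrow> dg M code j = g j"
      using ex_digits[of K g M] g(1) by blast
    have "setof cc code = set ys"
    proof (rule set_eqI)
      fix v
      show "v \<in> setof cc code \<longleftrightarrow> v \<in> set ys"
      proof (cases "v div B < K")
        case True
        then have "v \<in> setof cc code \<longleftrightarrow> v mod B \<in> set (blk (v div B) ys)"
          using g code cc by (simp add: setof_def)
        also have "\<dots> \<longleftrightarrow> (\<exists>u \<in> set ys. u div B = v div B \<and> u mod B = v mod B)"
          by (simp add: blk_def image_iff) metis
        also have "\<dots> \<longleftrightarrow> v \<in> set ys" by (metis div_mult_mod_eq)
        finally show ?thesis .
      next
        case False
        \<comment> \<open>Beyond the \<open>K\<close> blocks all digits are \<open>0\<close>, and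
          digit \<open>0\<close> stands for the empty set.\<close>
        then have "dg M code (v div B) = 0" using dg_beyond[OF code(1)] by simp
        then have "v \<notin> setof cc code"
          using dec_empty[OF dg_less[OF pos(2)] pos(3)] by (simp add: setof_def)
        moreover have "v \<notin> set ys"
        proof
          assume "v \<in> set ys"
          then have "v \<in> set xs" using ys by simp
          then have "v < K * B" using sx(1) n by simp
          then show False using False by (simp add: less_mult_imp_div_less)
        qed
        ultimately show ?thesis by simp
      qed
    qed
    then show ?thesis using code(1) by blast
  qed
  then show ?thesis using cc(1) unfolding covers_def by blast
qed

section \<open>Path lengths belonging to a state and their recurrence\<close>

definition paths :: "nat \<Rightarrow> nat \<Rightarrow> nat \<Rightarrow> nat \<Rightarrow> nat \<Rightarrow> nat list set" where
  "paths n cc st code v = {xs. distinct xs \<and> set xs \<subseteq> {..<n} \<and> xs \<noteq> [] \<and> hd xs = st \<and> last xs = v \<and>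
     set xs = setof cc code}"

text \<open>The value computed for a state need not be optimal for the state: it is the length of some path
  (an element of \<open>Hi\<close>) and at most the length of every path with all prefixes in the family (\<open>Lo\<close>).\<close>

definition Hi :: "(nat \<Rightarrow> nat \<Rightarrow> real) \<Rightarrow> nat \<Rightarrow> nat \<Rightarrow> nat \<Rightarrow> nat \<Rightarrow> nat \<Rightarrow> real set" where
  "Hi e n cc st code v = plen e ` paths n cc st code v"

definition Lo :: "(nat \<Rightarrow> nat \<Rightarrow> real) \<Rightarrow> nat \<Rightarrow> nat \<Rightarrow> nat \<Rightarrow> nat \<Rightarrow> nat \<Rightarrow> nat \<Rightarrow> real set" where
  "Lo e n K cc st code v = plen e ` {xs \<in> paths n cc st code v. covers (setof cc ` {..<M ^ K}) xs}"

text \<open>A covered path ending in \<open>v\<close> has its prefix without \<open>v\<close> in the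
  family, so \<open>two_le_tab_at\<close> would yield a predecessor. \<open>Hi\<close> may be
  nonempty here, but flag \<open>0\<close> is still a correct answer.\<close>

lemma Lo_no_pred:
  assumes "tab_at cc code v < 2"
  shows "Lo e n K cc st code v = {}"
proof (rule ccontr)
  assume "Lo e n K cc st code v \<noteq> {}"
  then obtain xs where xs: "xs \<in> paths n cc st code v" "covers (setof cc ` {..<M ^ K}) xs"
    by (auto simp: Lo_def)
  then have eq: "xs = butlast xs @ [v]" by (auto simp: paths_def)
  then have "set (butlast xs) \<in> setof cc ` {..<M ^ K}" using xs(2) unfolding covers_def by blast
  then obtain code' where "setof cc code' = set (butlast xs)" by force
  moreover have "set (butlast xs) = setof cc code - {v}" "v \<in> setof cc code"
  proof -
    have "distinct (butlast xs @ [v])" "set (butlast xs @ [v]) = setof cc code"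
      using xs(1) eq by (simp_all add: paths_def)
    then show "set (butlast xs) = setof cc code - {v}" "v \<in> setof cc code" by auto
  qed
  ultimately have "2 \<le> tab_at cc code v" using two_le_tab_at by metis
  then show False using assms by simp
qed

lemma paths_step:
  assumes "2 \<le> tab_at cc code v" "xs \<in> paths n cc st code v"
  shows "xs = butlast xs @ [v]" "set (butlast xs) = setof cc (pred_code cc code v)"
proof -
  show eq: "xs = butlast xs @ [v]" using assms(2) by (auto simp: paths_def)
  have "distinct (butlast xs @ [v])" "set (butlast xs @ [v]) = setof cc code"
    using assms(2) eq by (simp_all add: paths_def)
  then show "set (butlast xs) = setof cc (pred_code cc code v)"
    unfolding pred_code(3)[OF assms(1)] by auto
qed

lemma paths_base:
  assumes "2 \<le> tab_at cc code v" "pred_code cc code v = 0" "v < n"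
  shows "paths n cc st code v = (if st = v then {[v]} else {})"
proof -
  have s: "setof cc code = {v}"
    using pred_code(1,3)[OF assms(1)] assms(2) setof_zero by auto
  have only: "xs = [v]" if "xs \<in> paths n cc st code v" for xs
    using paths_step[OF assms(1) that] assms(2) setof_zero by auto
  have mem: "[v] \<in> paths n cc st code v \<longleftrightarrow> st = v" using s assms(3) by (auto simp: paths_def)
  have "paths n cc st code v \<subseteq> {[v]}" using only by blast
  then have "paths n cc st code v = {} \<or> paths n cc st code v = {[v]}" by (rule subset_singletonD)
  then show ?thesis using mem by (elim disjE) (metis empty_iff, metis insertI1)
qed

text \<open>The recurrence is split into two inclusions: here any path to the preceding state
  extends by \<open>v\<close>, and in \<open>Lo_step\<close> every covered path arises from a
  covered one.\<close>

lemma Hi_step: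
  assumes "2 \<le> tab_at cc code v" "v < n" "y \<in> Hi e n cc st (pred_code cc code v) u"
  shows "y + e u v \<in> Hi e n cc st code v"
proof -
  obtain xs where xs: "xs \<in> paths n cc st (pred_code cc code v) u" "y = plen e xs"
    using assms(3) by (auto simp: Hi_def)
  have "xs @ [v] \<in> paths n cc st code v"
    using xs(1) pred_code(1,3)[OF assms(1)] assms(2) by (auto simp: paths_def)
  moreover have "plen e (xs @ [v]) = y + e u v"
    using xs by (auto simp: paths_def plen_snoc)
  ultimately show ?thesis unfolding Hi_def by (metis imageI)
qed

lemma Lo_step:
  assumes "2 \<le> tab_at cc code v" "code < M ^ K" "pred_code cc code v \<noteq> 0" "y \<in> Lo e n K cc st code v"
  shows "\<exists>u < n. \<exists>y' \<in> Lo e n K cc st (pred_code cc code v) u. y = y' + e u v"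
proof -
  obtain xs where xs: "xs \<in> paths n cc st code v" "covers (setof cc ` {..<M ^ K}) xs" "y = plen e xs"
    using assms(4) by (auto simp: Lo_def)
  define ys where "ys = butlast xs"
  have eq: "xs = ys @ [v]" and sy: "set ys = setof cc (pred_code cc code v)"
    using paths_step[OF assms(1) xs(1)] by (auto simp: ys_def)
  have ne: "ys \<noteq> []"
    using sy setof_eq_empty[of "pred_code cc code v" K cc] pred_code(2)[OF assms(1)] assms(2,3) by auto
  have "covers (setof cc ` {..<M ^ K}) ys"
    using xs(2) unfolding covers_def eq by (metis append.assoc)
  moreover have "ys \<in> paths n cc st (pred_code cc code v) (last ys)"
    using xs(1) sy ne unfolding eq by (auto simp: paths_def)
  ultimately have "plen e ys \<in> Lo e n K cc st (pred_code cc code v) (last ys)" by (auto simp: Lo_def)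
  moreover have "last ys < n" using xs(1) ne last_in_set[OF ne] unfolding eq by (auto simp: paths_def)
  moreover have "y = plen e ys + e (last ys) v" using xs(3) ne by (simp add: eq plen_snoc)
  ultimately show ?thesis by blast
qed

end

section \<open>The program\<close>

text \<open>
  Integer registers: 0 number \<open>n\<close> of cities; 1, 2 numbers \<open>M ^ K\<close>, \<open>N ^ K\<close> of states and of covers, for
  \<open>K\<close> blocks; 3 pair of a cover and a start city, split into 16 and 15; 4 state; 5 city \<open>v\<close>; 6 city \<open>u\<close>;
  7, 8 weights of the block of \<open>v\<close> in states and covers; 9 and real 1 current cell; 10 table entry;
  11 preceding state; 12 number of cities in the state; 13 and real 0 best tour so far; 14 and
  real 2, 3 scratch. Values come in pairs of a flag, \<open>0\<close> meaning \<open>\<infinity>\<close>, and a real number. The value of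
  state \<open>c\<close> with last city \<open>v\<close> is at address \<open>n * n + c * n + v\<close> of the two memory banks.
\<close>

lemma isopt_relax:
  assumes "isopt fl0 x0 L0 H0" "isopt fl x L H"
  shows "isopt (if fl = 0 \<or> fl0 \<noteq> 0 \<and> \<not> x + c < x0 then fl0 else 1)
    (if fl = 0 \<or> fl0 \<noteq> 0 \<and> \<not> x + c < x0 then x0 else x + c)
    (L0 \<union> (\<lambda>y. y + c) ` L) (H0 \<union> (\<lambda>y. y + c) ` H)"
  using assms unfolding isopt_def by (auto split: if_splits)

definition idxE :: "reg \<Rightarrow> reg \<Rightarrow> iexp" where
  "idxE c u = IAdd (IAdd (IMul (IReg 0) (IReg 0)) (IMul (IReg c) (IReg 0))) (IReg u)"

lemma ival_idxE [simp]: "ival s (idxE c u) = ireg s 0 * ireg s 0 + ireg s c * ireg s 0 + ireg s u"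
  by (simp add: idxE_def)

text \<open>Serves twice: to extend paths of the preceding state by \<open>v\<close>, and to close
  the tours of a full state by an edge to the start city. Register \<open>t\<close> holds the head
  of the edge; \<open>fr\<close> and \<open>br\<close> hold the flag and the value being
  improved.\<close>

definition scan_body :: "reg \<Rightarrow> reg \<Rightarrow> reg \<Rightarrow> reg \<Rightarrow> com" where
  "scan_body c t fr br =
    Seq (ILoad 14 (idxE c 6))
    (Cond (ILess (IConst 0) (IReg 14))
      (Seq (RLoad 2 (idxE c 6))
      (Seq (RLoad 3 (IAdd (IMul (IReg 6) (IReg 0)) (IReg t)))
      (Seq (RSet 2 (RAdd (RReg 2) (RReg 3)))
        (Cond (BAnd (ILess (IConst 0) (IReg fr)) (BNot (RLess (RReg 2) (RReg br))))
          Skip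
          (Seq (RSet br (RReg 2)) (ISet fr (IConst 1)))))))
      Skip)"

definition scan :: "reg \<Rightarrow> reg \<Rightarrow> reg \<Rightarrow> reg \<Rightarrow> com" where
  "scan c t fr br = For 6 (IReg 0) (scan_body c t fr br)"

section \<open>Machine bounds and correctness of a scan over last cities\<close>

locale tsp_run = cover_tables +
  fixes n K w m :: nat and D :: real and e :: "nat \<Rightarrow> nat \<Rightarrow> real"
  assumes n: "0 < n" and K: "K = n div B + 1"
    and big: "n * n + M ^ K * n + N ^ K * n + M + 2 < 2 ^ w"
    and m: "m = n * n + M ^ K * n"
    and e_bound: "\<And>u v. u < n \<Longrightarrow> v < n \<Longrightarrow> \<bar>e u v\<bar> \<le> D"
    and D: "0 \<le> D"
begin

lemma idx_less: "code < M ^ K \<Longrightarrow> u < n \<Longrightarrow> n * n + code * n + u < m"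
proof -
  assume "code < M ^ K" "u < n"
  then have "code * n + u < Suc code * n" by simp
  also have "\<dots> \<le> M ^ K * n" using \<open>code < M ^ K\<close> by (intro mult_right_mono) auto
  finally show ?thesis using m by simp
qed

lemma mat_less: "u < n \<Longrightarrow> v < n \<Longrightarrow> u * n + v < n * n"
proof -
  assume "u < n" "v < n"
  then have "u * n + v < Suc u * n" by simp
  also have "\<dots> \<le> n * n" using \<open>u < n\<close> by (intro mult_right_mono) auto
  finally show ?thesis .
qed

lemma n_le: "n \<le> n * n"
  using n by (cases n) auto

lemma real_bound: "\<bar>y\<bar> \<le> real n * D \<Longrightarrow> u < n \<Longrightarrow> v < n \<Longrightarrow> \<bar>y + e u v\<bar> \<le> 2 ^ w * D"
proof -
  assume y: "\<bar>y\<bar> \<le> real n * D" and uv: "u < n" "v < n"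
  have "\<bar>y + e u v\<bar> \<le> real (n + 1) * D" using y e_bound[OF uv] by (simp add: algebra_simps)
  also have "\<dots> \<le> real (2 ^ w) * D"
    using big n_le D by (intro mult_right_mono) (auto simp only: of_nat_le_iff)
  finally show ?thesis by simp
qed

lemma runs_scan:
  assumes regs: "c \<notin> {6, 14, fr}" "t \<notin> {6, 14, fr}" "fr \<notin> {0, 6, 14}" "br \<notin> {2, 3}"
    and s: "ireg s 0 = n" "ireg s c = code" "ireg s t = v" "code < M ^ K" "v < n"
    and mat: "\<And>u v. u < n \<Longrightarrow> v < n \<Longrightarrow> rmem s (u * n + v) = e u v"
    and cells: "\<And>u. u < n \<Longrightarrow>
      isopt (imem s (n * n + code * n + u)) (rmem s (n * n + code * n + u)) (L u) (H u)"
    and bd: "\<And>u y. u < n \<Longrightarrow> y \<in> H u \<Longrightarrow> \<bar>y\<bar> \<le> real n * D"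
    and opt: "isopt (ireg s fr) (rreg s br) L0 H0"
  shows "runs w D m (scan c t fr br) s (2 + n * 10) (\<lambda>s'. imem s' = imem s \<and> rmem s' = rmem s \<and>
    (\<forall>r. r \<notin> {6, 14, fr} \<longrightarrow> ireg s' r = ireg s r) \<and>
    (\<forall>r. r \<notin> {2, 3, br} \<longrightarrow> rreg s' r = rreg s r) \<and>
    isopt (ireg s' fr) (rreg s' br) (L0 \<union> (\<Union>u<n. (\<lambda>y. y + e u v) ` L u)) (H0 \<union> (\<Union>u<n. (\<lambda>y. y + e u v) ` H u)))"
proof -
  define I where "I k s' \<longleftrightarrow> ireg s' 6 = k \<and> imem s' = imem s \<and> rmem s' = rmem s \<and>
    (\<forall>r. r \<notin> {6, 14, fr} \<longrightarrow> ireg s' r = ireg s r) \<and>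
    (\<forall>r. r \<notin> {2, 3, br} \<longrightarrow> rreg s' r = rreg s r) \<and>
    isopt (ireg s' fr) (rreg s' br) (L0 \<union> (\<Union>u<k. (\<lambda>y. y + e u v) ` L u)) (H0 \<union> (\<Union>u<k. (\<lambda>y. y + e u v) ` H u))"
    for k :: nat and s' :: state
  have body: "runs w D m (scan_body c t fr br) s1 8
      (\<lambda>s'. ireg s' 6 = k \<and> I (Suc k) (s'\<lparr>ireg := (ireg s')(6 := Suc k)\<rparr>))"
    if k: "k < n" and I1: "I k s1" for k s1
  proof -
    define x where "x = rmem s (n * n + code * n + k)"
    define fl where "fl = imem s (n * n + code * n + k)"
    have r1: "ireg s1 0 = n" "ireg s1 c = code" "ireg s1 t = v" "ireg s1 6 = k"
      "imem s1 = imem s" "rmem s1 = rmem s"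
      using I1 regs s by (auto simp: I_def)
    have fr1: "ireg s1 r = ireg s r" if "r \<noteq> 6" "r \<noteq> 14" "r \<noteq> fr" for r
      using I1 that by (simp add: I_def)
    have fr2: "rreg s1 r = rreg s r" if "r \<noteq> 2" "r \<noteq> 3" "r \<noteq> br" for r
      using I1 that by (simp add: I_def)
    have ad: "n * n + code * n + k < m" "k * n + v < m"
      using idx_less[OF s(4) k] mat_less[OF k s(5)] m by auto
    \<comment> \<open>A cell with flag \<open>0\<close> may hold a leftover real for which no bound
      is known; the program never adds to it.\<close>
    have xb: "\<bar>x + e k v\<bar> \<le> 2 ^ w * D" if "fl \<noteq> 0"
      using cells[OF k] bd[OF k] real_bound[OF _ k s(5)] that by (auto simp: isopt_def x_def fl_def)
    have rx: "isopt (if fl = 0 \<or> ireg s1 fr \<noteq> 0 \<and> \<not> x + e k v < rreg s1 br then ireg s1 fr else 1)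
      (if fl = 0 \<or> ireg s1 fr \<noteq> 0 \<and> \<not> x + e k v < rreg s1 br then rreg s1 br else x + e k v)
      (L0 \<union> (\<Union>u<Suc k. (\<lambda>y. y + e u v) ` L u)) (H0 \<union> (\<Union>u<Suc k. (\<lambda>y. y + e u v) ` H u))"
    proof -
      have U: "A \<union> (\<Union>u<Suc k. (\<lambda>y. y + e u v) ` X u) =
        A \<union> (\<Union>u<k. (\<lambda>y. y + e u v) ` X u) \<union> (\<lambda>y. y + e k v) ` X k" for A X
        by (auto simp: lessThan_Suc)
      have "isopt (ireg s1 fr) (rreg s1 br) (L0 \<union> (\<Union>u<k. (\<lambda>y. y + e u v) ` L u)) (H0 \<union> (\<Union>u<k. (\<lambda>y. y + e u v) ` H u))"
        using I1 by (simp add: I_def)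
      from isopt_relax[OF this cells[OF k], of "e k v"] show ?thesis unfolding U x_def fl_def .
    qed
    have w: "1 < (2::nat) ^ w" using big by simp
    have "vc w D m (scan_body c t fr br) s1
      (\<lambda>s'. ireg s' 6 = k \<and> I (Suc k) (s'\<lparr>ireg := (ireg s')(6 := Suc k)\<rparr>))"
    proof (cases "fl = 0")
      case True
      then show ?thesis using rx regs r1 ad fr1 fr2 w
        by (simp add: scan_body_def I_def fl_def)
    next
      case False
      show ?thesis
      proof (cases "ireg s1 fr \<noteq> 0 \<and> \<not> x + e k v < rreg s1 br")
        case True
        then show ?thesis using False rx regs r1 ad fr1 fr2 w xb mat[OF k s(5)]
          by (simp add: scan_body_def I_def fl_def x_def)
      next
        case less: False
        then have "\<not> (fl = 0 \<or> ireg s1 fr \<noteq> 0 \<and> \<not> x + e k v < rreg s1 br)" using False by simp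
        note rx' = rx[unfolded if_not_P[OF this]]
        show ?thesis using less False rx' regs r1 ad fr1 fr2 w xb mat[OF k s(5)]
          by (auto simp: scan_body_def I_def fl_def x_def)
      qed
    qed
    from runs_vc[OF this] show ?thesis by (rule runs_mono) (auto simp: scan_body_def)
  qed
  have "runs w D m (For 6 (IReg 0) (scan_body c t fr br)) s (2 + n * (8 + 2)) (I n)"
  proof (rule runs_For)
    show "I 0 (s\<lparr>ireg := (ireg s)(6 := 0)\<rparr>)" using opt regs by (simp add: I_def)
    show "ireg s' 6 = k \<and> ival s' (IReg 0) = n" if "I k s'" for k s'
      using that regs s by (simp add: I_def)
    show "n < 2 ^ w" using big n_le by linarith
  qed (rule body)
  then show ?thesis unfolding scan_def by (rule runs_mono) (auto simp: I_def)
qed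

end

section \<open>Computing one cell of the table\<close>

context cover_tables
begin

definition aE :: iexp where "aE = IMod (IDiv (IReg 4) (IReg 7)) (IConst M)"

definition iE :: iexp where "iE = IMod (IDiv (IReg 16) (IReg 8)) (IConst N)"

text \<open>Family, member and element are packed into one index below \<open>N * M * B\<close>.
  That number is independent of the input, so the look-up is an expression of fixed size.\<close>

definition pE :: iexp where
  "pE = tabE (\<lambda>k. tab (k div B div M) (k div B mod M) (k mod B)) (N * M * B)
    (IAdd (IMul (IAdd (IMul iE (IConst M)) aE) (IConst B)) (IMod (IReg 5) (IConst B)))"

definition predE :: iexp where
  "predE = ISub (IAdd (IReg 4) (IMul (ISub (IReg 10) (IConst 2)) (IReg 7))) (IMul aE (IReg 7))"

definition signE :: "reg \<Rightarrow> iexp" where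
  "signE r = ISub (IConst 1) (ISub (IConst 1) (IReg r))"

text \<open>There is no exponentiation, so the weights live in registers: the weight grows by the
  factor \<open>b\<close> exactly when \<open>v\<close> is the last element of its block.\<close>

definition powE :: "nat \<Rightarrow> reg \<Rightarrow> iexp" where
  "powE b r = IMul (IReg r) (tabE (\<lambda>k. if Suc k = B then b else 1) B (IMod (IReg 5) (IConst B)))"

definition cell1 :: com where
  "cell1 = Seq (ISet 10 pE) (Seq (ISet 9 (IConst 0)) (ISet 12 (IAdd (IReg 12) (signE 10))))"

definition cell2 :: com where
  "cell2 = Cond (ILess (IConst 1) (IReg 10))
    (Seq (ISet 11 predE)
      (Cond (ILess (IConst 0) (IReg 11))
        (scan 11 5 9 1)
        (Cond (BAnd (BNot (ILess (IReg 5) (IReg 15))) (BNot (ILess (IReg 15) (IReg 5))))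
          (Seq (RSet 1 RZero) (ISet 9 (IConst 1)))
          Skip)))
    Skip"

text \<open>The real is written only with the flag set, for only then does a path bound it.\<close>

definition cell3 :: com where
  "cell3 = Seq (IStore (idxE 4 5) (signE 9))
    (Seq (Cond (ILess (IConst 0) (IReg 9)) (RStore (idxE 4 5) (RReg 1)) Skip)
    (Seq (ISet 7 (powE M 7)) (ISet 8 (powE N 8))))"

definition cell :: com where "cell = Seq cell1 (Seq cell2 cell3)"

lemma ival_signE [simp]: "ival s (signE r) = (if ireg s r = 0 then 0 else 1)"
  by (simp add: signE_def)

lemma ival_pE:
  assumes "ireg s 4 = code" "ireg s 5 = v" "ireg s 7 = M ^ (v div B)" "ireg s 8 = N ^ (v div B)" "ireg s 16 = cc"
  shows "ival s pE = tab_at cc code v"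
proof -
  define i where "i = dg N cc (v div B)"
  define a where "a = dg M code (v div B)"
  define x where "x = v mod B"
  have b: "i < N" "a < M" "x < B" using pos by (auto simp: i_def a_def x_def dg_less)
  have "i * M + a < Suc i * M" using b by simp
  also have "\<dots> \<le> N * M" using b by (intro mult_right_mono) auto
  finally have 1: "i * M + a < N * M" .
  have "(i * M + a) * B + x < Suc (i * M + a) * B" using b by simp
  also have "\<dots> \<le> N * M * B" using 1 by (intro mult_right_mono) auto
  finally have 2: "(i * M + a) * B + x < N * M * B" .
  have 3: "((i * M + a) * B + x) div B = i * M + a" "((i * M + a) * B + x) mod B = x" using b by auto
  have 4: "(i * M + a) div M = i" "(i * M + a) mod M = a" using b by auto
  have 5: "ival s aE = a" "ival s iE = i" using assms by (auto simp: aE_def iE_def a_def i_def dg_def)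
  have iv: "ival s (IAdd (IMul (IAdd (IMul iE (IConst M)) aE) (IConst B)) (IMod (IReg 5) (IConst B))) =
      (i * M + a) * B + x"
    using assms(2) 5 by (simp add: x_def)
  have "ival s pE = tab i a x" unfolding pE_def ival_tabE iv 3 4 using 2 by simp
  then show ?thesis by (simp add: tab_at_def i_def a_def x_def)
qed

lemma ival_powE:
  assumes "ireg s 5 = v" "ireg s r = b ^ (v div B)"
  shows "ival s (powE b r) = b ^ (Suc v div B)"
  using pos assms by (auto simp: powE_def div_Suc mod_Suc)

end

context tsp_run
begin

definition cellok :: "state \<Rightarrow> nat \<Rightarrow> nat \<Rightarrow> nat \<Rightarrow> nat \<Rightarrow> bool" where
  "cellok s cc st code u \<longleftrightarrow> isopt (imem s (n * n + code * n + u)) (rmem s (n * n + code * n + u))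
     (Lo e n K cc st code u) (Hi e n cc st code u)"

definition mat :: "state \<Rightarrow> bool" where
  "mat s \<longleftrightarrow> (\<forall>u<n. \<forall>v<n. rmem s (u * n + v) = e u v)"

lemma Hi_bound:
  assumes "y \<in> Hi e n cc st code v"
  shows "\<bar>y\<bar> \<le> real n * D"
proof -
  obtain xs where xs: "distinct xs" "set xs \<subseteq> {..<n}" "y = plen e xs"
    using assms by (auto simp: Hi_def paths_def)
  have "length xs \<le> n" using distinct_card[OF xs(1)] card_mono[OF _ xs(2)] by simp
  have "\<bar>y\<bar> \<le> real (length xs) * D" unfolding xs(3) by (rule abs_plen_le[OF e_bound xs(2) D])
  also have "\<dots> \<le> real n * D" using \<open>length xs \<le> n\<close> D by (intro mult_right_mono) auto
  finally show ?thesis .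
qed

lemma word_bounds: "M ^ K < 2 ^ w" "N ^ K < 2 ^ w" "n < 2 ^ w" "M + 1 < 2 ^ w" "1 < (2::nat) ^ w" "N ^ K * n < 2 ^ w"
proof -
  have "M ^ K \<le> M ^ K * n" "N ^ K \<le> N ^ K * n" using n by auto
  then show "M ^ K < 2 ^ w" "N ^ K < 2 ^ w" "n < 2 ^ w" "M + 1 < 2 ^ w" "1 < (2::nat) ^ w" "N ^ K * n < 2 ^ w"
    using big n_le by linarith+
qed

text \<open>Everything read from the table belongs to the preceding state, whose code is smaller, so
  knowing the rows below \<open>code\<close> is enough. The scan starts from flag \<open>0\<close>
  with both sets empty.\<close>

lemma runs_cell2:
  assumes s: "ireg s 0 = n" "ireg s 4 = code" "ireg s 5 = v" "ireg s 7 = M ^ (v div B)"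
      "ireg s 10 = tab_at cc code v" "ireg s 15 = st" "ireg s 9 = 0"
    and b: "code < M ^ K" "v < n" and mt: "mat s"
    and cells: "\<And>c u. c < code \<Longrightarrow> u < n \<Longrightarrow> cellok s cc st c u"
  shows "runs w D m cell2 s (n * 10 + 7) (\<lambda>s'. imem s' = imem s \<and> rmem s' = rmem s \<and>
    (\<forall>r. r \<notin> {6, 9, 11, 14} \<longrightarrow> ireg s' r = ireg s r) \<and> (\<forall>r. r \<notin> {1, 2, 3} \<longrightarrow> rreg s' r = rreg s r) \<and>
    isopt (ireg s' 9) (rreg s' 1) (Lo e n K cc st code v) (Hi e n cc st code v))"
    (is "runs w D m cell2 s _ ?Q")
proof -
  show ?thesis
  proof (cases "tab_at cc code v < 2")
    case True
    have "vc w D m Skip s ?Q" using Lo_no_pred[OF True] s by (simp add: isopt_def)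
    from runs_vc[OF this] have "runs w D m Skip s (n * 10 + 6) ?Q" by (rule runs_mono) auto
    then show ?thesis using True s unfolding cell2_def
      by (intro runs_mono[OF runs_Cond[of s _ w D m _ "n * 10 + 6" ?Q]]) auto
  next
    case False
    then have t: "2 \<le> tab_at cc code v" by simp
    define c' where "c' = pred_code cc code v"
    have c': "c' < code" using pred_code(2)[OF t] by (simp add: c'_def)
    define s1 where "s1 = s\<lparr>ireg := (ireg s)(11 := c')\<rparr>"
    have iv: "ival s predE = c'"
      using s by (simp add: predE_def aE_def c'_def pred_code_def dg_def)
    have set11: "runs w D m (ISet 11 predE) s 1 (\<lambda>s'. s' = s1)"
      using runs_vc[of w D m "ISet 11 predE" s] iv c' b word_bounds by (simp add: s1_def)
    have r1: "ireg s1 0 = n" "ireg s1 4 = code" "ireg s1 5 = v" "ireg s1 9 = 0" "ireg s1 11 = c'" "ireg s1 15 = st"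
      "imem s1 = imem s" "rmem s1 = rmem s" "rreg s1 = rreg s" using s by (simp_all add: s1_def)
    have r2: "ireg s1 r = ireg s r" if "r \<noteq> 11" for r using that by (simp add: s1_def)
    have "runs w D m (Cond (ILess (IConst 0) (IReg 11)) (scan 11 5 9 1)
        (Cond (BAnd (BNot (ILess (IReg 5) (IReg 15))) (BNot (ILess (IReg 15) (IReg 5))))
          (Seq (RSet 1 RZero) (ISet 9 (IConst 1))) Skip)) s1 (1 + (n * 10 + 3)) ?Q"
    proof (rule runs_Cond)
      assume "bval s1 (ILess (IConst 0) (IReg 11))"
      then have nz: "c' \<noteq> 0" using r1 by simp
      have "runs w D m (scan 11 5 9 1) s1 (2 + n * 10) (\<lambda>s'. imem s' = imem s1 \<and> rmem s' = rmem s1 \<and>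
        (\<forall>r. r \<notin> {6, 14, 9} \<longrightarrow> ireg s' r = ireg s1 r) \<and>
        (\<forall>r. r \<notin> {2, 3, 1} \<longrightarrow> rreg s' r = rreg s1 r) \<and>
        isopt (ireg s' 9) (rreg s' 1) ({} \<union> (\<Union>u<n. (\<lambda>y. y + e u v) ` Lo e n K cc st c' u))
          ({} \<union> (\<Union>u<n. (\<lambda>y. y + e u v) ` Hi e n cc st c' u)))"
      proof (rule runs_scan)
        show "ireg s1 11 = c'" "ireg s1 0 = n" "ireg s1 5 = v" "v < n" "c' < M ^ K" using r1 b c' by auto
        show "rmem s1 (u * n + v) = e u v" if "u < n" "v < n" for u v
          using mt that r1 by (simp add: mat_def)
        show "isopt (imem s1 (n * n + c' * n + u)) (rmem s1 (n * n + c' * n + u))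
          (Lo e n K cc st c' u) (Hi e n cc st c' u)" if "u < n" for u
          using cells[OF c' that] r1 by (simp add: cellok_def)
        show "isopt (ireg s1 9) (rreg s1 1) {} {}" using r1 by (simp add: isopt_def)
      qed (auto intro: Hi_bound)
      then show "runs w D m (scan 11 5 9 1) s1 (n * 10 + 3) ?Q"
      proof (rule runs_mono)
        fix s' :: state assume a: "imem s' = imem s1 \<and> rmem s' = rmem s1 \<and>
          (\<forall>r. r \<notin> {6, 14, 9} \<longrightarrow> ireg s' r = ireg s1 r) \<and>
          (\<forall>r. r \<notin> {2, 3, 1} \<longrightarrow> rreg s' r = rreg s1 r) \<and>
          isopt (ireg s' 9) (rreg s' 1) ({} \<union> (\<Union>u<n. (\<lambda>y. y + e u v) ` Lo e n K cc st c' u))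
            ({} \<union> (\<Union>u<n. (\<lambda>y. y + e u v) ` Hi e n cc st c' u))"
        have sub1: "Lo e n K cc st code v \<subseteq> {} \<union> (\<Union>u<n. (\<lambda>y. y + e u v) ` Lo e n K cc st c' u)"
        proof
          fix y assume "y \<in> Lo e n K cc st code v"
          from Lo_step[OF t b(1) nz[unfolded c'_def] this]
          show "y \<in> {} \<union> (\<Union>u<n. (\<lambda>y. y + e u v) ` Lo e n K cc st c' u)"
            unfolding c'_def by blast
        qed
        have sub2: "{} \<union> (\<Union>u<n. (\<lambda>y. y + e u v) ` Hi e n cc st c' u) \<subseteq> Hi e n cc st code v"
          using Hi_step[OF t b(2)] unfolding c'_def by blast
        from a have "isopt (ireg s' 9) (rreg s' 1) ({} \<union> (\<Union>u<n. (\<lambda>y. y + e u v) ` Lo e n K cc st c' u))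
            ({} \<union> (\<Union>u<n. (\<lambda>y. y + e u v) ` Hi e n cc st c' u))" by (elim conjE)
        from isopt_mono[OF this sub1 sub2] show "?Q s'" using a r1 r2 by simp
      qed simp
    next
      assume "\<not> bval s1 (ILess (IConst 0) (IReg 11))"
      then have z: "pred_code cc code v = 0" using r1 by (simp add: c'_def)
      note base = paths_base[OF t z b(2), of st]
      have "vc w D m (Cond (BAnd (BNot (ILess (IReg 5) (IReg 15))) (BNot (ILess (IReg 15) (IReg 5))))
          (Seq (RSet 1 RZero) (ISet 9 (IConst 1))) Skip) s1 ?Q"
        using r1 r2 word_bounds(5) D by (auto simp: isopt_def Lo_def Hi_def base)
      from runs_vc[OF this] show "runs w D m (Cond (BAnd (BNot (ILess (IReg 5) (IReg 15))) (BNot (ILess (IReg 15) (IReg 5))))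
          (Seq (RSet 1 RZero) (ISet 9 (IConst 1))) Skip) s1 (n * 10 + 3) ?Q"
        by (rule runs_mono) auto
    qed
    then have "runs w D m (ISet 11 predE) s 1 (\<lambda>s'. runs w D m (Cond (ILess (IConst 0) (IReg 11)) (scan 11 5 9 1)
        (Cond (BAnd (BNot (ILess (IReg 5) (IReg 15))) (BNot (ILess (IReg 15) (IReg 5))))
          (Seq (RSet 1 RZero) (ISet 9 (IConst 1))) Skip)) s' (1 + (n * 10 + 3)) ?Q)"
      using set11 by (auto elim: runs_mono)
    from runs_Seq[OF this] show ?thesis using t s unfolding cell2_def
      by (intro runs_mono[OF runs_Cond[of s _ w D m _ "1 + (1 + (n * 10 + 3))" ?Q]]) auto
  qed
qed

text \<open>Nothing is asserted about later cells. They may hold leftovers of earlier sweeps and are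
  overwritten before they are read, so one table serves all pairs of a cover and a start city and is
  never cleared. This keeps the space at \<open>M ^ K\<close> up to a polynomial factor.\<close>

definition rowI :: "nat \<Rightarrow> nat \<Rightarrow> nat \<Rightarrow> nat \<Rightarrow> real set \<Rightarrow> real set \<Rightarrow> nat \<Rightarrow> state \<Rightarrow> bool" where
  "rowI cs cc st code Lb Hb v s \<longleftrightarrow> ireg s 0 = n \<and> ireg s 1 = M ^ K \<and> ireg s 2 = N ^ K \<and> ireg s 3 = cs \<and>
    ireg s 4 = code \<and> ireg s 5 = v \<and> ireg s 7 = M ^ (v div B) \<and> ireg s 8 = N ^ (v div B) \<and>
    ireg s 12 = card {u. u < v \<and> u \<in> setof cc code} \<and> ireg s 15 = st \<and> ireg s 16 = cc \<and> mat s \<and>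
    isopt (ireg s 13) (rreg s 0) Lb Hb \<and>
    (\<forall>c<code. \<forall>u<n. cellok s cc st c u) \<and> (\<forall>u<v. cellok s cc st code u)"

lemma idx_eq: "u < n \<Longrightarrow> v < n \<Longrightarrow> n * n + c * n + u = n * n + c' * n + v \<longleftrightarrow> c = c' \<and> u = v"
proof -
  assume uv: "u < n" "v < n"
  have "c * n + u = c' * n + v \<Longrightarrow> c = c' \<and> u = v"
  proof -
    assume a: "c * n + u = c' * n + v"
    have "(c * n + u) div n = c" "(c' * n + v) div n = c'" "(c * n + u) mod n = u" "(c' * n + v) mod n = v"
      using uv by auto
    then show ?thesis using a by metis
  qed
  then show ?thesis by auto
qed

lemma runs_cell:
  assumes I: "rowI cs cc st code Lb Hb v s" and b: "code < M ^ K" "v < n"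
  shows "runs w D m cell s (n * 10 + 20)
    (\<lambda>s'. ireg s' 5 = v \<and> rowI cs cc st code Lb Hb (Suc v) (s'\<lparr>ireg := (ireg s')(5 := Suc v)\<rparr>))"
proof -
  have r: "ireg s 0 = n" "ireg s 1 = M ^ K" "ireg s 2 = N ^ K" "ireg s 3 = cs" "ireg s 4 = code"
    "ireg s 5 = v" "ireg s 7 = M ^ (v div B)" "ireg s 8 = N ^ (v div B)"
    "ireg s 12 = card {u. u < v \<and> u \<in> setof cc code}" "ireg s 15 = st" "ireg s 16 = cc" "mat s"
    "isopt (ireg s 13) (rreg s 0) Lb Hb"
    and cells: "\<And>c u. c < code \<Longrightarrow> u < n \<Longrightarrow> cellok s cc st c u" "\<And>u. u < v \<Longrightarrow> cellok s cc st code u"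
    using I by (auto simp: rowI_def)
  have p: "ival s pE = tab_at cc code v" by (rule ival_pE) (use r in auto)
  have pb: "tab_at cc code v < 2 ^ w"
    using tab_le[of "dg M code (v div B)" "dg N cc (v div B)" "v mod B"] word_bounds(4) dg_less pos
    unfolding tab_at_def by (meson le_less_trans)
  define cnt where "cnt = card {u. u < Suc v \<and> u \<in> setof cc code}"
  have cnt: "cnt = card {u. u < v \<and> u \<in> setof cc code} + (if tab_at cc code v = 0 then 0 else 1)"
  proof -
    have "{u. u < Suc v \<and> u \<in> setof cc code} =
      (if v \<in> setof cc code then insert v {u. u < v \<and> u \<in> setof cc code} else {u. u < v \<and> u \<in> setof cc code})"
      by (auto simp: less_Suc_eq)
    then show ?thesis unfolding cnt_def tab_at_eq_0 by simp
  qed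
  have cntb: "cnt < 2 ^ w"
  proof -
    have "cnt \<le> card {..<Suc v}" unfolding cnt_def by (intro card_mono) auto
    then show ?thesis using b word_bounds(3) by simp
  qed
  define s1 where "s1 = s\<lparr>ireg := (ireg s)(10 := tab_at cc code v, 9 := 0, 12 := cnt)\<rparr>"
  have "vc w D m cell1 s (\<lambda>s'. s' = s1)"
    unfolding cell1_def using p pb cntb cnt r word_bounds by (simp add: s1_def)
  from runs_vc[OF this] have c1: "runs w D m cell1 s 3 (\<lambda>s'. s' = s1)" by (simp add: cell1_def eval_nat_numeral)
  have r1: "imem s1 = imem s" "rmem s1 = rmem s" "rreg s1 = rreg s" by (auto simp: s1_def)
  have c2: "runs w D m cell2 s1 (n * 10 + 7) (\<lambda>s'. imem s' = imem s1 \<and> rmem s' = rmem s1 \<and>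
    (\<forall>r. r \<notin> {6, 9, 11, 14} \<longrightarrow> ireg s' r = ireg s1 r) \<and> (\<forall>r. r \<notin> {1, 2, 3} \<longrightarrow> rreg s' r = rreg s1 r) \<and>
    isopt (ireg s' 9) (rreg s' 1) (Lo e n K cc st code v) (Hi e n cc st code v))"
    by (rule runs_cell2) (use r b cells r1 in \<open>auto simp: s1_def cellok_def mat_def\<close>)
  have c3: "runs w D m cell3 s2 6
      (\<lambda>s'. ireg s' 5 = v \<and> rowI cs cc st code Lb Hb (Suc v) (s'\<lparr>ireg := (ireg s')(5 := Suc v)\<rparr>))"
    if q: "imem s2 = imem s1 \<and> rmem s2 = rmem s1 \<and>
    (\<forall>r. r \<notin> {6, 9, 11, 14} \<longrightarrow> ireg s2 r = ireg s1 r) \<and> (\<forall>r. r \<notin> {1, 2, 3} \<longrightarrow> rreg s2 r = rreg s1 r) \<and>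
    isopt (ireg s2 9) (rreg s2 1) (Lo e n K cc st code v) (Hi e n cc st code v)" for s2
  proof -
    have r2: "ireg s2 0 = n" "ireg s2 1 = M ^ K" "ireg s2 2 = N ^ K" "ireg s2 3 = cs" "ireg s2 4 = code"
      "ireg s2 5 = v" "ireg s2 7 = M ^ (v div B)" "ireg s2 8 = N ^ (v div B)"
      "ireg s2 12 = cnt" "ireg s2 15 = st" "ireg s2 16 = cc" "ireg s2 13 = ireg s 13" "rreg s2 0 = rreg s 0"
      "imem s2 = imem s" "rmem s2 = rmem s"
      using q r by (auto simp: s1_def)
    have opt: "isopt (ireg s2 9) (rreg s2 1) (Lo e n K cc st code v) (Hi e n cc st code v)" using q by simp
    define A where "A = n * n + code * n + v"
    have Am: "A < m" using idx_less[OF b] by (simp add: A_def)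
    define fl :: nat where "fl = (if ireg s2 9 = 0 then 0 else 1)"
    \<comment> \<open>With flag \<open>0\<close> the real cell keeps its old contents. Naming that
      value lets both cases be treated as one update.\<close>
    define x where "x = (if ireg s2 9 = 0 then rmem s A else rreg s2 1)"
    have optx: "isopt fl x (Lo e n K cc st code v) (Hi e n cc st code v)"
      using opt by (auto simp: isopt_def fl_def x_def)
    have xb: "\<bar>rreg s2 1\<bar> \<le> 2 ^ w * D" if "ireg s2 9 \<noteq> 0"
    proof -
      have "\<bar>rreg s2 1\<bar> \<le> real n * D" using opt that Hi_bound by (auto simp: isopt_def)
      also have "\<dots> \<le> real (2 ^ w) * D"
        using word_bounds(3) D by (intro mult_right_mono) (auto simp only: of_nat_le_iff less_imp_le)
      finally show ?thesis by simp
    qed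
    \<comment> \<open>The weights are advanced even after the last city, so the block of
      \<open>n\<close> itself must have a weight within range.\<close>
    have le: "Suc v div B \<le> K" unfolding K using div_le_mono[of "Suc v" n B] b(2) by simp
    have "M ^ (Suc v div B) \<le> M ^ K" "N ^ (Suc v div B) \<le> N ^ K"
      using le pos by (auto intro!: power_increasing)
    then have pw: "M ^ (Suc v div B) < 2 ^ w" "N ^ (Suc v div B) < 2 ^ w" using word_bounds by auto
    have cellsA: "isopt (if n * n + c * n + u = A then fl else imem s (n * n + c * n + u))
        (if n * n + c * n + u = A then x else rmem s (n * n + c * n + u))
        (Lo e n K cc st c u) (Hi e n cc st c u)"
      if "(c < code \<and> u < n) \<or> (c = code \<and> u < Suc v)" for c u
    proof (cases "c = code \<and> u = v")
      case True
      then show ?thesis using optx by (simp add: A_def)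
    next
      case False
      then have "n * n + c * n + u \<noteq> A" using that b(2) idx_eq[of u v c code] by (auto simp: A_def)
      moreover have "cellok s cc st c u" using that False cells by (auto simp: less_Suc_eq)
      ultimately show ?thesis by (simp add: cellok_def)
    qed
    have mA: "(u * n + v' = A) = False" if "u < n" "v' < n" for u v'
      using mat_less[OF that] by (simp add: A_def)
    define s3 where "s3 = s2\<lparr>imem := (imem s)(A := fl), rmem := (rmem s)(A := x),
      ireg := (ireg s2)(7 := M ^ (Suc v div B), 8 := N ^ (Suc v div B))\<rparr>"
    have up: "(rmem s)(A := x) = rmem s" if "ireg s2 9 = 0" using that by (simp add: x_def)
    have vcp: "vc w D m cell3 s2 (\<lambda>s'. s' = s3)"
    proof -
      have iv7: "ival s' (powE M 7) = M ^ (Suc v div B)" if "ireg s' = ireg s2" for s'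
        by (rule ival_powE) (use that r2 in auto)
      have iv8: "ival s' (powE N 8) = N ^ (Suc v div B)"
        if "ireg s' = (ireg s2)(7 := M ^ (Suc v div B))" for s'
        by (rule ival_powE) (use that r2 in auto)
      show ?thesis
      proof (cases "ireg s2 9 = 0")
        case True
        have "s2\<lparr>imem := (imem s)(A := 0), ireg := (ireg s2)(7 := M ^ (Suc v div B), 8 := N ^ (Suc v div B))\<rparr> = s3"
          using True r2 up[OF True] by (simp add: s3_def fl_def)
        then show ?thesis unfolding cell3_def
          using True r2 Am pw word_bounds(5) by (simp add: iv7 iv8 A_def[symmetric])
      next
        case False
        then show ?thesis unfolding cell3_def
          using r2 Am pw word_bounds(5) xb by (simp add: iv7 iv8 A_def[symmetric] s3_def fl_def x_def)
      qed
    qed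
    have "ireg s3 5 = v \<and> rowI cs cc st code Lb Hb (Suc v) (s3\<lparr>ireg := (ireg s3)(5 := Suc v)\<rparr>)"
      using r2 r(12,13) cellsA mA by (simp add: s3_def rowI_def cellok_def mat_def cnt_def)
    with runs_vc[OF vcp] show ?thesis by (elim runs_mono) (auto simp: cell3_def)
  qed
  have "runs w D m (Seq cell2 cell3) s1 (n * 10 + 7 + 6)
      (\<lambda>s'. ireg s' 5 = v \<and> rowI cs cc st code Lb Hb (Suc v) (s'\<lparr>ireg := (ireg s')(5 := Suc v)\<rparr>))"
    by (rule runs_Seq[OF runs_mono[OF c2 order_refl c3]])
  then have "runs w D m cell1 s 3 (\<lambda>s'. runs w D m (Seq cell2 cell3) s' (n * 10 + 7 + 6)
      (\<lambda>s'. ireg s' 5 = v \<and> rowI cs cc st code Lb Hb (Suc v) (s'\<lparr>ireg := (ireg s')(5 := Suc v)\<rparr>)))"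
    using c1 by (auto elim: runs_mono)
  from runs_Seq[OF this] show ?thesis unfolding cell_def by (rule runs_mono) auto
qed

end

section \<open>Rows, sweeps and the whole program\<close>

context cover_tables
begin

definition row :: com where
  "row = Seq (Seq (ISet 12 (IConst 0)) (Seq (ISet 7 (IConst 1)) (ISet 8 (IConst 1))))
    (Seq (For 5 (IReg 0) cell)
      (Cond (BNot (ILess (IReg 12) (IReg 0))) (scan 4 15 13 0) Skip))"

definition sweep :: com where
  "sweep = Seq (Seq (ISet 15 (IMod (IReg 3) (IReg 0))) (ISet 16 (IDiv (IReg 3) (IReg 0))))
    (For 4 (IReg 1) row)"

definition powers :: com where
  "powers = Seq (Seq (ISet 1 (IConst 1)) (ISet 2 (IConst 1)))
    (For 5 (IAdd (IDiv (IReg 0) (IConst B)) (IConst 1))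
      (Seq (ISet 1 (IMul (IReg 1) (IConst M))) (ISet 2 (IMul (IReg 2) (IConst N)))))"

definition tsp_prog :: com where
  "tsp_prog = Seq powers (For 3 (IMul (IReg 2) (IReg 0)) sweep)"

end

definition tours :: "(nat \<Rightarrow> nat \<Rightarrow> real) \<Rightarrow> nat \<Rightarrow> real set" where
  "tours e n = (\<lambda>xs. plen e xs + e (last xs) (hd xs)) ` permutations_of_set {..<n}"

context tsp_run
begin

text \<open>Inclusion rather than equality, because the program counts only cities below
  \<open>n\<close>. A set with further elements passes the test but has no paths and adds
  nothing.\<close>

definition fin :: "nat \<Rightarrow> nat \<Rightarrow> nat \<Rightarrow> real set" where
  "fin cc st code = (if {..<n} \<subseteq> setof cc code
     then \<Union>u<n. (\<lambda>y. y + e u st) ` Lo e n K cc st code u else {})"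

lemma tours_Hi:
  assumes "{..<n} \<subseteq> setof cc code"
  shows "(\<Union>u<n. (\<lambda>y. y + e u st) ` Hi e n cc st code u) \<subseteq> tours e n"
proof
  fix z assume "z \<in> (\<Union>u<n. (\<lambda>y. y + e u st) ` Hi e n cc st code u)"
  then obtain u xs where xs: "xs \<in> paths n cc st code u" "z = plen e xs + e u st" by (auto simp: Hi_def)
  then have "xs \<in> permutations_of_set {..<n}" "last xs = u" "hd xs = st"
    using assms by (auto simp: paths_def permutations_of_set_def)
  then show "z \<in> tours e n" unfolding tours_def xs(2) by blast
qed

definition rowS :: "nat \<Rightarrow> nat \<Rightarrow> nat \<Rightarrow> real set \<Rightarrow> nat \<Rightarrow> state \<Rightarrow> bool" where
  "rowS cs cc st Lb code s \<longleftrightarrow> ireg s 0 = n \<and> ireg s 1 = M ^ K \<and> ireg s 2 = N ^ K \<and> ireg s 3 = cs \<and>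
    ireg s 4 = code \<and> ireg s 15 = st \<and> ireg s 16 = cc \<and> mat s \<and>
    isopt (ireg s 13) (rreg s 0) Lb (tours e n) \<and> (\<forall>c<code. \<forall>u<n. cellok s cc st c u)"

text \<open>The \<open>- 2\<close> in the time bound makes up for the two steps that
  \<open>runs_For\<close> adds per round, so that all rows together cost a plain multiple of
  \<open>n * n\<close>.\<close>

lemma runs_row:
  assumes S: "rowS cs cc st Lb code s" and b: "code < M ^ K" "st < n"
  shows "runs w D m row s (60 * n * n - 2)
    (\<lambda>s'. ireg s' 4 = code \<and> rowS cs cc st (Lb \<union> fin cc st code) (Suc code) (s'\<lparr>ireg := (ireg s')(4 := Suc code)\<rparr>))"
    (is "runs w D m row s _ ?Q")
proof -
  let ?I = "rowI cs cc st code Lb (tours e n)"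
  have last: "runs w D m (Cond (BNot (ILess (IReg 12) (IReg 0))) (scan 4 15 13 0) Skip) s2 (1 + (2 + n * 10)) ?Q"
    if I2: "?I n s2" for s2
  proof -
    have r: "ireg s2 0 = n" "ireg s2 1 = M ^ K" "ireg s2 2 = N ^ K" "ireg s2 3 = cs" "ireg s2 4 = code"
      "ireg s2 12 = card {u. u < n \<and> u \<in> setof cc code}" "ireg s2 15 = st" "ireg s2 16 = cc" "mat s2"
      "isopt (ireg s2 13) (rreg s2 0) Lb (tours e n)"
      and cells: "\<And>c u. c < Suc code \<Longrightarrow> u < n \<Longrightarrow> cellok s2 cc st c u"
      using I2 by (auto simp: rowI_def less_Suc_eq)
    have full: "\<not> card {u. u < n \<and> u \<in> setof cc code} < n \<longleftrightarrow> {..<n} \<subseteq> setof cc code"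
    proof
      assume a: "\<not> card {u. u < n \<and> u \<in> setof cc code} < n"
      have "{u. u < n \<and> u \<in> setof cc code} = {..<n}"
        by (rule card_subset_eq) (use a card_mono[of "{..<n}" "{u. u < n \<and> u \<in> setof cc code}"] in auto)
      then show "{..<n} \<subseteq> setof cc code" by blast
    next
      assume "{..<n} \<subseteq> setof cc code"
      then have "{u. u < n \<and> u \<in> setof cc code} = {..<n}" by blast
      then show "\<not> card {u. u < n \<and> u \<in> setof cc code} < n" by simp
    qed
    show ?thesis
    proof (rule runs_Cond)
      assume "bval s2 (BNot (ILess (IReg 12) (IReg 0)))"
      then have sub: "{..<n} \<subseteq> setof cc code" using r full by simp
      have "runs w D m (scan 4 15 13 0) s2 (2 + n * 10) (\<lambda>s'. imem s' = imem s2 \<and> rmem s' = rmem s2 \<and>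
        (\<forall>r. r \<notin> {6, 14, 13} \<longrightarrow> ireg s' r = ireg s2 r) \<and>
        (\<forall>r. r \<notin> {2, 3, 0} \<longrightarrow> rreg s' r = rreg s2 r) \<and>
        isopt (ireg s' 13) (rreg s' 0) (Lb \<union> (\<Union>u<n. (\<lambda>y. y + e u st) ` Lo e n K cc st code u))
          (tours e n \<union> (\<Union>u<n. (\<lambda>y. y + e u st) ` Hi e n cc st code u)))"
      proof (rule runs_scan)
        show "rmem s2 (u * n + v) = e u v" if "u < n" "v < n" for u v
          using r that by (simp add: mat_def)
        show "isopt (imem s2 (n * n + code * n + u)) (rmem s2 (n * n + code * n + u))
          (Lo e n K cc st code u) (Hi e n cc st code u)" if "u < n" for u
          using cells[of code u] that by (simp add: cellok_def)
      qed (use r b Hi_bound in auto)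
      then show "runs w D m (scan 4 15 13 0) s2 (2 + n * 10) ?Q"
      proof (rule runs_mono)
        fix s' :: state assume a: "imem s' = imem s2 \<and> rmem s' = rmem s2 \<and>
          (\<forall>r. r \<notin> {6, 14, 13} \<longrightarrow> ireg s' r = ireg s2 r) \<and>
          (\<forall>r. r \<notin> {2, 3, 0} \<longrightarrow> rreg s' r = rreg s2 r) \<and>
          isopt (ireg s' 13) (rreg s' 0) (Lb \<union> (\<Union>u<n. (\<lambda>y. y + e u st) ` Lo e n K cc st code u))
            (tours e n \<union> (\<Union>u<n. (\<lambda>y. y + e u st) ` Hi e n cc st code u))"
        have "tours e n \<union> (\<Union>u<n. (\<lambda>y. y + e u st) ` Hi e n cc st code u) = tours e n"
          using tours_Hi[OF sub] by blast
        moreover have "Lb \<union> (\<Union>u<n. (\<lambda>y. y + e u st) ` Lo e n K cc st code u) = Lb \<union> fin cc st code"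
          using sub by (simp add: fin_def)
        ultimately have "isopt (ireg s' 13) (rreg s' 0) (Lb \<union> fin cc st code) (tours e n)"
          using a by simp
        then show "?Q s'" using a r(1-9) cells by (simp add: rowS_def cellok_def mat_def)
      qed simp
    next
      assume "\<not> bval s2 (BNot (ILess (IReg 12) (IReg 0)))"
      then have "fin cc st code = {}" using r full by (simp add: fin_def)
      then have "vc w D m Skip s2 ?Q" using r cells by (simp add: rowS_def cellok_def mat_def)
      from runs_vc[OF this] show "runs w D m Skip s2 (2 + n * 10) ?Q" by (rule runs_mono) auto
    qed
  qed
  have "runs w D m (For 5 (IReg 0) cell) s1 (2 + n * (n * 10 + 20 + 2)) (?I n)"
    if s1: "s1 = s\<lparr>ireg := (ireg s)(12 := 0, 7 := 1, 8 := 1)\<rparr>" for s1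
  proof (rule runs_For[where I = ?I])
    show "?I 0 (s1\<lparr>ireg := (ireg s1)(5 := 0)\<rparr>)"
      using S by (simp add: s1 rowS_def rowI_def cellok_def mat_def)
    show "ireg s' 5 = k \<and> ival s' (IReg 0) = n" if "?I k s'" for k s'
      using that by (simp add: rowI_def)
    show "n < 2 ^ w" by (rule word_bounds)
  qed (rule runs_cell[OF _ b(1)])
  from runs_Seq[OF runs_mono[OF this order_refl last]]
  have rest: "runs w D m (Seq (For 5 (IReg 0) cell) (Cond (BNot (ILess (IReg 12) (IReg 0))) (scan 4 15 13 0) Skip))
      s1 (2 + n * (n * 10 + 20 + 2) + (1 + (2 + n * 10))) ?Q"
    if "s1 = s\<lparr>ireg := (ireg s)(12 := 0, 7 := 1, 8 := 1)\<rparr>" for s1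
    using that by blast
  have "vc w D m (Seq (ISet 12 (IConst 0)) (Seq (ISet 7 (IConst 1)) (ISet 8 (IConst 1)))) s
    (\<lambda>s1. s1 = s\<lparr>ireg := (ireg s)(12 := 0, 7 := 1, 8 := 1)\<rparr>)"
    using word_bounds(5) by simp
  from runs_Seq[OF runs_mono[OF runs_vc[OF this] order_refl rest]]
  have "runs w D m row s (3 + (2 + n * (n * 10 + 20 + 2) + (1 + (2 + n * 10)))) ?Q"
    unfolding row_def by (simp add: eval_nat_numeral)
  then show ?thesis
  proof (rule runs_mono)
    have "3 + (2 + n * (n * 10 + 20 + 2) + (1 + (2 + n * 10))) = 8 + 32 * n + 10 * (n * n)"
      by (simp add: algebra_simps)
    also have "\<dots> \<le> 60 * (n * n) - 2" using n_le n by linarith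
    finally show "3 + (2 + n * (n * 10 + 20 + 2) + (1 + (2 + n * 10))) \<le> 60 * n * n - 2" by (simp add: mult.assoc)
  qed
qed

definition CL :: "nat \<Rightarrow> real set" where
  "CL cs = (\<lambda>xs. plen e xs + e (last xs) (hd xs)) `
     {xs \<in> permutations_of_set {..<n}. hd xs = cs mod n \<and> covers (setof (cs div n) ` {..<M ^ K}) xs}"

text \<open>An ordering is a prefix of itself, so the set of all its cities has a code in the
  family, and closing the tours of that full state accounts for it.\<close>

lemma CL_fin: "CL cs \<subseteq> (\<Union>c<M ^ K. fin (cs div n) (cs mod n) c)"
proof
  fix z assume "z \<in> CL cs"
  then obtain xs where xs: "xs \<in> permutations_of_set {..<n}" "hd xs = cs mod n"
    "covers (setof (cs div n) ` {..<M ^ K}) xs" "z = plen e xs + e (last xs) (hd xs)" by (auto simp: CL_def)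
  have sx: "set xs = {..<n}" "distinct xs" using xs(1) by (auto simp: permutations_of_set_def)
  have ne: "xs \<noteq> []"
  proof
    assume "xs = []"
    then have "{..<n} = {}" using sx(1) by simp
    then show False using n by (metis empty_iff lessThan_iff)
  qed
  have "set xs \<in> setof (cs div n) ` {..<M ^ K}" using xs(3) unfolding covers_def by (metis append_Nil2)
  then obtain c where c: "c < M ^ K" "setof (cs div n) c = {..<n}" using sx by auto
  have "xs \<in> paths n (cs div n) (cs mod n) c (last xs)"
    using sx ne xs(2) c(2) by (simp add: paths_def)
  then have "plen e xs \<in> Lo e n K (cs div n) (cs mod n) c (last xs)" using xs(3) by (auto simp: Lo_def)
  moreover have "last xs < n" using last_in_set[OF ne] sx by simp
  ultimately have "z \<in> fin (cs div n) (cs mod n) c" using c(2) xs(2,4) by (auto simp: fin_def)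
  then show "z \<in> (\<Union>c<M ^ K. fin (cs div n) (cs mod n) c)" using c(1) by blast
qed

definition sweepI :: "nat \<Rightarrow> state \<Rightarrow> bool" where
  "sweepI cs s \<longleftrightarrow> ireg s 0 = n \<and> ireg s 1 = M ^ K \<and> ireg s 2 = N ^ K \<and> ireg s 3 = cs \<and> mat s \<and>
    isopt (ireg s 13) (rreg s 0) (\<Union>c<cs. CL c) (tours e n)"

lemma runs_sweep:
  assumes S: "sweepI cs s" and cs: "cs < N ^ K * n"
  shows "runs w D m sweep s (66 * n * n * M ^ K - 2)
    (\<lambda>s'. ireg s' 3 = cs \<and> sweepI (Suc cs) (s'\<lparr>ireg := (ireg s')(3 := Suc cs)\<rparr>))"
    (is "runs w D m sweep s _ ?Q")
proof -
  let ?cc = "cs div n" and ?st = "cs mod n" and ?Lb = "\<Union>c<cs. CL c"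
  define I where "I k = rowS cs ?cc ?st (?Lb \<union> (\<Union>c<k. fin ?cc ?st c)) k" for k
  have st: "?st < n" using n by simp
  have st_w: "?st < 2 ^ w" using st word_bounds(3) by linarith
  have cc_w: "?cc < 2 ^ w" using cs word_bounds(6) div_le_dividend[of cs n] by linarith
  have "runs w D m (For 4 (IReg 1) row) s1 (2 + M ^ K * (60 * n * n - 2 + 2)) (I (M ^ K))"
    if s1: "s1 = s\<lparr>ireg := (ireg s)(15 := ?st, 16 := ?cc)\<rparr>" for s1
  proof (rule runs_For)
    show "I 0 (s1\<lparr>ireg := (ireg s1)(4 := 0)\<rparr>)"
      using S by (simp add: I_def s1 rowS_def sweepI_def mat_def)
    show "ireg s' 4 = k \<and> ival s' (IReg 1) = M ^ K" if "I k s'" for k s'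
      using that by (simp add: I_def rowS_def)
    show "M ^ K < 2 ^ w" by (rule word_bounds)
    show "runs w D m row s' (60 * n * n - 2)
      (\<lambda>s'. ireg s' 4 = k \<and> I (Suc k) (s'\<lparr>ireg := (ireg s')(4 := Suc k)\<rparr>))"
      if "k < M ^ K" "I k s'" for k s'
    proof -
      have "?Lb \<union> (\<Union>c<k. fin ?cc ?st c) \<union> fin ?cc ?st k = ?Lb \<union> (\<Union>c<Suc k. fin ?cc ?st c)"
        by (auto simp: lessThan_Suc)
      then show ?thesis using runs_row[OF that(2)[unfolded I_def] that(1) st] unfolding I_def by simp
    qed
  qed
  moreover have "vc w D m (Seq (ISet 15 (IMod (IReg 3) (IReg 0))) (ISet 16 (IDiv (IReg 3) (IReg 0)))) s
    (\<lambda>s1. s1 = s\<lparr>ireg := (ireg s)(15 := ?st, 16 := ?cc)\<rparr>)"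
    using S st_w cc_w by (simp add: sweepI_def)
  ultimately have "runs w D m sweep s (2 + (2 + M ^ K * (60 * n * n - 2 + 2))) (I (M ^ K))"
    unfolding sweep_def by (intro runs_Seq[OF runs_mono[OF runs_vc]]) (auto simp: eval_nat_numeral)
  then show ?thesis
  proof (rule runs_mono)
    have MK: "1 \<le> M ^ K" "1 \<le> n * n" using pos n by auto
    have "1 * 1 \<le> (n * n) * M ^ K" using MK by (intro mult_le_mono) auto
    moreover have "M ^ K * (60 * n * n - 2 + 2) = 60 * ((n * n) * M ^ K)" using MK by (simp add: algebra_simps)
    moreover have "66 * n * n * M ^ K = 66 * ((n * n) * M ^ K)" by (simp add: algebra_simps)
    ultimately show "2 + (2 + M ^ K * (60 * n * n - 2 + 2)) \<le> 66 * n * n * M ^ K - 2" by linarith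
  next
    fix s' assume "I (M ^ K) s'"
    then have s': "rowS cs ?cc ?st (?Lb \<union> (\<Union>c<M ^ K. fin ?cc ?st c)) (M ^ K) s'" by (simp add: I_def)
    have sub: "(\<Union>c<Suc cs. CL c) \<subseteq> ?Lb \<union> (\<Union>c<M ^ K. fin ?cc ?st c)"
      using CL_fin[of cs] by (auto simp: lessThan_Suc)
    have "isopt (ireg s' 13) (rreg s' 0) (?Lb \<union> (\<Union>c<M ^ K. fin ?cc ?st c)) (tours e n)"
      using s' unfolding rowS_def by (elim conjE)
    from isopt_mono[OF this sub order_refl]
    have "isopt (ireg s' 13) (rreg s' 0) (\<Union>c<Suc cs. CL c) (tours e n)" .
    then show "?Q s'" using s' by (simp add: rowS_def sweepI_def mat_def)
  qed
qed

text \<open>Some \<open>cc\<close> covers the ordering, and its pair with the first city is a value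
  of the outer loop. This closes the gap in \<open>isopt\<close>: at the end both sets are
  \<open>tours e n\<close>.\<close>

lemma all_covered: "tours e n \<subseteq> (\<Union>cs<N ^ K * n. CL cs)"
proof
  fix z assume "z \<in> tours e n"
  then obtain xs where xs: "xs \<in> permutations_of_set {..<n}" "z = plen e xs + e (last xs) (hd xs)"
    by (auto simp: tours_def)
  have "n < K * B" unfolding K using pos(1) dividend_less_div_times[of B n] by simp
  from ex_setof_covers[OF this xs(1)] obtain cc where cc: "cc < N ^ K" "covers (setof cc ` {..<M ^ K}) xs"
    by blast
  have "set xs = {..<n}" using xs(1) by (simp add: permutations_of_set_def)
  then have hd: "hd xs < n" using n hd_in_set[of xs] by (cases "xs = []") auto
  define cs where "cs = cc * n + hd xs"
  have "cs div n = cc" "cs mod n = hd xs" using hd by (auto simp: cs_def)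
  then have "z \<in> CL cs" using xs cc by (auto simp: CL_def)
  moreover have "cs < N ^ K * n"
  proof -
    have "cs < Suc cc * n" using hd by (simp add: cs_def)
    also have "\<dots> \<le> N ^ K * n" using cc(1) by (intro mult_right_mono) auto
    finally show ?thesis .
  qed
  ultimately show "z \<in> (\<Union>cs<N ^ K * n. CL cs)" by blast
qed

lemma runs_tsp_prog:
  assumes s: "ireg s 0 = n" "ireg s 13 = 0" "mat s"
  shows "runs w D m tsp_prog s (80 * n ^ 3 * N ^ K * M ^ K) (\<lambda>s'. rreg s' 0 = Min (tours e n))"
proof -
  define J where "J k s' \<longleftrightarrow> ireg s' 0 = n \<and> ireg s' 13 = 0 \<and> ireg s' 1 = M ^ k \<and> ireg s' 2 = N ^ k \<and>
    ireg s' 5 = k \<and> mat s'" for k s'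
  let ?body = "Seq (ISet 1 (IMul (IReg 1) (IConst M))) (ISet 2 (IMul (IReg 2) (IConst N)))"
  have "runs w D m (For 5 (IAdd (IDiv (IReg 0) (IConst B)) (IConst 1)) ?body) s1 (2 + K * (2 + 2)) (J K)"
    if s1: "s1 = s\<lparr>ireg := (ireg s)(1 := 1, 2 := 1)\<rparr>" for s1
  proof (rule runs_For)
    show "J 0 (s1\<lparr>ireg := (ireg s1)(5 := 0)\<rparr>)" using s by (simp add: s1 J_def mat_def)
    show "ireg s' 5 = k \<and> ival s' (IAdd (IDiv (IReg 0) (IConst B)) (IConst 1)) = K" if "J k s'" for k s'
      using that by (simp add: J_def K)
    have "K \<le> n + 1" unfolding K by simp
    then show "K < 2 ^ w" using big n_le by linarith
    show "runs w D m ?body s' 2 (\<lambda>s'. ireg s' 5 = k \<and> J (Suc k) (s'\<lparr>ireg := (ireg s')(5 := Suc k)\<rparr>))"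
      if "k < K" "J k s'" for k s'
    proof -
      have "M ^ Suc k \<le> M ^ K" "N ^ Suc k \<le> N ^ K" using that(1) pos by (intro power_increasing; simp)+
      then have "M ^ Suc k < 2 ^ w" "N ^ Suc k < 2 ^ w" using word_bounds by linarith+
      then have "vc w D m ?body s' (\<lambda>s'. ireg s' 5 = k \<and> J (Suc k) (s'\<lparr>ireg := (ireg s')(5 := Suc k)\<rparr>))"
        using that(2) by (simp add: J_def mat_def mult.commute)
      from runs_vc[OF this] show ?thesis by (simp add: eval_nat_numeral)
    qed
  qed
  moreover have "vc w D m (Seq (ISet 1 (IConst 1)) (ISet 2 (IConst 1))) s
    (\<lambda>s1. s1 = s\<lparr>ireg := (ireg s)(1 := 1, 2 := 1)\<rparr>)"
    using word_bounds(5) by simp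
  ultimately have p: "runs w D m powers s (2 + (2 + K * (2 + 2))) (J K)"
    unfolding powers_def by (intro runs_Seq[OF runs_mono[OF runs_vc]]) (auto simp: eval_nat_numeral)
  have q: "runs w D m (For 3 (IMul (IReg 2) (IReg 0)) sweep) s1
      (2 + N ^ K * n * (66 * n * n * M ^ K - 2 + 2)) (sweepI (N ^ K * n))"
    if "J K s1" for s1
  proof (rule runs_For)
    show "sweepI 0 (s1\<lparr>ireg := (ireg s1)(3 := 0)\<rparr>)"
      using that by (simp add: J_def sweepI_def mat_def isopt_def)
    show "ireg s' 3 = k \<and> ival s' (IMul (IReg 2) (IReg 0)) = N ^ K * n" if "sweepI k s'" for k s'
      using that by (simp add: sweepI_def)
    show "N ^ K * n < 2 ^ w" by (rule word_bounds)
  qed (rule runs_sweep)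
  from runs_Seq[OF runs_mono[OF p order_refl q]]
  have "runs w D m tsp_prog s (2 + (2 + K * (2 + 2)) + (2 + N ^ K * n * (66 * n * n * M ^ K - 2 + 2)))
      (sweepI (N ^ K * n))" unfolding tsp_prog_def .
  then show ?thesis
  proof (rule runs_mono)
    define X where "X = n ^ 3 * N ^ K * M ^ K"
    have "1 \<le> n * n" "1 \<le> M ^ K" using n pos by auto
    then have "1 * 1 \<le> n * n * M ^ K" by (intro mult_le_mono) auto
    then have "66 * (n * n * M ^ K) - 2 + 2 = 66 * (n * n * M ^ K)" by linarith
    then have "66 * n * n * M ^ K - 2 + 2 = 66 * n * n * M ^ K" by (simp only: mult.assoc)
    then have 1: "N ^ K * n * (66 * n * n * M ^ K - 2 + 2) = 66 * X"
      by (simp add: X_def power3_eq_cube algebra_simps)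
    have "n * 1 * 1 \<le> n ^ 3 * N ^ K * M ^ K"
      using n pos by (intro mult_le_mono) (auto simp: self_le_power)
    then have "n \<le> X" by (simp only: X_def mult_1_right)
    moreover from this have "1 \<le> X" using n by linarith
    moreover have "K \<le> n + 1" unfolding K by simp
    ultimately have "2 + (2 + K * (2 + 2)) + (2 + 66 * X) \<le> 80 * X" by simp
    then show "2 + (2 + K * (2 + 2)) + (2 + N ^ K * n * (66 * n * n * M ^ K - 2 + 2)) \<le> 80 * n ^ 3 * N ^ K * M ^ K"
      unfolding 1 by (simp add: X_def mult.assoc)
  next
    fix s' assume "sweepI (N ^ K * n) s'"
    then have o: "isopt (ireg s' 13) (rreg s' 0) (tours e n) (tours e n)"
      using isopt_mono[OF _ all_covered order_refl] by (simp add: sweepI_def)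
    have fin: "finite (tours e n)" by (simp add: tours_def)
    have ne: "tours e n \<noteq> {}" by (simp add: tours_def)
    show "rreg s' 0 = Min (tours e n)"
      using o ne fin by (intro Min_eqI[symmetric]) (auto simp: isopt_def)
  qed
qed

end

section \<open>Time and space bounds\<close>

lemma plen_eq_sum: "plen e xs = (\<Sum>i<length xs - 1. e (xs ! i) (xs ! Suc i))"
proof (induction xs rule: induct_list012)
  case (3 x y zs)
  then show ?case by (simp add: sum.lessThan_Suc_shift del: sum.lessThan_Suc)
qed auto

lemma tour_length_eq:
  assumes n: "0 < n" and xs: "length xs = n" "\<And>i. i < n \<Longrightarrow> \<pi> (Suc i) = Suc (xs ! i)"
  shows "tour_length n d \<pi> = plen (\<lambda>u v. d (u + 1) (v + 1)) xs + d (last xs + 1) (hd xs + 1)"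
proof -
  have "(\<Sum>i = 1..n - 1. d (\<pi> i) (\<pi> (i + 1))) = (\<Sum>i<n - 1. d (\<pi> (Suc i)) (\<pi> (Suc (Suc i))))"
    by (simp add: sum.atLeast1_atMost_eq)
  also have "\<dots> = (\<Sum>i<n - 1. d (xs ! i + 1) (xs ! Suc i + 1))"
    by (rule sum.cong) (auto simp: xs(2))
  also have "\<dots> = plen (\<lambda>u v. d (u + 1) (v + 1)) xs" by (simp add: plen_eq_sum xs(1))
  finally have 1: "(\<Sum>i = 1..n - 1. d (\<pi> i) (\<pi> (i + 1))) = plen (\<lambda>u v. d (u + 1) (v + 1)) xs" .
  have ne: "xs \<noteq> []" using n xs(1) by auto
  have 2: "\<pi> n = last xs + 1" using xs(2)[of "n - 1"] n ne xs(1) by (simp add: last_conv_nth)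
  have 3: "\<pi> 1 = hd xs + 1" using xs(2)[of 0] n ne by (simp add: hd_conv_nth)
  show ?thesis unfolding tour_length_def 1 2 3 by simp
qed

text \<open>Lists count cities and positions from \<open>0\<close>, permutations from
  \<open>1\<close>: entry \<open>i\<close> of the list is \<open>\<pi> (Suc i) - 1\<close>.\<close>

lemma tours_eq:
  assumes n: "0 < n"
  shows "tours (\<lambda>u v. d (u + 1) (v + 1)) n = {tour_length n d \<pi> | \<pi>. \<pi> permutes {1..n}}"
proof (intro equalityI subsetI)
  fix z assume "z \<in> tours (\<lambda>u v. d (u + 1) (v + 1)) n"
  then obtain xs where xs: "set xs = {..<n}" "distinct xs"
    "z = plen (\<lambda>u v. d (u + 1) (v + 1)) xs + d (last xs + 1) (hd xs + 1)"
    by (auto simp: tours_def permutations_of_set_def)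
  have len: "length xs = n" using distinct_card[OF xs(2)] xs(1) by simp
  define \<pi> where "\<pi> i = (if i \<in> {1..n} then Suc (xs ! (i - 1)) else i)" for i
  have "\<pi> permutes {1..n}"
  proof (rule bij_imp_permutes)
    have sub: "\<pi> ` {1..n} \<subseteq> {1..n}"
    proof
      fix y assume "y \<in> \<pi> ` {1..n}"
      then obtain i where i: "1 \<le> i" "i \<le> n" "y = Suc (xs ! (i - 1))" by (auto simp: \<pi>_def)
      have "xs ! (i - 1) \<in> set xs" using i len by (intro nth_mem) auto
      then show "y \<in> {1..n}" using xs(1) i by auto
    qed
    have inj: "inj_on \<pi> {1..n}"
    proof (rule inj_onI)
      fix i j assume "i \<in> {1..n}" "j \<in> {1..n}" "\<pi> i = \<pi> j"
      then have "xs ! (i - 1) = xs ! (j - 1)" "i - 1 < n" "j - 1 < n" "1 \<le> i" "1 \<le> j"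
        by (auto simp: \<pi>_def)
      then show "i = j" using nth_eq_iff_index_eq[OF xs(2)] len by (metis le_add_diff_inverse)
    qed
    show "bij_betw \<pi> {1..n} {1..n}"
      unfolding bij_betw_def using inj endo_inj_surj[OF _ sub inj] by simp
  qed (auto simp: \<pi>_def)
  moreover have "z = tour_length n d \<pi>"
    unfolding xs(3) by (rule tour_length_eq[symmetric, OF n len]) (simp add: \<pi>_def)
  ultimately show "z \<in> {tour_length n d \<pi> | \<pi>. \<pi> permutes {1..n}}" by blast
next
  fix z assume "z \<in> {tour_length n d \<pi> | \<pi>. \<pi> permutes {1..n}}"
  then obtain \<pi> where \<pi>: "\<pi> permutes {1..n}" "z = tour_length n d \<pi>" by blast
  define xs where "xs = map (\<lambda>i. \<pi> (Suc i) - 1) [0..<n]"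
  have pin: "1 \<le> \<pi> (Suc i) \<and> \<pi> (Suc i) \<le> n" if "i < n" for i
    using permutes_in_image[OF \<pi>(1), of "Suc i"] that by simp
  have dis: "distinct xs"
    unfolding xs_def distinct_map
  proof (intro conjI inj_onI)
    fix i j assume ij: "i \<in> set [0..<n]" "j \<in> set [0..<n]" "\<pi> (Suc i) - 1 = \<pi> (Suc j) - 1"
    then have "\<pi> (Suc i) = \<pi> (Suc j)" using pin[of i] pin[of j] by auto
    then show "i = j" using permutes_inj[OF \<pi>(1)] by (auto dest: injD)
  qed simp
  have sub: "set xs \<subseteq> {..<n}"
  proof
    fix y assume "y \<in> set xs"
    then obtain i where "i < n" "y = \<pi> (Suc i) - 1" by (auto simp: xs_def)
    then show "y \<in> {..<n}" using pin[of i] by auto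
  qed
  have "set xs = {..<n}"
    by (rule card_subset_eq[OF _ sub]) (simp_all add: distinct_card[OF dis], simp add: xs_def)
  then have "xs \<in> permutations_of_set {..<n}" using dis by (simp add: permutations_of_set_def)
  moreover have "z = plen (\<lambda>u v. d (u + 1) (v + 1)) xs + d (last xs + 1) (hd xs + 1)"
    unfolding \<pi>(2)
  proof (rule tour_length_eq[OF n])
    show "\<pi> (Suc i) = Suc (xs ! i)" if "i < n" for i
      using pin[OF that] that by (simp add: xs_def)
  qed (simp add: xs_def)
  ultimately show "z \<in> tours (\<lambda>u v. d (u + 1) (v + 1)) n" unfolding tours_def by blast
qed

lemma abs_le_max_dist:
  assumes "i \<in> {1..n}" "j \<in> {1..n}"
  shows "\<bar>d i j\<bar> \<le> max_dist n d"
proof -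
  have "finite {\<bar>d i j\<bar> | i j. i \<in> {1..n} \<and> j \<in> {1..n}}" by (rule finite_image_set2) auto
  then show ?thesis unfolding max_dist_def by (rule Max_ge) (use assms in blast)
qed

lemma (in cover_tables) solves_tsp_prog:
  assumes n: "0 < n"
    and big: "n * n + M ^ (n div B + 1) * n + N ^ (n div B + 1) * n + M + 2 < 2 ^ (k * n)"
  shows "\<exists>t. solves_tsp tsp_prog k n d t (2 * (n * n + M ^ (n div B + 1) * n)) \<and>
    t \<le> 80 * n ^ 3 * N ^ (n div B + 1) * M ^ (n div B + 1)"
proof -
  define e where "e u v = d (u + 1) (v + 1)" for u v
  define m where "m = n * n + M ^ (n div B + 1) * n"
  have D: "0 \<le> max_dist n d" using abs_le_max_dist[of 1 n 1 d] n by simp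
  interpret tsp_run B N M dec n "n div B + 1" "k * n" m "max_dist n d" e
    by unfold_locales (use n big D in \<open>auto simp: m_def e_def intro!: abs_le_max_dist\<close>)
  have "mat (tsp_input n d)"
    using mat_less by (auto simp: mat_def tsp_input_def e_def)
  then obtain t s where ts: "exec (k * n) (max_dist n d) m tsp_prog (tsp_input n d) t s"
    "t \<le> 80 * n ^ 3 * N ^ (n div B + 1) * M ^ (n div B + 1)" "rreg s 0 = Min (tours e n)"
    using runs_tsp_prog[of "tsp_input n d"] by (auto simp: tsp_input_def runs_def)
  have "Min (tours e n) = tsp_opt n d"
    unfolding tsp_opt_def tours_eq[OF n, symmetric] e_def ..
  then have "solves_tsp tsp_prog k n d t (2 * m)"
    unfolding solves_tsp_def using ts by (intro exI[of _ m] exI[of _ s]) (simp add: m_def)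
  then show ?thesis using ts(2) unfolding m_def by blast
qed

text \<open>The family is listed by cardinality, with the empty set in front, and padded with the
  whole block, which is largest and so keeps the list sorted. By \<open>0 < b\<close> the padding is
  nonempty.\<close>

lemma ex_enumeration:
  fixes b M :: nat
  assumes "{} \<in> F" "F \<subseteq> Pow {..<b}" "card F \<le> M" "0 < b"
  shows "\<exists>h. (\<forall>a<M. h a \<subseteq> {..<b}) \<and> (\<forall>a<M. h a = {} \<longleftrightarrow> a = 0) \<and>
    (\<forall>a a'. a \<le> a' \<longrightarrow> a' < M \<longrightarrow> card (h a) \<le> card (h a')) \<and> F \<subseteq> h ` {..<M}"
proof -
  have finF: "finite F" using assms(2) by (rule finite_subset) simp
  obtain ys where ys: "set ys = F - {{}}" "distinct ys" using finite_distinct_list[of "F - {{}}"] finF by auto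
  define zs where "zs = sort_key card ys @ replicate (M - card F) {..<b}"
  have "0 < card F" using finF assms(1) card_gt_0_iff by blast
  moreover have "length ys = card F - 1"
    using distinct_card[OF ys(2)] ys(1) finF assms(1) by simp
  ultimately have len: "length ({} # zs) = M" using assms(3) by (simp add: zs_def)
  have szs: "set zs \<subseteq> Pow {..<b} - {{}}"
    using ys(1) assms(2,4) by (auto simp: zs_def)
  have "card A \<le> b" if "A \<subseteq> {..<b}" for A using card_mono[OF _ that] by simp
  then have "sorted (map card ({} # zs))"
    using ys(1) assms(2) by (auto simp: zs_def sorted_append sorted_map sorted_sort_key[unfolded sorted_map])
  then have sorted: "card (({} # zs) ! a) \<le> card (({} # zs) ! a')" if "a \<le> a'" "a' < M" for a a'
  proof -
    have "map card ({} # zs) ! x = card (({} # zs) ! x)" if "x < M" for x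
      by (rule nth_map) (use that len in simp)
    then show ?thesis using sorted_nth_mono[OF \<open>sorted (map card ({} # zs))\<close>, of a a'] that len by simp
  qed
  have nth: "({} # zs) ! a \<in> Pow {..<b} - {{}}" if "0 < a" "a < M" for a
  proof -
    have "zs ! (a - 1) \<in> set zs" using that len by (intro nth_mem) simp
    then show ?thesis using szs that by (auto simp: nth_Cons')
  qed
  have "F \<subseteq> set ({} # zs)" using ys(1) by (auto simp: zs_def)
  also have "\<dots> = (!) ({} # zs) ` {..<M}" using len by (simp only: set_conv_nth) auto
  finally have F: "F \<subseteq> (!) ({} # zs) ` {..<M}" .
  show ?thesis
  proof (intro exI[of _ "(!) ({} # zs)"] conjI allI impI)
    fix a assume "a < M"
    then show "({} # zs) ! a \<subseteq> {..<b}" "({} # zs) ! a = {} \<longleftrightarrow> a = 0"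
      using nth[of a] by (cases "a = 0"; auto)+
  qed (use sorted F in auto)
qed

lemma covers_mono: "covers F xs \<Longrightarrow> F \<subseteq> G \<Longrightarrow> covers G xs"
  unfolding covers_def by blast

lemma ex_cover_tables:
  assumes "0 < b" "Gs \<noteq> []" "\<And>F. F \<in> set Gs \<Longrightarrow> {} \<in> F \<and> F \<subseteq> Pow {..<b} \<and> card F \<le> M"
    and cov: "\<And>xs. xs \<in> permutations_of_set {..<b} \<Longrightarrow> \<exists>F \<in> set Gs. covers F xs"
  shows "\<exists>dec. cover_tables b (length Gs) M dec"
proof -
  have "\<forall>i<length Gs. \<exists>h. (\<forall>a<M. h a \<subseteq> {..<b}) \<and> (\<forall>a<M. h a = {} \<longleftrightarrow> a = 0) \<and>
    (\<forall>a a'. a \<le> a' \<longrightarrow> a' < M \<longrightarrow> card (h a) \<le> card (h a')) \<and> Gs ! i \<subseteq> h ` {..<M}"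
  proof (intro allI impI)
    fix i assume "i < length Gs"
    then show "\<exists>h. (\<forall>a<M. h a \<subseteq> {..<b}) \<and> (\<forall>a<M. h a = {} \<longleftrightarrow> a = 0) \<and>
    (\<forall>a a'. a \<le> a' \<longrightarrow> a' < M \<longrightarrow> card (h a) \<le> card (h a')) \<and> Gs ! i \<subseteq> h ` {..<M}"
      using assms(3)[OF nth_mem] by (intro ex_enumeration[OF _ _ _ assms(1)]) auto
  qed
  then obtain dec where dec: "\<And>i. i < length Gs \<Longrightarrow> (\<forall>a<M. dec i a \<subseteq> {..<b}) \<and> (\<forall>a<M. dec i a = {} \<longleftrightarrow> a = 0) \<and>
    (\<forall>a a'. a \<le> a' \<longrightarrow> a' < M \<longrightarrow> card (dec i a) \<le> card (dec i a')) \<and> Gs ! i \<subseteq> dec i ` {..<M}"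
    by metis
  have "cover_tables b (length Gs) M dec"
  proof
    show "0 < b" by (rule assms(1))
    show "0 < length Gs" using assms(2) by simp
    have F: "{} \<in> hd Gs" "hd Gs \<subseteq> Pow {..<b}" "card (hd Gs) \<le> M"
      using assms(3)[of "hd Gs"] assms(2) by auto
    then have "finite (hd Gs)" by (meson finite_Pow_iff finite_lessThan finite_subset)
    then have "0 < card (hd Gs)" using F(1) card_gt_0_iff by blast
    then show "0 < M" using F(3) by simp
    show "\<exists>i<length Gs. covers (dec i ` {..<M}) xs" if xs: "xs \<in> permutations_of_set {..<b}" for xs
    proof -
      obtain i where i: "i < length Gs" "covers (Gs ! i) xs" using cov[OF xs] by (auto simp: in_set_conv_nth)
      then have "covers (dec i ` {..<M}) xs" using dec[OF i(1)] by (intro covers_mono[OF i(2)]) simp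
      then show ?thesis using i(1) by blast
    qed
  qed (use dec in blast)+
  then show ?thesis by blast
qed

section \<open>Polynomial factors and word length\<close>

lemma log_poly_small:
  assumes "1 < S" "0 < c"
  shows "(\<lambda>n. log S (c * real n ^ j)) \<in> o(\<lambda>n. real n)"
proof -
  have "(\<lambda>n::nat. (ln c + real j * ln (real n)) / ln S) \<in> o(\<lambda>n. real n)"
    using assms by real_asymp
  moreover have "eventually (\<lambda>n::nat. (ln c + real j * ln (real n)) / ln S = log S (c * real n ^ j)) sequentially"
    using eventually_gt_at_top[of 0]
    by eventually_elim (use assms in \<open>simp add: log_def ln_mult ln_realpow\<close>)
  ultimately show ?thesis using landau_o.small.in_cong by force
qed

text \<open>The factor \<open>c\<close> moves into the exponent; by \<open>log_poly_small\<close>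
  this shift is \<open>o(n)\<close> when \<open>c\<close> is a polynomial factor.\<close>

lemma le_powr_add_log:
  assumes "1 < S" "0 < c" "x \<le> c * S ^ n"
  shows "x \<le> S powr (real n + log S c)"
  using assms by (simp add: powr_add powr_realpow mult.commute)

text \<open>The incomplete last block costs one more factor \<open>A\<close>, a constant.\<close>

lemma pow_div_le:
  fixes A S :: real
  assumes "1 \<le> A" "A \<le> S ^ b" "1 \<le> S"
  shows "A ^ (n div b + 1) \<le> A * S ^ n"
proof -
  have "A ^ (n div b) \<le> (S ^ b) ^ (n div b)" using assms by (intro power_mono) auto
  also have "\<dots> = S ^ (b * (n div b))" by (simp add: power_mult)
  also have "\<dots> \<le> S ^ n" using assms by (intro power_increasing) auto
  finally show ?thesis using assms by simp
qed

lemma ex_word_length: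
  fixes M N b :: nat
  assumes "0 < M" "0 < N"
  shows "\<exists>k. \<forall>n \<ge> 1. n * n + M ^ (n div b + 1) * n + N ^ (n div b + 1) * n + M + 2 < 2 ^ (k * n)"
proof -
  \<comment> \<open>A sum chosen so that \<open>c ^ n\<close> bounds each part:
    \<open>n * n <= 4 ^ n\<close>, and \<open>A ^ (n div b + 1) * n <= (2 * A ^ 2) ^ n\<close> for
    \<open>A = M\<close> and \<open>A = N\<close>, because
    \<open>n div b + 1 <= 2 * n\<close>.\<close>
  define c where "c = 4 + 2 * M ^ 2 + 2 * N ^ 2 + M + 2"
  define k where "k = 4 * c"
  have k: "4 * c < 2 ^ k" unfolding k_def by (rule less_exp)
  have "n * n + M ^ (n div b + 1) * n + N ^ (n div b + 1) * n + M + 2 < 2 ^ (k * n)" if n: "1 \<le> n" for n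
  proof -
    have K: "n div b + 1 \<le> 2 * n" using div_le_dividend[of n b] n by linarith
    have n2: "n \<le> 2 ^ n" using less_exp[of n] by simp
    have p: "A ^ (n div b + 1) * n \<le> c ^ n" if "0 < A" "2 * A ^ 2 \<le> c" for A
    proof -
      have "A ^ (n div b + 1) * n \<le> A ^ (2 * n) * 2 ^ n"
        using K n2 that(1) by (intro mult_le_mono power_increasing) auto
      also have "\<dots> = (2 * A ^ 2) ^ n" by (simp add: power_mult power_mult_distrib)
      also have "\<dots> \<le> c ^ n" using that(2) by (intro power_mono) auto
      finally show ?thesis .
    qed
    have "n * n \<le> 2 ^ n * 2 ^ n" using n2 by (intro mult_le_mono)
    also have "\<dots> = 4 ^ n" by (simp flip: power_mult_distrib)
    also have "\<dots> \<le> c ^ n" by (intro power_mono) (auto simp: c_def)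
    finally have 1: "n * n \<le> c ^ n" .
    have 2: "M ^ (n div b + 1) * n \<le> c ^ n" "N ^ (n div b + 1) * n \<le> c ^ n"
      using p[of M] p[of N] assms by (auto simp: c_def)
    have "M + 2 \<le> c ^ 1" by (simp add: c_def)
    also have "\<dots> \<le> c ^ n" using n by (intro power_increasing) (auto simp: c_def)
    finally have 3: "M + 2 \<le> c ^ n" .
    have "n * n + M ^ (n div b + 1) * n + N ^ (n div b + 1) * n + M + 2 \<le> 4 * c ^ n" using 1 2 3 by linarith
    also have "\<dots> \<le> 4 ^ n * c ^ n" using n self_le_power[of "4::nat" n] by simp
    also have "\<dots> = (4 * c) ^ n" by (simp add: power_mult_distrib)
    also have "\<dots> < (2 ^ k) ^ n" using k n by (intro power_strict_mono) auto
    finally show ?thesis by (simp add: power_mult)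
  qed
  then show ?thesis by blast
qed

lemma feasible_tradeoff_of_cover_tables:
  assumes "cover_tables b N M dec" "1 < S" "1 < T" "real M \<le> S ^ b" "real N * real M \<le> T ^ b"
  shows "feasible_tradeoff S T"
proof -
  interpret cover_tables b N M dec by fact
  obtain k where k: "\<And>n. 1 \<le> n \<Longrightarrow>
      n * n + M ^ (n div b + 1) * n + N ^ (n div b + 1) * n + M + 2 < 2 ^ (k * n)"
    using ex_word_length[OF pos(3,2), of b] by blast
  \<comment> \<open>\<open>n ^ 3\<close> counts start cities, last cities and the scan over
    preceding cities; \<open>N * M\<close> pays for the extra block.\<close>
  define f where "f n = log T (80 * real N * real M * real n ^ 3)" for n :: nat
  define g where "g n = log S (4 * real M * real n ^ 2)" for n :: nat
  have f: "f \<in> o(\<lambda>n. real n)" and g: "g \<in> o(\<lambda>n. real n)"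
    unfolding f_def g_def using assms(2,3) pos by (auto intro!: log_poly_small)
  have "\<exists>t p. solves_tsp tsp_prog k n d t p \<and> real t \<le> T powr (real n + f n) \<and> real p \<le> S powr (real n + g n)"
    if n: "1 \<le> n" for n d
  proof -
    have NM: "1 \<le> real N * real M"
      using pos by (metis Suc_leI mult_pos_pos of_nat_1 of_nat_le_iff of_nat_mult One_nat_def)
    obtain t where t: "solves_tsp tsp_prog k n d t (2 * (n * n + M ^ (n div b + 1) * n))"
      "t \<le> 80 * n ^ 3 * N ^ (n div b + 1) * M ^ (n div b + 1)"
      using solves_tsp_prog[OF _ k[OF n], of d] n by auto
    have "real t \<le> real (80 * n ^ 3 * N ^ (n div b + 1) * M ^ (n div b + 1))"
      using t(2) by (simp only: of_nat_le_iff)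
    also have "\<dots> = 80 * real n ^ 3 * (real N * real M) ^ (n div b + 1)" by (simp add: power_mult_distrib)
    also have "\<dots> \<le> 80 * real n ^ 3 * ((real N * real M) * T ^ n)"
      using assms NM by (intro mult_left_mono pow_div_le) auto
    finally have "real t \<le> 80 * real N * real M * real n ^ 3 * T ^ n" by (simp add: mult_ac)
    then have T: "real t \<le> T powr (real n + f n)"
      unfolding f_def using assms(3) pos n by (intro le_powr_add_log) auto
    have "real (2 * (n * n + M ^ (n div b + 1) * n)) = 2 * (real n * real n + real M ^ (n div b + 1) * real n)"
      by simp
    also have "\<dots> \<le> 2 * (real M * real n ^ 2 * S ^ n + real M * real n ^ 2 * S ^ n)"
    proof -
      have "1 * 1 \<le> real M * S ^ n" using pos assms(2) by (intro mult_mono) auto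
      then have "real n ^ 2 * 1 \<le> real n ^ 2 * (real M * S ^ n)" by (intro mult_left_mono) auto
      then have 1: "real n * real n \<le> real M * real n ^ 2 * S ^ n" by (simp add: power2_eq_square mult_ac)
      have "real M ^ (n div b + 1) \<le> real M * S ^ n" using assms pos by (intro pow_div_le) auto
      then have "real M ^ (n div b + 1) * real n \<le> (real M * S ^ n) * real n ^ 2"
        using n assms(2) by (intro mult_mono) (auto simp: power2_eq_square)
      then have 2: "real M ^ (n div b + 1) * real n \<le> real M * real n ^ 2 * S ^ n" by (simp add: mult_ac)
      show ?thesis using 1 2 by (intro mult_left_mono add_mono) auto
    qed
    finally have "real (2 * (n * n + M ^ (n div b + 1) * n)) \<le> 4 * real M * real n ^ 2 * S ^ n"
      by (simp add: algebra_simps)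
    then have S: "real (2 * (n * n + M ^ (n div b + 1) * n)) \<le> S powr (real n + g n)"
      unfolding g_def using assms(2) pos n by (intro le_powr_add_log) auto
    show ?thesis by (intro exI conjI, rule t(1), rule T, rule S)
  qed
  then have all: "\<forall>n\<ge>1. \<forall>d. \<exists>t p. solves_tsp tsp_prog k n d t p \<and>
      real t \<le> T powr (real n + f n) \<and> real p \<le> S powr (real n + g n)" by blast
  have "\<exists>f \<in> o(\<lambda>n. real n). \<exists>g \<in> o(\<lambda>n. real n). \<forall>n\<ge>1. \<forall>d. \<exists>t p. solves_tsp tsp_prog k n d t p \<and>
      real t \<le> T powr (real n + f n) \<and> real p \<le> S powr (real n + g n)"
    by (rule bexI[of _ f], rule bexI[of _ g], rule all, rule g, rule f)
  then show ?thesis unfolding feasible_tradeoff_def using assms(2,3) by fastforce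
qed

theorem theorem1p2:
  "\<exists>T::real. T < 1.786 * sqrt 2 \<and> feasible_tradeoff (sqrt 2) T \<and> sqrt 2 * T < 3.572"
proof -
  obtain b M Gs where b: "0 < b" and Gs: "Gs \<noteq> []" "real M \<le> sqrt 2 ^ b"
    "real (length Gs) * real M < (1.786 * sqrt 2) ^ b"
    "\<forall>F \<in> set Gs. {} \<in> F \<and> F \<subseteq> Pow {..<b} \<and> card F \<le> M"
    "\<forall>xs \<in> permutations_of_set {..<b}. \<exists>F \<in> set Gs. covers F xs"
    using ex_good_cover by blast
  obtain dec where dec: "cover_tables b (length Gs) M dec"
    using ex_cover_tables[OF b Gs(1)] Gs(4,5) by blast
  define A where "A = real (length Gs) * real M"
  \<comment> \<open>The \<open>b\<close>-th root turns the strict inequality for a block into one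
    for the base. The maximum with \<open>2\<close>, still below \<open>1.786 * sqrt 2\<close>,
    provides \<open>1 < T\<close>.\<close>
  define T where "T = max 2 (root b A)"
  have "root b A < 1.786 * sqrt 2"
  proof -
    have "root b A < root b ((1.786 * sqrt 2) ^ b)" using b Gs(3) by (simp add: A_def)
    also have "\<dots> = 1.786 * sqrt 2" using b by (simp add: real_root_power_cancel)
    finally show ?thesis .
  qed
  moreover have "1.4 < sqrt 2" by (rule real_less_rsqrt) (simp add: power2_eq_square)
  ultimately have T: "T < 1.786 * sqrt 2" by (simp add: T_def)
  have "A = root b A ^ b" using b by (simp add: A_def)
  also have "\<dots> \<le> T ^ b" using b by (intro power_mono) (auto simp: T_def A_def)
  finally have "A \<le> T ^ b" .
  then have "feasible_tradeoff (sqrt 2) T"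
    using Gs(2) by (intro feasible_tradeoff_of_cover_tables[OF dec]) (auto simp: T_def A_def)
  moreover have "sqrt 2 * T < 3.572"
  proof -
    have "sqrt 2 * T < sqrt 2 * (1.786 * sqrt 2)" using T by (intro mult_strict_left_mono) auto
    also have "\<dots> = 1.786 * (sqrt 2 * sqrt 2)" by (simp only: mult_ac)
    finally show ?thesis by simp
  qed
  ultimately show ?thesis using T by blast
qed

end
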